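(* Let $\theta,\alpha\in(0,1)$ with $\theta$ irrational, let $\beta$ be an algebraic number with $|\beta|>1$, and let $f(x)\in\mathbb Z[x]$ be a non-constant polynomial. Then the series $\sum_{n=0}^\infty f(\lfloor n\theta+\alpha\rfloor)\,\beta^{-n}$ is a transcendental number.
   Context: $\lfloor r\rfloor$ denotes the integer part (floor) of a real number $r$. *)

theory Defs
  imports "HOL-Analysis.Analysis" "HOL-Computational_Algebra.Polynomial"
begin

end

theory Submission
  imports Defs "HOL-Complex_Analysis.Great_Picard" "HOL-Real_Asymp.Real_Asymp"
begin

text \<open>
  Write \<open>x = 1/\<beta>\<close>, \<open>s n = \<lfloor>n\<theta> + \<alpha>\<rfloor>\<close> and suppose the sum is algebraic. If \<open>p/q\<close> is close to \<open>\<theta>\<close>, then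
  \<open>s (n + q) = s n + p\<close> except on a sparse set of mismatches, where the two sides differ by one. Multiplying
  the series by \<open>(1 - x^q)^(deg f + 1)\<close> therefore leaves an explicit polynomial in \<open>x\<close> plus \<open>x^q\<close> times a series
  supported on the mismatches, whose value is algebraic of size \<open>O(q)\<close> in the sense of Liouville's inequality.

  Let \<open>p/q\<close>, \<open>P/Q\<close> be Farey neighbours enclosing \<open>\<theta>\<close>. Mismatches for the shift by \<open>q\<close> are at least \<open>Q\<close> apart.
  If \<open>\<theta>\<close> is not badly approximable, neighbours with \<open>Q/q\<close> (or \<open>q/Q\<close>) arbitrarily large exist; after removing
  at most one early term the mismatch series is nonzero and too small for Liouville's inequality.

  If \<open>\<theta>\<close> is badly approximable, then \<open>q\<close> and \<open>Q\<close> are comparable. The mismatches are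
  \<open>n\<^sub>0 + iQ + b\<^sub>i q\<close> with a Sturmian sequence \<open>b\<close>, so the mismatch series is, up to a power of \<open>x\<close>, the value at
  \<open>X = x^Q\<close>, \<open>Y = x^q\<close> of \<open>G = \<Sum>i. w\<^sub>i(Y) Y^(b\<^sub>i) X^i\<close>. As in Mahler's method, Siegel's lemma gives a polynomial in
  \<open>X, Y, G\<close> of bounded degree that vanishes to high order in \<open>X\<close>, and its value contradicts Liouville's inequality
  unless it is zero. To exclude zero, one lets the neighbours grow: a limit of the functions \<open>G\<close> is
  transcendental, so one fixed coefficient of the auxiliary series is nonzero infinitely often. As the
  numbers \<open>iQ + jq\<close> are well separated, the lowest monomial then dominates the value.
\<close>

section \<open>Siegel's lemma and Liouville's inequality\<close>

text \<open>Algebraicity is used in one way only: a nonzero number of level \<open>L\<close> is at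
  least \<kappa>^L, and all values that occur have level O(q). Every contradiction therefore needs a
  nonzero value below C^(-q) for each fixed C. Long gaps give this directly. For comparable q and Q
  the next mismatch comes after O(q) places, so discarding finitely many terms never wins, and
  smallness must come from a high order of vanishing. With degree d in each of X, Y and G there are
  (d + 1)^3 coefficients; vanishing to order n * d in X costs O(n^2 d^2) linear conditions, because
  the Y-degree grows linearly with the X-degree. So n can be as large as desired once d is large,
  while the level grows only like d * Q. The obstacle is that no single function with a functional
  equation is available: slope, intercept and weights of G change with the pair. Bad approximability
  repairs this twice. It keeps the slopes bounded and uniformly away from each rational, so that
  limits of slopes are irrational; and it keeps the exponents \<open>i * Q + j * q\<close> apart.
  The weights grow like a power of Q and have to be normalised before a limit can be taken.\<close>

lemma siegel_pigeonhole:
  fixes A :: "'i \<Rightarrow> 'j \<Rightarrow> int" and B :: int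
  assumes fin: "finite I" "finite J" and card: "card I < card J" and B: "1 \<le> B"
    and A: "\<And>i j. i \<in> I \<Longrightarrow> j \<in> J \<Longrightarrow> \<bar>A i j\<bar> \<le> B"
  obtains c where "\<exists>j\<in>J. c j \<noteq> 0" "\<And>i. i \<in> I \<Longrightarrow> (\<Sum>j\<in>J. A i j * c j) = 0"
    "\<And>j. j \<in> J \<Longrightarrow> \<bar>c j\<bar> \<le> (2 * int (card J) * B + 1) ^ card I"
proof -
  define n where "n = int (card J)"
  \<comment> \<open>The count below needs ((2nB + 1) H)^card I < (H + 1)^card J; with this H the
    left side is H^(card I + 1). Sharper exponents exist, but \<open>card I\<close> is fixed in both
    applications, so only polynomial dependence on \<open>B\<close> matters.\<close>
  define H where "H = (2 * n * B + 1) ^ card I"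
  define U where "U = PiE J (\<lambda>_. {0..H})"
  define V where "V = PiE I (\<lambda>_. {- (n * B * H)..n * B * H})"
  define T where "T = (\<lambda>c. restrict (\<lambda>i. \<Sum>j\<in>J. A i j * c j) I)"
  have n: "n \<ge> 1" using card by (simp add: n_def)
  have nB: "n * B \<ge> 1" using n B by (smt (verit) mult_less_cancel_right2)
  have H: "H \<ge> 1" unfolding H_def using nB by (intro one_le_power) (simp add: mult.assoc)
  have "T ` U \<subseteq> V"
  proof
    fix g assume "g \<in> T ` U"
    then obtain c where c: "c \<in> U" and g: "g = T c" by blast
    have "\<bar>\<Sum>j\<in>J. A i j * c j\<bar> \<le> n * B * H" if "i \<in> I" for i
    proof -
      have "\<bar>A i j * c j\<bar> \<le> B * H" if "j \<in> J" for j
      proof -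
        have "0 \<le> c j" "c j \<le> H" using c that by (auto simp: U_def PiE_iff)
        then show ?thesis unfolding abs_mult using A[OF \<open>i \<in> I\<close> that] B
          by (intro mult_mono) auto
      qed
      then have "(\<Sum>j\<in>J. \<bar>A i j * c j\<bar>) \<le> of_nat (card J) * (B * H)"
        by (intro sum_bounded_above) auto
      with sum_abs[of "\<lambda>j. A i j * c j" J] have "\<bar>\<Sum>j\<in>J. A i j * c j\<bar> \<le> int (card J) * (B * H)"
        by (rule order.trans)
      then show ?thesis by (simp only: n_def mult.assoc)
    qed
    then show "g \<in> V" unfolding g T_def V_def by (auto simp: PiE_iff abs_le_iff) fastforce
  qed
  moreover have "finite V" unfolding V_def using fin by (intro finite_PiE) auto
  ultimately have "card (T ` U) \<le> card V" by (intro card_mono)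
  also have "int (card V) = (2 * (n * B * H) + 1) ^ card I"
  proof -
    have "0 \<le> w \<Longrightarrow> int (card (PiE I (\<lambda>_. {-w..w}))) = (2 * w + 1) ^ card I" for w
      using fin by (simp add: card_PiE)
    then show ?thesis unfolding V_def using nB H by simp
  qed
  also have "\<dots> \<le> ((2 * n * B + 1) * H) ^ card I"
  proof (rule power_mono)
    show "2 * (n * B * H) + 1 \<le> (2 * n * B + 1) * H" using H by (simp add: algebra_simps)
    show "0 \<le> 2 * (n * B * H) + 1" using nB H by simp
  qed
  also have "\<dots> = H * H ^ card I" by (simp add: power_mult_distrib H_def)
  also have "\<dots> = H ^ Suc (card I)" by simp
  also have "\<dots> < (H + 1) ^ Suc (card I)" using H by (intro power_strict_mono) auto
  also have "\<dots> \<le> (H + 1) ^ card J" using card H by (intro power_increasing) auto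
  also have "\<dots> = int (card U)" unfolding U_def using fin H by (simp add: card_PiE)
  finally have "card (T ` U) < card U" by simp
  then have "\<not> inj_on T U" by (rule pigeonhole)
  then obtain c d where cd: "c \<in> U" "d \<in> U" "T c = T d" "c \<noteq> d" by (auto simp: inj_on_def)
  have "\<exists>j\<in>J. c j \<noteq> d j" using cd unfolding U_def by (metis PiE_ext)
  moreover have "(\<Sum>j\<in>J. A i j * (c j - d j)) = 0" if "i \<in> I" for i
    using fun_cong[OF cd(3), of i] that by (simp add: T_def right_diff_distrib sum_subtractf)
  moreover have "\<bar>c j - d j\<bar> \<le> H" if "j \<in> J" for j
  proof -
    have "c j \<in> {0..H}" "d j \<in> {0..H}" using cd that by (auto simp: U_def PiE_iff)
    then show ?thesis by auto
  qed
  ultimately show thesis using that[of "\<lambda>j. c j - d j"] by (simp add: H_def n_def)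
qed

section \<open>Algebraic integers and denominators\<close>

lemma poly_map_of_int_altdef:
  "poly (map_poly of_int p) (b :: complex) = (\<Sum>i\<le>degree p. of_int (coeff p i) * b ^ i)"
  by (simp add: poly_altdef degree_map_poly coeff_map_poly)

text \<open>Reduction by the monic relation. The coefficients are not bounded, because only the
  finitely many products of generators will be expanded.\<close>

lemma algebraic_int_powers_span:
  fixes b :: complex
  assumes "algebraic_int b"
  obtains r where "\<And>n. \<exists>c::nat \<Rightarrow> int. b ^ n = (\<Sum>l<r. of_int (c l) * b ^ l)"
proof -
  from assms obtain p where p: "poly (map_poly of_int p) b = 0" "lead_coeff p = 1"
    unfolding algebraic_int_altdef_ipoly by blast
  define r where "r = degree p"
  have "0 = (\<Sum>i\<le>r. of_int (coeff p i) * b ^ i)"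
    using p(1) by (simp add: poly_map_of_int_altdef r_def)
  also have "\<dots> = (\<Sum>i<r. of_int (coeff p i) * b ^ i) + b ^ r"
    using p(2) by (simp add: r_def lessThan_Suc_atMost[symmetric])
  finally have br: "b ^ r = (\<Sum>i<r. of_int (- coeff p i) * b ^ i)"
    by (simp add: eq_neg_iff_add_eq_0 sum_negf add.commute)
  have "\<exists>c::nat \<Rightarrow> int. b ^ n = (\<Sum>l<r. of_int (c l) * b ^ l)" for n
  proof (induction n)
    case 0
    show ?case
    proof (cases "r = 0")
      case True
      then show ?thesis using br by simp
    next
      case False
      have "(\<Sum>l<r. of_int (if l = 0 then 1 else 0) * b ^ l) = (\<Sum>l<r. if l = 0 then 1 else 0)"
        by (intro sum.cong) auto
      also have "\<dots> = 1" using False by simp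
      finally show ?thesis by (intro exI[of _ "\<lambda>l. if l = 0 then 1 else 0"]) simp
    qed
  next
    case (Suc n)
    then obtain c where c: "b ^ n = (\<Sum>l<r. of_int (c l) * b ^ l)" by blast
    show ?case
    proof (cases r)
      case 0
      then show ?thesis using c by simp
    next
      case (Suc r')
      define d where "d l = (if l = 0 then 0 else c (l - 1)) - c r' * coeff p l" for l
      have "b ^ Suc n = (\<Sum>l<r. of_int (c l) * b ^ Suc l)"
        unfolding power_Suc c sum_distrib_left by (intro sum.cong) auto
      also have "\<dots> = (\<Sum>l<r'. of_int (c l) * b ^ Suc l) + of_int (c r') * b ^ r"
        by (simp add: Suc)
      also have "(\<Sum>l<r'. of_int (c l) * b ^ Suc l) = (\<Sum>l<r. of_int (if l = 0 then 0 else c (l - 1)) * b ^ l)"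
        unfolding Suc by (subst sum.lessThan_Suc_shift) simp
      also have "of_int (c r') * b ^ r = (\<Sum>l<r. of_int (- c r' * coeff p l) * b ^ l)"
        unfolding br sum_distrib_left by (intro sum.cong) (auto simp: mult.assoc)
      also have "(\<Sum>l<r. of_int (if l = 0 then 0 else c (l - 1)) * b ^ l) + \<dots> = (\<Sum>l<r. of_int (d l) * b ^ l)"
        unfolding sum.distrib[symmetric] by (intro sum.cong) (auto simp: d_def algebra_simps)
      finally show ?thesis by blast
    qed
  qed
  then show thesis by (rule that)
qed

lemma algebraic_imp_multiple_algebraic_int:
  fixes b :: complex
  assumes "algebraic b"
  obtains a :: int where "a \<ge> 1" "algebraic_int (of_int a * b)"
proof -
  from assms obtain p where p: "p \<noteq> 0" "poly (map_poly of_int p) b = 0" by (erule algebraicE')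
  define n where "n = degree p"
  define a where "a = lead_coeff p"
  have a0: "a \<noteq> 0" using p by (simp add: a_def)
  have n0: "n \<noteq> 0"
  proof
    assume "n = 0"
    then obtain k where "p = [:k:]" by (metis degree_eq_zeroE n_def)
    then show False using p by (simp add: map_poly_pCons)
  qed
  \<comment> \<open>This is a^(n-1) p(z / a), which is monic with integer coefficients and vanishes
    at a * b.\<close>
  define P where "P = (\<Sum>i<n. monom (coeff p i * a ^ (n - 1 - i)) i) + monom 1 n"
  have cP: "coeff P i = (if i < n then coeff p i * a ^ (n - 1 - i) else if i = n then 1 else 0)" for i
    by (auto simp: P_def coeff_sum sum.delta)
  have "degree P = n" by (rule antisym) (auto intro!: degree_le le_degree simp: cP)
  then have lc: "lead_coeff P = 1" by (simp add: cP)
  have "poly (map_poly of_int P) (of_int a * b) = (\<Sum>i\<le>n. of_int (coeff P i) * (of_int a * b) ^ i)"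
    using \<open>degree P = n\<close> by (simp add: poly_map_of_int_altdef)
  also have "\<dots> = (\<Sum>i\<le>n. of_int a ^ (n - 1) * (of_int (coeff p i) * b ^ i))"
  proof (rule sum.cong[OF refl])
    fix i assume "i \<in> {..n}"
    then consider "i < n" | "i = n" by fastforce
    then show "of_int (coeff P i) * (of_int a * b) ^ i = of_int a ^ (n - 1) * (of_int (coeff p i) * b ^ i)"
    proof cases
      case 1
      have "(of_int a :: complex) ^ (n - 1) = of_int a ^ (n - 1 - i) * of_int a ^ i"
        using 1 by (simp flip: power_add)
      then show ?thesis using 1 by (simp add: cP power_mult_distrib)
    next
      case 2
      have "(of_int a :: complex) ^ n = of_int a ^ (n - 1) * of_int a"
        using n0 by (simp flip: power_Suc2)
      then show ?thesis using 2 by (simp add: cP power_mult_distrib a_def n_def)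
    qed
  qed
  also have "\<dots> = 0" using p(2) by (simp add: poly_map_of_int_altdef n_def flip: sum_distrib_left)
  finally have ai: "algebraic_int (of_int a * b)" using lc unfolding algebraic_int_altdef_ipoly by blast
  show thesis
  proof (cases "a \<ge> 1")
    case True
    then show thesis using ai that by blast
  next
    case False
    then have "- a \<ge> 1" using a0 by simp
    moreover have "algebraic_int (of_int (- a) * b)" using algebraic_int_minus[OF ai] by simp
    ultimately show thesis using that by blast
  qed
qed

text \<open>
  \<open>Z L\<close> plays the role of the algebraic numbers of logarithmic height at most \<open>L\<close> in a fixed order:
  integer combinations of a basis with coefficients and denominator exponential in \<open>L\<close>. The lower
  bound comes from a small integer relation among the powers of \<open>\<rho>\<close>, supplied by Siegel's lemma.
\<close>
lemma liouville_filtration_of_basis: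
  fixes \<beta> S :: complex and v :: "'i \<Rightarrow> complex" and t :: "'i \<Rightarrow> 'i \<Rightarrow> 'i \<Rightarrow> int" and a :: int
  assumes fin: "finite I" and a: "a \<ge> 1"
    and mult: "\<And>i j. i \<in> I \<Longrightarrow> j \<in> I \<Longrightarrow> v i * v j = (\<Sum>l\<in>I. of_int (t i j l) * v l)"
    and one: "1 = (\<Sum>l\<in>I. of_int (e1 l) * v l)"
    and beta: "of_int a * \<beta> = (\<Sum>l\<in>I. of_int (e2 l) * v l)"
    and S: "of_int a * S = (\<Sum>l\<in>I. of_int (e3 l) * v l)"
  obtains Z :: "nat \<Rightarrow> complex set" and \<kappa> :: real where "0 < \<kappa>" "\<kappa> \<le> 1"
    "\<And>L M. L \<le> M \<Longrightarrow> Z L \<subseteq> Z M"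
    "\<And>L M u v. u \<in> Z L \<Longrightarrow> v \<in> Z M \<Longrightarrow> u * v \<in> Z (L + M)"
    "\<And>L u v. u \<in> Z L \<Longrightarrow> v \<in> Z L \<Longrightarrow> u + v \<in> Z (L + 1)"
    "\<And>L n. 1 \<le> L \<Longrightarrow> \<bar>n\<bar> \<le> 2 ^ L \<Longrightarrow> of_int n \<in> Z L"
    "\<beta> \<in> Z 1" "S \<in> Z 1"
    "\<And>L \<rho>. 1 \<le> L \<Longrightarrow> \<rho> \<in> Z L \<Longrightarrow> \<rho> \<noteq> 0 \<Longrightarrow> \<kappa> ^ L \<le> norm \<rho>"
proof -
  define r where "r = card I"
  define T where "T = 1 + (\<Sum>i\<in>I. \<Sum>j\<in>I. \<Sum>l\<in>I. \<bar>t i j l\<bar>) + (\<Sum>l\<in>I. \<bar>e1 l\<bar>) + (\<Sum>l\<in>I. \<bar>e2 l\<bar>) + (\<Sum>l\<in>I. \<bar>e3 l\<bar>)"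
  have nonneg: "0 \<le> (\<Sum>i\<in>I. \<Sum>j\<in>I. \<Sum>l\<in>I. \<bar>t i j l\<bar>)" "0 \<le> (\<Sum>l\<in>I. \<bar>e1 l\<bar>)" "0 \<le> (\<Sum>l\<in>I. \<bar>e2 l\<bar>)" "0 \<le> (\<Sum>l\<in>I. \<bar>e3 l\<bar>)"
    by (auto intro!: sum_nonneg)
  have T1: "T \<ge> 1" using nonneg by (simp add: T_def)
  have le_e: "\<bar>e1 l\<bar> \<le> T" "\<bar>e2 l\<bar> \<le> T" "\<bar>e3 l\<bar> \<le> T" if "l \<in> I" for l
    using nonneg member_le_sum[of l I "\<lambda>l. \<bar>e1 l\<bar>"] member_le_sum[of l I "\<lambda>l. \<bar>e2 l\<bar>"]
      member_le_sum[of l I "\<lambda>l. \<bar>e3 l\<bar>"] fin that by (auto simp: T_def)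
  have le_t: "\<bar>t i j l\<bar> \<le> T" if "i \<in> I" "j \<in> I" "l \<in> I" for i j l
  proof -
    have "\<bar>t i j l\<bar> \<le> (\<Sum>l\<in>I. \<bar>t i j l\<bar>)" using that fin by (intro member_le_sum) auto
    also have "\<dots> \<le> (\<Sum>j\<in>I. \<Sum>l\<in>I. \<bar>t i j l\<bar>)"
      using that fin by (intro member_le_sum[of j I "\<lambda>j. \<Sum>l\<in>I. \<bar>t i j l\<bar>"]) (auto intro!: sum_nonneg)
    also have "\<dots> \<le> (\<Sum>i\<in>I. \<Sum>j\<in>I. \<Sum>l\<in>I. \<bar>t i j l\<bar>)"
      using that fin by (intro member_le_sum[of i I "\<lambda>i. \<Sum>j\<in>I. \<Sum>l\<in>I. \<bar>t i j l\<bar>"]) (auto intro!: sum_nonneg)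
    finally show ?thesis using nonneg unfolding T_def by linarith
  qed
  define M where "M = int r * int r * T + 1"
  have M1: "M \<ge> 1" using T1 by (simp add: M_def)
  \<comment> \<open>The factor 2 * a pays for one more power of the denominator together with one
    addition; M * T pays for the coordinates of integers and of the two generators.\<close>
  define k where "k = 2 * a * M * T"
  have aM: "M * T \<ge> 1" using mult_mono[of 1 M 1 T] M1 T1 by simp
  have k2: "k \<ge> 2 * a"
  proof -
    have "2 * a * 1 \<le> 2 * a * (M * T)" using a aM by (intro mult_left_mono) auto
    then show ?thesis by (simp add: k_def mult.assoc)
  qed
  have kMT: "k \<ge> T * M"
  proof -
    have "1 * (M * T) \<le> (2 * a) * (M * T)" using a aM by (intro mult_right_mono) auto
    then show ?thesis by (simp add: k_def mult_ac)
  qed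
  have k1: "k \<ge> 1" using k2 a by simp
  \<comment> \<open>Vectors bounded by p and q have a product bounded by M * p * q. Putting the
    weight M into the definition absorbs this loss, so that levels simply add under multiplication.
    The \<open>v i\<close> only have to generate, hence the coordinates are merely required to
    exist.\<close>
  define Z where "Z L = {\<rho>. \<exists>c. of_int (a ^ L) * \<rho> = (\<Sum>i\<in>I. of_int (c i) * v i) \<and> (\<forall>i\<in>I. \<bar>c i\<bar> * M \<le> k ^ L)}" for L
  have ZI: "\<rho> \<in> Z L" if "of_int (a ^ L) * \<rho> = (\<Sum>i\<in>I. of_int (c i) * v i)" "\<And>i. i \<in> I \<Longrightarrow> \<bar>c i\<bar> * M \<le> k ^ L" for \<rho> c L
    using that by (auto simp: Z_def)
  have ZE: "\<exists>c. of_int (a ^ L) * \<rho> = (\<Sum>i\<in>I. of_int (c i) * v i) \<and> (\<forall>i\<in>I. \<bar>c i\<bar> * M \<le> k ^ L)" if "\<rho> \<in> Z L" for \<rho> L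
    using that by (auto simp: Z_def)
  have Zsuc: "Z L \<subseteq> Z (Suc L)" for L
  proof
    fix \<rho> assume "\<rho> \<in> Z L"
    then obtain c where c: "of_int (a ^ L) * \<rho> = (\<Sum>i\<in>I. of_int (c i) * v i)" "\<forall>i\<in>I. \<bar>c i\<bar> * M \<le> k ^ L"
      using ZE by blast
    show "\<rho> \<in> Z (Suc L)"
    proof (rule ZI)
      have "of_int (a ^ Suc L) * \<rho> = of_int a * (of_int (a ^ L) * \<rho>)" by simp
      also have "\<dots> = (\<Sum>i\<in>I. of_int (a * c i) * v i)" unfolding c(1) by (simp add: sum_distrib_left mult.assoc)
      finally show "of_int (a ^ Suc L) * \<rho> = (\<Sum>i\<in>I. of_int (a * c i) * v i)" .
      show "\<bar>a * c i\<bar> * M \<le> k ^ Suc L" if "i \<in> I" for i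
      proof -
        have "\<bar>a * c i\<bar> * M = a * (\<bar>c i\<bar> * M)" using a by (simp add: abs_mult)
        also have "\<dots> \<le> k * k ^ L" using c(2) that a k2 M1 by (intro mult_mono) auto
        finally show ?thesis by simp
      qed
    qed
  qed
  have Zmono: "Z L \<subseteq> Z N" if "L \<le> N" for L N
    using lift_Suc_mono_le[of Z, OF Zsuc that] .
  have Zmult: "u * w \<in> Z (L + N)" if u: "u \<in> Z L" and w: "w \<in> Z N" for L N u w
  proof -
    obtain c where c: "of_int (a ^ L) * u = (\<Sum>i\<in>I. of_int (c i) * v i)" "\<forall>i\<in>I. \<bar>c i\<bar> * M \<le> k ^ L"
      using ZE[OF u] by blast
    obtain d where d: "of_int (a ^ N) * w = (\<Sum>i\<in>I. of_int (d i) * v i)" "\<forall>i\<in>I. \<bar>d i\<bar> * M \<le> k ^ N"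
      using ZE[OF w] by blast
    show ?thesis
    proof (rule ZI)
      have "of_int (a ^ (L + N)) * (u * w) = (of_int (a ^ L) * u) * (of_int (a ^ N) * w)"
        by (simp add: power_add)
      also have "\<dots> = (\<Sum>i\<in>I. \<Sum>j\<in>I. of_int (c i * d j) * (v i * v j))"
        unfolding c(1) d(1) sum_product by (simp add: mult_ac)
      also have "\<dots> = (\<Sum>i\<in>I. \<Sum>j\<in>I. \<Sum>l\<in>I. of_int (c i * d j * t i j l) * v l)"
        by (intro sum.cong refl) (simp add: mult sum_distrib_left mult_ac)
      also have "\<dots> = (\<Sum>i\<in>I. \<Sum>l\<in>I. \<Sum>j\<in>I. of_int (c i * d j * t i j l) * v l)"
        by (intro sum.cong refl sum.swap)
      also have "\<dots> = (\<Sum>l\<in>I. \<Sum>i\<in>I. \<Sum>j\<in>I. of_int (c i * d j * t i j l) * v l)"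
        by (rule sum.swap)
      also have "\<dots> = (\<Sum>l\<in>I. of_int (\<Sum>i\<in>I. \<Sum>j\<in>I. c i * d j * t i j l) * v l)"
        by (simp add: sum_distrib_right)
      finally show "of_int (a ^ (L + N)) * (u * w) = (\<Sum>l\<in>I. of_int (\<Sum>i\<in>I. \<Sum>j\<in>I. c i * d j * t i j l) * v l)" .
      fix l assume l: "l \<in> I"
      define p where "p = k ^ L div M"
      define q where "q = k ^ N div M"
      have cp: "\<bar>c i\<bar> \<le> p" if "i \<in> I" for i using zdiv_mono1[OF c(2)[rule_format, OF that], of M] M1 unfolding p_def by simp
      have dq: "\<bar>d i\<bar> \<le> q" if "i \<in> I" for i using zdiv_mono1[OF d(2)[rule_format, OF that], of M] M1 unfolding q_def by simp
      have pq0: "p \<ge> 0" "q \<ge> 0" using k1 M1 by (auto simp: p_def q_def pos_imp_zdiv_nonneg_iff)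
      have "\<bar>\<Sum>i\<in>I. \<Sum>j\<in>I. c i * d j * t i j l\<bar> \<le> (\<Sum>i\<in>I. \<Sum>j\<in>I. \<bar>c i * d j * t i j l\<bar>)"
        by (intro order.trans[OF sum_abs] sum_mono sum_abs)
      also have "\<dots> \<le> (\<Sum>i\<in>I. \<Sum>j\<in>I. p * q * T)"
        unfolding abs_mult using cp dq le_t l pq0 T1 by (intro sum_mono mult_mono) auto
      also have "\<dots> = (int r * int r * T) * (p * q)" by (simp add: r_def)
      also have "\<dots> \<le> M * (p * q)" using pq0 by (intro mult_right_mono) (auto simp: M_def)
      finally have "\<bar>\<Sum>i\<in>I. \<Sum>j\<in>I. c i * d j * t i j l\<bar> * M \<le> (M * (p * q)) * M"
        using M1 by (intro mult_right_mono) auto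
      also have "\<dots> = (p * M) * (q * M)" by simp
      also have "\<dots> \<le> k ^ L * k ^ N"
      proof (rule mult_mono)
        show "p * M \<le> k ^ L" unfolding p_def using div_mult_mod_eq[of "k ^ L" M] pos_mod_sign[of M "k ^ L"] M1 by linarith
        show "q * M \<le> k ^ N" unfolding q_def using div_mult_mod_eq[of "k ^ N" M] pos_mod_sign[of M "k ^ N"] M1 by linarith
      qed (use M1 pq0 k1 in auto)
      finally show "\<bar>\<Sum>i\<in>I. \<Sum>j\<in>I. c i * d j * t i j l\<bar> * M \<le> k ^ (L + N)" by (simp add: power_add)
    qed
  qed
  have Zadd: "u + w \<in> Z (L + 1)" if u: "u \<in> Z L" and w: "w \<in> Z L" for L u w
  proof -
    obtain c where c: "of_int (a ^ L) * u = (\<Sum>i\<in>I. of_int (c i) * v i)" "\<forall>i\<in>I. \<bar>c i\<bar> * M \<le> k ^ L"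
      using ZE[OF u] by blast
    obtain d where d: "of_int (a ^ L) * w = (\<Sum>i\<in>I. of_int (d i) * v i)" "\<forall>i\<in>I. \<bar>d i\<bar> * M \<le> k ^ L"
      using ZE[OF w] by blast
    show ?thesis
    proof (rule ZI)
      have "of_int (a ^ (L + 1)) * (u + w) = of_int a * (of_int (a ^ L) * u + of_int (a ^ L) * w)"
        by (simp add: algebra_simps)
      also have "\<dots> = (\<Sum>i\<in>I. of_int (a * (c i + d i)) * v i)"
        unfolding c(1) d(1) by (simp add: sum_distrib_left sum.distrib algebra_simps)
      finally show "of_int (a ^ (L + 1)) * (u + w) = (\<Sum>i\<in>I. of_int (a * (c i + d i)) * v i)" .
      fix i assume i: "i \<in> I"
      have "\<bar>a * (c i + d i)\<bar> * M \<le> a * (\<bar>c i\<bar> * M + \<bar>d i\<bar> * M)"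
        using a M1 by (simp add: abs_mult flip: distrib_right)
      also have "\<dots> \<le> a * (2 * k ^ L)" using c(2) d(2) i a by (intro mult_left_mono) fastforce+
      also have "\<dots> = (2 * a) * k ^ L" by simp
      also have "\<dots> \<le> k * k ^ L" using k2 k1 by (intro mult_right_mono) auto
      finally show "\<bar>a * (c i + d i)\<bar> * M \<le> k ^ (L + 1)" by simp
    qed
  qed
  have Zint: "of_int n \<in> Z L" if L: "1 \<le> L" and n: "\<bar>n\<bar> \<le> 2 ^ L" for L n
  proof (rule ZI)
    show "of_int (a ^ L) * of_int n = (\<Sum>i\<in>I. of_int (a ^ L * n * e1 i) * v i)"
      using arg_cong[OF one, of "\<lambda>z. of_int (a ^ L * n) * z"] by (simp add: sum_distrib_left mult.assoc)
    fix i assume i: "i \<in> I"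
    have MT: "M * T \<le> (M * T) ^ L" using aM L by (simp add: self_le_power)
    have "\<bar>a ^ L * n * e1 i\<bar> * M = a ^ L * \<bar>n\<bar> * (\<bar>e1 i\<bar> * M)" using a by (simp add: abs_mult)
    also have "\<dots> \<le> a ^ L * 2 ^ L * (T * M)"
      using n le_e(1)[OF i] a M1 by (intro mult_mono mult_nonneg_nonneg) auto
    also have "\<dots> \<le> a ^ L * 2 ^ L * (M * T) ^ L" using MT a by (intro mult_left_mono) (auto simp: mult.commute)
    also have "\<dots> = k ^ L" by (simp add: k_def power_mult_distrib)
    finally show "\<bar>a ^ L * n * e1 i\<bar> * M \<le> k ^ L" .
  qed
  have Zbeta: "\<beta> \<in> Z 1"
  proof (rule ZI)
    show "of_int (a ^ 1) * \<beta> = (\<Sum>i\<in>I. of_int (e2 i) * v i)" using beta by simp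
    show "\<bar>e2 i\<bar> * M \<le> k ^ 1" if "i \<in> I" for i
      using order.trans[OF mult_right_mono[OF le_e(2)[OF that]] kMT] M1 by simp
  qed
  have ZS: "S \<in> Z 1"
  proof (rule ZI)
    show "of_int (a ^ 1) * S = (\<Sum>i\<in>I. of_int (e3 i) * v i)" using S by simp
    show "\<bar>e3 i\<bar> * M \<le> k ^ 1" if "i \<in> I" for i
      using order.trans[OF mult_right_mono[OF le_e(3)[OF that]] kMT] M1 by simp
  qed
  define R where "R = real (r + 1)"
  define K where "K = R * (3 * R) ^ r * real_of_int k ^ ((r + 1) * r)"
  have R1: "R \<ge> 1" by (simp add: R_def)
  have K1: "K \<ge> 1"
  proof -
    have "1 * 1 * 1 \<le> R * (3 * R) ^ r * real_of_int k ^ ((r + 1) * r)"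
      using R1 k1 by (intro mult_mono one_le_power) auto
    then show ?thesis by (simp add: K_def)
  qed
  have lower: "(1 / K) ^ L \<le> norm \<rho>" if L: "1 \<le> L" and \<rho>: "\<rho> \<in> Z L" "\<rho> \<noteq> 0" for L \<rho>
  proof (cases "norm \<rho> \<ge> 1")
    case True
    have "(1 / K) ^ L \<le> 1" using K1 by (intro power_le_one) auto
    then show ?thesis using True by simp
  next
    case False
    \<comment> \<open>One common level for 1, \<rho>, ..., \<rho>^r; with r + 1 instead of r it
      stays positive when r = 0.\<close>
    define N where "N = L * (r + 1)"
    have N1: "N \<ge> 1" using L by (simp add: N_def)
    have pw: "\<rho> ^ s \<in> Z (L * s)" if "s \<ge> 1" for s
      using that
    proof (induction s rule: dec_induct)
      case base
      then show ?case using \<rho> by simp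
    next
      case (step s)
      then show ?case using Zmult[OF \<rho>(1) step.IH] by simp
    qed
    have "\<rho> ^ s \<in> Z N" if "s \<le> r" for s
    proof (cases "s = 0")
      case True
      have "of_int 1 \<in> Z N" using N1 by (intro Zint) auto
      then show ?thesis using True by simp
    next
      case False
      then have "\<rho> ^ s \<in> Z (L * s)" by (intro pw) auto
      also have "\<dots> \<subseteq> Z N" using mult_le_mono2[of s "r + 1" L] that by (intro Zmono) (simp add: N_def)
      finally show ?thesis .
    qed
    then have "\<forall>s. \<exists>c. s \<le> r \<longrightarrow> of_int (a ^ N) * \<rho> ^ s = (\<Sum>i\<in>I. of_int (c i) * v i) \<and> (\<forall>i\<in>I. \<bar>c i\<bar> * M \<le> k ^ N)"
      using ZE by blast
    then obtain c where c: "\<And>s. s \<le> r \<Longrightarrow> of_int (a ^ N) * \<rho> ^ s = (\<Sum>i\<in>I. of_int (c s i) * v i)"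
      "\<And>s i. s \<le> r \<Longrightarrow> i \<in> I \<Longrightarrow> \<bar>c s i\<bar> * M \<le> k ^ N" by metis
    have cb: "\<bar>c s i\<bar> \<le> k ^ N" if "i \<in> I" "s \<in> {..r}" for s i
    proof -
      have "\<bar>c s i\<bar> * 1 \<le> \<bar>c s i\<bar> * M" using M1 by (intro mult_left_mono) auto
      then show ?thesis using c(2)[of s i] that by auto
    qed
    have cardI: "card I < card {..r}" by (simp add: r_def)
    have kN: "1 \<le> k ^ N" using k1 by simp
    obtain d where d: "\<exists>s\<in>{..r}. d s \<noteq> 0" "\<And>i. i \<in> I \<Longrightarrow> (\<Sum>s\<in>{..r}. c s i * d s) = 0"
        "\<And>s. s \<in> {..r} \<Longrightarrow> \<bar>d s\<bar> \<le> (2 * int (card {..r}) * k ^ N + 1) ^ card I"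
      using siegel_pigeonhole[of I "{..r}" "k ^ N" "\<lambda>i s. c s i", OF fin _ cardI kN cb]
      by auto
    define D where "D = (2 * R * real_of_int k ^ N + 1) ^ r"
    have dD: "\<bar>real_of_int (d s)\<bar> \<le> D" if "s \<le> r" for s
    proof -
      have "real_of_int \<bar>d s\<bar> \<le> real_of_int ((2 * int (card {..r}) * k ^ N + 1) ^ card I)"
        using d(3)[of s] that by (simp only: of_int_le_iff) simp
      then show ?thesis by (simp add: D_def R_def r_def add.commute)
    qed
    have D0: "D \<ge> 0" unfolding D_def using R1 k1 by (intro zero_le_power) auto
    have "of_int (a ^ N) * (\<Sum>s\<le>r. of_int (d s) * \<rho> ^ s) = (\<Sum>s\<le>r. of_int (d s) * (of_int (a ^ N) * \<rho> ^ s))"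
      by (simp add: sum_distrib_left mult_ac)
    also have "\<dots> = (\<Sum>s\<le>r. \<Sum>i\<in>I. of_int (c s i * d s) * v i)"
      by (intro sum.cong refl, subst c(1)) (auto simp: sum_distrib_left mult_ac)
    also have "\<dots> = (\<Sum>i\<in>I. of_int (\<Sum>s\<le>r. c s i * d s) * v i)"
      by (subst sum.swap) (simp add: sum_distrib_right)
    also have "\<dots> = 0" by (simp add: d(2) del: of_int_sum of_int_mult)
    finally have zero: "(\<Sum>s\<le>r. of_int (d s) * \<rho> ^ s) = 0" using a by simp
    \<comment> \<open>Dividing the relation by the lowest power that occurs isolates a nonzero
      integer, of modulus at least 1. All other terms keep a factor \<rho>, so \<rho> cannot be
      smaller than the reciprocal of the coefficients.\<close>
    define s0 where "s0 = (LEAST s. s \<le> r \<and> d s \<noteq> 0)"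
    have s0: "s0 \<le> r \<and> d s0 \<noteq> 0" unfolding s0_def by (rule LeastI_ex) (use d(1) in auto)
    have s0_least: "d s = 0" if "s < s0" for s using not_less_Least[of s "\<lambda>s. s \<le> r \<and> d s \<noteq> 0"] that s0 unfolding s0_def[symmetric]
      by auto
    have "(\<Sum>s\<le>r. of_int (d s) * \<rho> ^ s) = (\<Sum>s\<in>{s0..r}. of_int (d s) * \<rho> ^ s)"
      by (rule sum.mono_neutral_right) (auto simp: s0_least not_le)
    also have "\<dots> = (\<Sum>s\<in>{s0..r}. \<rho> ^ s0 * (of_int (d s) * \<rho> ^ (s - s0)))"
      by (intro sum.cong) (auto simp flip: power_add)
    also have "\<dots> = \<rho> ^ s0 * (\<Sum>s\<in>{s0..r}. of_int (d s) * \<rho> ^ (s - s0))" by (simp add: sum_distrib_left)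
    finally have "(\<Sum>s\<in>{s0..r}. of_int (d s) * \<rho> ^ (s - s0)) = 0" using zero \<rho>(2) by simp
    moreover have "(\<Sum>s\<in>{s0..r}. of_int (d s) * \<rho> ^ (s - s0)) = of_int (d s0) + (\<Sum>s\<in>{Suc s0..r}. of_int (d s) * \<rho> ^ (s - s0))"
      using s0 by (subst sum.atLeast_Suc_atMost) auto
    ultimately have "of_int (d s0) = - (\<Sum>s\<in>{Suc s0..r}. of_int (d s) * \<rho> ^ (s - s0))"
      by (simp add: add_eq_0_iff2)
    then have "norm (of_int (d s0) :: complex) \<le> (\<Sum>s\<in>{Suc s0..r}. norm (of_int (d s) * \<rho> ^ (s - s0)))"
      by (simp add: sum_norm_le)
    also have "\<dots> \<le> (\<Sum>s\<in>{Suc s0..r}. D * norm \<rho>)"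
    proof (rule sum_mono)
      fix s assume s: "s \<in> {Suc s0..r}"
      have "norm \<rho> ^ (s - s0) \<le> norm \<rho> ^ 1" using False s by (intro power_decreasing) auto
      then show "norm (of_int (d s) * \<rho> ^ (s - s0)) \<le> D * norm \<rho>"
        using dD[of s] s D0 by (auto simp: norm_mult norm_power intro!: mult_mono)
    qed
    also have "\<dots> = real (r - s0) * (D * norm \<rho>)" by simp
    also have "\<dots> \<le> R * (D * norm \<rho>)" using D0 by (intro mult_right_mono) (auto simp: R_def)
    finally have "norm (of_int (d s0) :: complex) \<le> R * (D * norm \<rho>)" .
    moreover have "norm (of_int (d s0) :: complex) \<ge> 1"
    proof -
      have "1 \<le> \<bar>d s0\<bar>" using s0 by linarith
      then have "(1 :: real) \<le> of_int \<bar>d s0\<bar>" by (simp only: of_int_1_le_iff)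
      then show ?thesis by simp
    qed
    ultimately have one_le: "1 \<le> R * D * norm \<rho>" by simp
    have "R * D \<le> K ^ L"
    proof -
      have kNr: "real_of_int k ^ N \<ge> 1" using k1 by simp
      have "D \<le> (3 * R * real_of_int k ^ N) ^ r"
        unfolding D_def using mult_mono[OF R1 kNr] R1 kNr by (intro power_mono) auto
      also have "\<dots> = (3 * R) ^ r * (real_of_int k ^ ((r + 1) * r)) ^ L"
      proof -
        have e: "N * r = (r + 1) * r * L" by (simp add: N_def algebra_simps)
        show ?thesis unfolding power_mult_distrib power_mult[symmetric] e ..
      qed
      finally have "R * D \<le> (R * (3 * R) ^ r) * (real_of_int k ^ ((r + 1) * r)) ^ L"
        using R1 by (simp add: mult.assoc)
      also have "\<dots> \<le> (R * (3 * R) ^ r) ^ L * (real_of_int k ^ ((r + 1) * r)) ^ L"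
      proof (rule mult_right_mono)
        have "1 * 1 \<le> R * (3 * R) ^ r" using R1 by (intro mult_mono one_le_power) auto
        then show "R * (3 * R) ^ r \<le> (R * (3 * R) ^ r) ^ L" using L by (intro self_le_power) auto
      qed (use k1 in auto)
      also have "\<dots> = K ^ L" by (simp add: K_def power_mult_distrib)
      finally show ?thesis .
    qed
    then have "1 \<le> K ^ L * norm \<rho>" using one_le by (meson mult_right_mono norm_ge_zero order.trans)
    then show ?thesis using K1 by (simp add: power_one_over field_simps)
  qed
  show thesis
  proof (rule that[of "1 / K" Z])
    show "0 < 1 / K" "1 / K \<le> 1" using K1 by auto
  qed (fact Zmono Zmult Zadd Zint Zbeta ZS lower)+
qed

text \<open>Integer multiples b of \<beta> and s of S are algebraic integers, so finitely many
  products of their powers generate the ring they span. This ring takes the place of a number field,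
  with no need for linear independence or conjugates.\<close>

theorem liouville_filtration:
  fixes \<beta> S :: complex
  assumes "algebraic \<beta>" "algebraic S"
  obtains Z :: "nat \<Rightarrow> complex set" and \<kappa> :: real where "0 < \<kappa>" "\<kappa> \<le> 1"
    "\<And>L M. L \<le> M \<Longrightarrow> Z L \<subseteq> Z M"
    "\<And>L M u v. u \<in> Z L \<Longrightarrow> v \<in> Z M \<Longrightarrow> u * v \<in> Z (L + M)"
    "\<And>L u v. u \<in> Z L \<Longrightarrow> v \<in> Z L \<Longrightarrow> u + v \<in> Z (L + 1)"
    "\<And>L n. 1 \<le> L \<Longrightarrow> \<bar>n\<bar> \<le> 2 ^ L \<Longrightarrow> of_int n \<in> Z L"
    "\<beta> \<in> Z 1" "S \<in> Z 1"
    "\<And>L \<rho>. 1 \<le> L \<Longrightarrow> \<rho> \<in> Z L \<Longrightarrow> \<rho> \<noteq> 0 \<Longrightarrow> \<kappa> ^ L \<le> norm \<rho>"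
proof -
  obtain a1 where a1: "a1 \<ge> 1" "algebraic_int (of_int a1 * \<beta>)"
    using algebraic_imp_multiple_algebraic_int[OF assms(1)] .
  obtain a2 where a2: "a2 \<ge> 1" "algebraic_int (of_int a2 * S)"
    using algebraic_imp_multiple_algebraic_int[OF assms(2)] .
  define b where "b = of_int a1 * \<beta>"
  define s where "s = of_int a2 * S"
  obtain r1 where "\<And>n. \<exists>c::nat \<Rightarrow> int. b ^ n = (\<Sum>l<r1. of_int (c l) * b ^ l)"
    using algebraic_int_powers_span a1(2) unfolding b_def by blast
  then obtain c1 :: "nat \<Rightarrow> nat \<Rightarrow> int" where c1: "\<And>n. b ^ n = (\<Sum>l<r1. of_int (c1 n l) * b ^ l)" by metis
  obtain r2 where "\<And>n. \<exists>c::nat \<Rightarrow> int. s ^ n = (\<Sum>l<r2. of_int (c l) * s ^ l)"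
    using algebraic_int_powers_span a2(2) unfolding s_def by blast
  then obtain c2 :: "nat \<Rightarrow> nat \<Rightarrow> int" where c2: "\<And>n. s ^ n = (\<Sum>l<r2. of_int (c2 n l) * s ^ l)" by metis
  define I where "I = {..<r1} \<times> {..<r2}"
  define v where "v = (\<lambda>(i, j). b ^ i * s ^ j)"
  have span: "b ^ i * s ^ j = (\<Sum>l\<in>I. of_int (c1 i (fst l) * c2 j (snd l)) * v l)" for i j
  proof -
    have "b ^ i * s ^ j = (\<Sum>l<r1. of_int (c1 i l) * b ^ l) * (\<Sum>l<r2. of_int (c2 j l) * s ^ l)"
      by (simp only: c1[symmetric] c2[symmetric])
    then show ?thesis by (simp add: sum_product sum.cartesian_product I_def v_def case_prod_unfold mult_ac)
  qed
  show thesis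
  proof (rule liouville_filtration_of_basis[of I "a1 * a2" v
        "\<lambda>i j l. c1 (fst i + fst j) (fst l) * c2 (snd i + snd j) (snd l)"
        "\<lambda>l. c1 0 (fst l) * c2 0 (snd l)" \<beta> "\<lambda>l. a2 * (c1 1 (fst l) * c2 0 (snd l))"
        S "\<lambda>l. a1 * (c1 0 (fst l) * c2 1 (snd l))"])
    show "finite I" by (simp add: I_def)
    show "1 \<le> a1 * a2" using mult_mono[of 1 a1 1 a2] a1(1) a2(1) by simp
    show "v i * v j = (\<Sum>l\<in>I. of_int (c1 (fst i + fst j) (fst l) * c2 (snd i + snd j) (snd l)) * v l)" for i j
      unfolding span[symmetric] by (simp add: v_def case_prod_unfold power_add)
    show "1 = (\<Sum>l\<in>I. of_int (c1 0 (fst l) * c2 0 (snd l)) * v l)"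
      unfolding span[symmetric] by simp
    show "of_int (a1 * a2) * \<beta> = (\<Sum>l\<in>I. of_int (a2 * (c1 1 (fst l) * c2 0 (snd l))) * v l)"
      using span[of 1 0] by (simp add: b_def mult_ac flip: sum_distrib_left)
    show "of_int (a1 * a2) * S = (\<Sum>l\<in>I. of_int (a1 * (c1 0 (fst l) * c2 1 (snd l))) * v l)"
      using span[of 0 1] by (simp add: s_def mult_ac flip: sum_distrib_left)
  qed (rule that; assumption)
qed

section \<open>Shifting a word\<close>

definition nab :: "int \<Rightarrow> (int \<Rightarrow> int) \<Rightarrow> int \<Rightarrow> int" where
  "nab p h = (\<lambda>y. h (y + p) - h y)"

lemma poly_power_tendsto_0:
  fixes r :: real assumes "0 \<le> r" "r < 1"
  shows "(\<lambda>n. (real n + 1) ^ e * r ^ n) \<longlonglongrightarrow> 0"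
proof (cases "r = 0")
  case True
  have "eventually (\<lambda>n. (real n + 1) ^ e * r ^ n = 0) sequentially"
    using eventually_gt_at_top[of 0] by eventually_elim (use True in auto)
  then show ?thesis by (rule tendsto_eventually)
next
  case False
  then have "0 < r" using assms by simp
  then show ?thesis using assms(2) by real_asymp
qed

lemma poly_power_bound:
  fixes r :: real assumes "0 \<le> r" "r < 1"
  obtains K where "K > 0" "\<And>n. (real n + 1) ^ e * r ^ n \<le> K"
proof -
  have "Bseq (\<lambda>n. (real n + 1) ^ e * r ^ n)"
    using poly_power_tendsto_0[OF assms] convergent_imp_Bseq convergentI by blast
  then obtain K where "K > 0" "\<And>n. norm ((real n + 1) ^ e * r ^ n) \<le> K" by (auto elim: BseqE)
  then show thesis using that[of K] by (metis abs_le_D1 real_norm_def)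
qed

lemma summable_poly_power:
  fixes r :: real assumes "0 \<le> r" "r < 1"
  shows "summable (\<lambda>n. (real n + 1) ^ e * r ^ n)"
proof -
  have r: "0 \<le> sqrt r" "sqrt r < 1" using assms by auto
  obtain K where K: "K > 0" "\<And>n. (real n + 1) ^ e * sqrt r ^ n \<le> K"
    using poly_power_bound[OF r] by blast
  have rr: "r ^ n = sqrt r ^ n * sqrt r ^ n" for n
    using assms by (simp flip: power_mult_distrib)
  show ?thesis
  proof (rule summable_comparison_test[of _ "\<lambda>n. K * sqrt r ^ n"])
    have "norm ((real n + 1) ^ e * r ^ n) \<le> K * sqrt r ^ n" for n
    proof -
      have "(real n + 1) ^ e * r ^ n = ((real n + 1) ^ e * sqrt r ^ n) * sqrt r ^ n"
        by (simp add: rr)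
      also have "\<dots> \<le> K * sqrt r ^ n" using K(2) r by (intro mult_right_mono) auto
      finally show ?thesis using assms by simp
    qed
    then show "\<exists>N. \<forall>n\<ge>N. norm ((real n + 1) ^ e * r ^ n) \<le> K * sqrt r ^ n" by blast
    show "summable (\<lambda>n. K * sqrt r ^ n)" using r by (intro summable_mult summable_geometric) auto
  qed
qed

lemma int_poly_bound:
  fixes P :: "int poly"
  shows "\<bar>real_of_int (poly P y)\<bar> \<le> (\<Sum>i\<le>degree P. \<bar>real_of_int (coeff P i)\<bar>) * (1 + \<bar>real_of_int y\<bar>) ^ degree P"
proof -
  have "\<bar>real_of_int (poly P y)\<bar> = \<bar>\<Sum>i\<le>degree P. real_of_int (coeff P i) * real_of_int y ^ i\<bar>"
    by (simp add: poly_altdef)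
  also have "\<dots> \<le> (\<Sum>i\<le>degree P. \<bar>real_of_int (coeff P i)\<bar> * \<bar>real_of_int y\<bar> ^ i)"
    by (intro order.trans[OF sum_abs]) (simp add: abs_mult power_abs)
  also have "\<dots> \<le> (\<Sum>i\<le>degree P. \<bar>real_of_int (coeff P i)\<bar> * (1 + \<bar>real_of_int y\<bar>) ^ degree P)"
  proof (intro sum_mono mult_left_mono)
    fix i assume i: "i \<in> {..degree P}"
    have "\<bar>real_of_int y\<bar> ^ i \<le> (1 + \<bar>real_of_int y\<bar>) ^ i" by (intro power_mono) auto
    also have "\<dots> \<le> (1 + \<bar>real_of_int y\<bar>) ^ degree P" using i by (intro power_increasing) auto
    finally show "\<bar>real_of_int y\<bar> ^ i \<le> (1 + \<bar>real_of_int y\<bar>) ^ degree P" .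
  qed auto
  finally show ?thesis by (simp add: sum_distrib_right)
qed

lemma nab_poly: "nab p (poly P) = poly (pcompose P [:p, 1:] - P)"
  by (auto simp: nab_def poly_pcompose algebra_simps)

lemma nab_funpow_poly: "\<exists>P'. (nab p ^^ r) (poly P) = poly P'"
proof (induction r)
  case (Suc r)
  then show ?case by (metis comp_apply funpow.simps(2) nab_poly)
qed auto

lemma nab_funpow_eq_0:
  assumes "degree P < J"
  shows "(nab p ^^ J) (poly P) = (\<lambda>_. 0)"
  using assms
proof (induction J arbitrary: P)
  case (Suc J)
  define R where "R = pcompose P [:p, 1:] - P"
  have zero: "(nab p ^^ J) (\<lambda>_. 0) = (\<lambda>_. 0)" for J by (induction J) (auto simp: nab_def)
  show ?case
  proof (cases "degree P = 0")
    case True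
    then obtain c where "P = [:c:]" by (metis degree_eq_zeroE)
    then have "nab p (poly P) = (\<lambda>_. 0)" by (simp add: nab_def)
    then show ?thesis by (simp add: funpow_Suc_right zero del: funpow.simps)
  next
    case False
    have "degree R < degree P"
    proof (rule coeff_0_degree_minus_1[THEN le_less_trans])
      have "coeff (pcompose P [:p, 1:]) (degree P) = lead_coeff (pcompose P [:p, 1:])"
        by (simp add: degree_pcompose)
      also have "\<dots> = lead_coeff P" by (subst lead_coeff_comp) auto
      finally show "coeff R (degree P) = 0" by (simp add: R_def)
      show "degree R \<le> degree P" unfolding R_def by (intro degree_diff_le) (auto simp: degree_pcompose)
    qed (use False in auto)
    then have "(nab p ^^ J) (poly R) = (\<lambda>_. 0)" using Suc by simp
    then show ?thesis by (simp add: funpow_Suc_right nab_poly R_def del: funpow.simps)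
  qed
qed auto

lemma nab_commute: "nab p (nab q h) = nab q (nab p h)"
  by (auto simp: nab_def algebra_simps)

lemma nab_funpow_commute: "(nab p ^^ r) (nab q h) = nab q ((nab p ^^ r) h)"
  by (induction r) (auto simp: nab_commute)

locale rotation_word =
  fixes s :: "nat \<Rightarrow> int" and x :: complex
  assumes s_bound: "0 \<le> s n" "s n \<le> int n" and x: "norm x < 1"
begin

definition Ser :: "(int \<Rightarrow> int) \<Rightarrow> complex" where
  "Ser h = (\<Sum>n. of_int (h (s n)) * x ^ n)"

lemma summable_poly_bounded:
  fixes a :: "nat \<Rightarrow> complex"
  assumes "\<And>n. norm (a n) \<le> C * (real n + 1) ^ e"
  shows "summable (\<lambda>n. norm (a n * x ^ n))" "summable (\<lambda>n. a n * x ^ n)"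
proof -
  show "summable (\<lambda>n. norm (a n * x ^ n))"
  proof (rule summable_comparison_test[of _ "\<lambda>n. C * ((real n + 1) ^ e * norm x ^ n)"])
    show "\<exists>N. \<forall>n\<ge>N. norm (norm (a n * x ^ n)) \<le> C * ((real n + 1) ^ e * norm x ^ n)"
      using mult_right_mono[OF assms, of "norm x ^ n" for n] by (auto simp: norm_mult norm_power mult.assoc)
    show "summable (\<lambda>n. C * ((real n + 1) ^ e * norm x ^ n))"
      using x by (intro summable_mult summable_poly_power) auto
  qed
  then show "summable (\<lambda>n. a n * x ^ n)" by (rule summable_norm_cancel)
qed

lemma summable_Ser:
  "summable (\<lambda>n. norm (of_int (poly P (s n)) * x ^ n))" "summable (\<lambda>n. of_int (poly P (s n)) * x ^ n)"
proof -
  define C where "C = (\<Sum>i\<le>degree P. \<bar>real_of_int (coeff P i)\<bar>)"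
  have C: "C \<ge> 0" by (auto simp: C_def intro: sum_nonneg)
  have "norm (of_int (poly P (s n)) :: complex) \<le> C * (real n + 1) ^ degree P" for n
  proof -
    have "norm (of_int (poly P (s n)) :: complex) \<le> C * (1 + \<bar>real_of_int (s n)\<bar>) ^ degree P"
      unfolding norm_of_int C_def by (rule int_poly_bound)
    also have "\<dots> \<le> C * (real n + 1) ^ degree P"
      using s_bound[of n] C by (intro mult_left_mono power_mono) auto
    finally show ?thesis .
  qed
  from summable_poly_bounded[OF this] show
    "summable (\<lambda>n. norm (of_int (poly P (s n)) * x ^ n))" "summable (\<lambda>n. of_int (poly P (s n)) * x ^ n)" by auto
qed

end

locale word_shift = rotation_word +
  fixes q :: nat and p :: int and \<sigma> :: int and Mis :: "nat set"
  assumes shift: "s (n + q) = s n + p + (if n \<in> Mis then \<sigma> else 0)"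
begin

definition Msum :: "(int \<Rightarrow> int) \<Rightarrow> complex" where
  "Msum h = (\<Sum>n. (if n \<in> Mis then of_int (nab \<sigma> h (s n + p)) else 0) * x ^ n)"

text \<open>A polynomial h satisfies h(s(n + q)) = h(s n) + \<open>nab p h\<close> (s n), plus
  \<open>nab \<sigma> h\<close> (s n + p) at mismatches. The part of the series from q on is
  therefore x^q times three series.\<close>

lemma
  shows summable_Msum: "summable (\<lambda>n. (if n \<in> Mis then of_int (nab \<sigma> (poly P) (s n + p)) else 0) * x ^ n)"
    and Ser_step: "(1 - x ^ q) * Ser (poly P) =
      (\<Sum>n<q. of_int (poly P (s n)) * x ^ n) + x ^ q * Msum (poly P) + x ^ q * Ser (nab p (poly P))"
proof -
  define h where "h = poly P"
  have "summable (\<lambda>n. of_int (h (s (n + q))) * x ^ (n + q))"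
    using summable_ignore_initial_segment[OF summable_Ser(2)[of P], of q] by (simp add: h_def)
  then have sum1: "summable (\<lambda>n. x ^ q * (of_int (h (s (n + q))) * x ^ n))"
    by (simp add: power_add mult_ac)
  have sum1': "summable (\<lambda>n. of_int (h (s (n + q))) * x ^ n)"
  proof (cases "x ^ q = 0")
    case True
    then have "x = 0" by simp
    then show ?thesis by (simp add: summable_0_powser)
  next
    case False
    then show ?thesis using sum1 summable_cmult_iff[of "x ^ q"] by blast
  qed
  have sum2: "summable (\<lambda>n. of_int (nab p h (s n)) * x ^ n)" "summable (\<lambda>n. of_int (h (s n)) * x ^ n)"
    unfolding h_def nab_poly by (rule summable_Ser(2))+
  have eq: "(if n \<in> Mis then of_int (nab \<sigma> h (s n + p)) else 0) * x ^ n =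
     of_int (h (s (n + q))) * x ^ n - of_int (nab p h (s n)) * x ^ n - of_int (h (s n)) * x ^ n" for n
    by (auto simp: shift nab_def algebra_simps)
  show "summable (\<lambda>n. (if n \<in> Mis then of_int (nab \<sigma> (poly P) (s n + p)) else 0) * x ^ n)"
    unfolding h_def[symmetric] eq by (intro summable_diff sum1' sum2)
  have M: "Msum h = (\<Sum>n. of_int (h (s (n + q))) * x ^ n) - Ser (nab p h) - Ser h"
    unfolding Msum_def Ser_def eq
    using suminf_diff[OF summable_diff[OF sum1' sum2(1)] sum2(2)] suminf_diff[OF sum1' sum2(1)] by simp
  have "Ser h = (\<Sum>n. of_int (h (s (n + q))) * x ^ (n + q)) + (\<Sum>n<q. of_int (h (s n)) * x ^ n)"
    unfolding Ser_def using suminf_split_initial_segment[OF sum2(2), of q] .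
  also have "(\<Sum>n. of_int (h (s (n + q))) * x ^ (n + q)) = x ^ q * (\<Sum>n. of_int (h (s (n + q))) * x ^ n)"
    by (subst suminf_mult[OF sum1', symmetric]) (simp add: power_add mult_ac)
  finally show "(1 - x ^ q) * Ser (poly P) =
      (\<Sum>n<q. of_int (poly P (s n)) * x ^ n) + x ^ q * Msum (poly P) + x ^ q * Ser (nab p (poly P))"
    unfolding M[unfolded h_def] by (simp add: h_def algebra_simps)
qed

text \<open>Each factor 1 - x^q trades the series of h for that of \<open>nab p h\<close>, of lower
  degree, plus a finite sum and a mismatch sum.\<close>

lemma Ser_iterate:
  "(1 - x ^ q) ^ J * Ser (poly P) =
     (\<Sum>r<J. (1 - x ^ q) ^ (J - 1 - r) * (x ^ q) ^ r *
        ((\<Sum>n<q. of_int ((nab p ^^ r) (poly P) (s n)) * x ^ n) + x ^ q * Msum ((nab p ^^ r) (poly P))))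
     + (x ^ q) ^ J * Ser ((nab p ^^ J) (poly P))"
proof (induction J)
  case (Suc J)
  obtain P' where P': "(nab p ^^ J) (poly P) = poly P'" using nab_funpow_poly by blast
  let ?Y = "x ^ q"
  let ?B = "\<lambda>r. (\<Sum>n<q. of_int ((nab p ^^ r) (poly P) (s n)) * x ^ n) + x ^ q * Msum ((nab p ^^ r) (poly P))"
  have "(1 - ?Y) ^ Suc J * Ser (poly P) = (1 - ?Y) * ((1 - ?Y) ^ J * Ser (poly P))" by simp
  also have "\<dots> = (\<Sum>r<J. (1 - ?Y) * ((1 - ?Y) ^ (J - 1 - r) * ?Y ^ r * ?B r)) + ?Y ^ J * ((1 - ?Y) * Ser ((nab p ^^ J) (poly P)))"
    unfolding Suc.IH by (simp add: algebra_simps sum_distrib_left)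
  also have "(\<Sum>r<J. (1 - ?Y) * ((1 - ?Y) ^ (J - 1 - r) * ?Y ^ r * ?B r)) = (\<Sum>r<J. (1 - ?Y) ^ (Suc J - 1 - r) * ?Y ^ r * ?B r)"
  proof (rule sum.cong[OF refl])
    fix r assume "r \<in> {..<J}"
    then have "Suc J - 1 - r = Suc (J - 1 - r)" by auto
    then show "(1 - ?Y) * ((1 - ?Y) ^ (J - 1 - r) * ?Y ^ r * ?B r) = (1 - ?Y) ^ (Suc J - 1 - r) * ?Y ^ r * ?B r"
      by (simp only: power_Suc mult_ac)
  qed
  also have "(1 - ?Y) * Ser ((nab p ^^ J) (poly P)) = ?B J + ?Y * Ser ((nab p ^^ Suc J) (poly P))"
    unfolding P' using Ser_step[of P'] P' by simp
  finally show ?case by (simp add: algebra_simps)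
qed auto

end

text \<open>
  The contribution of one mismatch after \<open>D + 1\<close> applications of \<open>1 - x^q\<close>, as a polynomial in \<open>x^q\<close>:
  the \<open>r\<close>-th power of \<open>x^q\<close> comes with \<open>r\<close> differences in direction \<open>p\<close>.
\<close>
definition wpoly :: "nat \<Rightarrow> int \<Rightarrow> (int \<Rightarrow> int) \<Rightarrow> int \<Rightarrow> complex poly" where
  "wpoly D p g y = (\<Sum>r\<le>D. [:1, -1:] ^ (D - r) * monom (of_int ((nab p ^^ r) g y)) r)"

context word_shift
begin

definition Known :: "int poly \<Rightarrow> complex" where
  "Known P = (\<Sum>r\<le>degree P. (1 - x ^ q) ^ (degree P - r) * (x ^ q) ^ r *
     (\<Sum>n<q. of_int ((nab p ^^ r) (poly P) (s n)) * x ^ n))"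

text \<open>After \<open>degree P + 1\<close> differences nothing is left of the original series, so
  the mismatch series becomes an explicit polynomial expression in x plus an explicit multiple of
  the sum under study.\<close>

theorem Ser_mismatch:
  fixes P :: "int poly"
  defines "W \<equiv> \<lambda>n. if n \<in> Mis then poly (wpoly (degree P) p (nab \<sigma> (poly P)) (s n + p)) (x ^ q) else 0"
  shows "summable (\<lambda>n. W n * x ^ n)"
    and "(1 - x ^ q) ^ (degree P + 1) * Ser (poly P) - Known P = x ^ q * (\<Sum>n. W n * x ^ n)"
proof -
  let ?Y = "x ^ q" and ?D = "degree P"
  define m where "m r n = (if n \<in> Mis then of_int (nab \<sigma> ((nab p ^^ r) (poly P)) (s n + p)) else 0) * x ^ n" for r n
  have sm: "summable (m r)" for r
  proof -
    obtain P' where P': "(nab p ^^ r) (poly P) = poly P'" using nab_funpow_poly by blast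
    show ?thesis unfolding m_def P' by (rule summable_Msum)
  qed
  have W: "W n * x ^ n = (\<Sum>r\<le>?D. (1 - ?Y) ^ (?D - r) * ?Y ^ r * m r n)" for n
    by (auto simp: W_def m_def wpoly_def poly_sum poly_monom sum_distrib_left sum_distrib_right
        nab_funpow_commute mult_ac intro!: sum.cong)
  show "summable (\<lambda>n. W n * x ^ n)" unfolding W by (intro summable_sum summable_mult sm)
  have "(\<Sum>n. W n * x ^ n) = (\<Sum>r\<le>?D. (1 - ?Y) ^ (?D - r) * ?Y ^ r * (\<Sum>n. m r n))"
    unfolding W by (subst suminf_sum) (auto intro!: summable_mult sm sum.cong simp: suminf_mult sm)
  also have "\<dots> = (\<Sum>r\<le>?D. (1 - ?Y) ^ (?D - r) * ?Y ^ r * Msum ((nab p ^^ r) (poly P)))"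
    by (simp add: m_def[abs_def] Msum_def)
  finally have WM: "(\<Sum>n. W n * x ^ n) = (\<Sum>r\<le>?D. (1 - ?Y) ^ (?D - r) * ?Y ^ r * Msum ((nab p ^^ r) (poly P)))" .
  have "Ser ((nab p ^^ (?D + 1)) (poly P)) = 0"
    by (subst nab_funpow_eq_0) (auto simp: Ser_def)
  then have "(1 - ?Y) ^ (?D + 1) * Ser (poly P) = (\<Sum>r<?D + 1. (1 - ?Y) ^ (?D - r) * ?Y ^ r *
        ((\<Sum>n<q. of_int ((nab p ^^ r) (poly P) (s n)) * x ^ n) + ?Y * Msum ((nab p ^^ r) (poly P))))"
    unfolding Ser_iterate[of "?D + 1"] by simp
  also have "{..<?D + 1} = {..?D}" by auto
  also have "(\<Sum>r\<in>{..?D}. (1 - ?Y) ^ (?D - r) * ?Y ^ r *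
        ((\<Sum>n<q. of_int ((nab p ^^ r) (poly P) (s n)) * x ^ n) + ?Y * Msum ((nab p ^^ r) (poly P))))
      = Known P + ?Y * (\<Sum>n. W n * x ^ n)"
    unfolding WM Known_def by (simp add: distrib_left sum.distrib sum_distrib_left mult_ac)
  finally show "(1 - ?Y) ^ (?D + 1) * Ser (poly P) - Known P = ?Y * (\<Sum>n. W n * x ^ n)" by simp
qed

end

section \<open>Size and integrality of the mismatch polynomials\<close>

lemma nab_funpow_bound:
  fixes C :: real
  assumes g: "\<And>y. 0 \<le> y \<Longrightarrow> \<bar>real_of_int (g y)\<bar> \<le> C * (1 + real_of_int y) ^ e" and C: "0 \<le> C"
    and p: "0 \<le> p" and y: "0 \<le> y"
  shows "\<bar>real_of_int ((nab p ^^ r) g y)\<bar> \<le> 2 ^ r * C * (1 + real_of_int y + real r * real_of_int p) ^ e"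
  using y
proof (induction r arbitrary: y)
  case 0
  then show ?case using g by simp
next
  case (Suc r)
  let ?R = "1 + real_of_int y + real (Suc r) * real_of_int p"
  have "\<bar>real_of_int ((nab p ^^ Suc r) g y)\<bar> \<le> \<bar>real_of_int ((nab p ^^ r) g (y + p))\<bar> + \<bar>real_of_int ((nab p ^^ r) g y)\<bar>"
    by (simp add: nab_def)
  also have "\<dots> \<le> 2 ^ r * C * ?R ^ e + 2 ^ r * C * ?R ^ e"
  proof (rule add_mono)
    have "\<bar>real_of_int ((nab p ^^ r) g (y + p))\<bar> \<le> 2 ^ r * C * (1 + real_of_int (y + p) + real r * real_of_int p) ^ e"
      using Suc.prems p by (intro Suc.IH) auto
    also have "1 + real_of_int (y + p) + real r * real_of_int p = ?R" by (simp add: algebra_simps)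
    finally show "\<bar>real_of_int ((nab p ^^ r) g (y + p))\<bar> \<le> 2 ^ r * C * ?R ^ e" .
    have "\<bar>real_of_int ((nab p ^^ r) g y)\<bar> \<le> 2 ^ r * C * (1 + real_of_int y + real r * real_of_int p) ^ e"
      using Suc by blast
    also have "\<dots> \<le> 2 ^ r * C * ?R ^ e"
      using C Suc.prems p by (intro mult_left_mono power_mono) (auto simp: algebra_simps)
    finally show "\<bar>real_of_int ((nab p ^^ r) g y)\<bar> \<le> 2 ^ r * C * ?R ^ e" .
  qed
  finally show ?case by (simp add: mult_ac)
qed

lemma nab_funpow_poly_bound:
  fixes P :: "int poly"
  obtains C where "C > 0" "\<And>p y r N. 0 \<le> p \<Longrightarrow> 0 \<le> y \<Longrightarrow> r \<le> D \<Longrightarrow> real_of_int p \<le> N \<Longrightarrow> real_of_int y \<le> N \<Longrightarrow>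
    \<bar>real_of_int ((nab p ^^ r) (poly P) y)\<bar> \<le> C * (1 + N) ^ degree P"
proof -
  define A where "A = (\<Sum>i\<le>degree P. \<bar>real_of_int (coeff P i)\<bar>) + 1"
  have A: "A > 0" by (auto simp: A_def intro!: add_nonneg_pos sum_nonneg)
  define C where "C = 2 ^ D * A * (real D + 1) ^ degree P"
  have C: "C > 0" using A by (simp add: C_def)
  have "\<bar>real_of_int ((nab p ^^ r) (poly P) y)\<bar> \<le> C * (1 + N) ^ degree P"
    if *: "0 \<le> p" "0 \<le> y" "r \<le> D" "real_of_int p \<le> N" "real_of_int y \<le> N" for p y r N
  proof -
    have N: "N \<ge> 0" using * by linarith
    have "\<bar>real_of_int ((nab p ^^ r) (poly P) y)\<bar> \<le> 2 ^ r * A * (1 + real_of_int y + real r * real_of_int p) ^ degree P"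
    proof (rule nab_funpow_bound)
      fix y :: int assume y: "0 \<le> y"
      have "\<bar>real_of_int (poly P y)\<bar> \<le> (A - 1) * (1 + \<bar>real_of_int y\<bar>) ^ degree P"
        unfolding A_def using int_poly_bound[of P y] by simp
      also have "\<dots> \<le> A * (1 + real_of_int y) ^ degree P"
        using y by (intro mult_mono) (auto simp: A_def sum_nonneg)
      finally show "\<bar>real_of_int (poly P y)\<bar> \<le> A * (1 + real_of_int y) ^ degree P" .
    qed (use A * in auto)
    also have "\<dots> \<le> 2 ^ D * A * ((real D + 1) * (1 + N)) ^ degree P"
    proof (intro mult_mono power_mono power_increasing)
      have "real r * real_of_int p \<le> real D * N" using * by (intro mult_mono) auto
      then show "1 + real_of_int y + real r * real_of_int p \<le> (real D + 1) * (1 + N)"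
        using * N by (simp add: algebra_simps)
    qed (use A * in auto)
    also have "\<dots> = C * (1 + N) ^ degree P" by (simp add: C_def power_mult_distrib)
    finally show ?thesis .
  qed
  with C show thesis by (rule that)
qed

lemma degree_wpoly: "degree (wpoly D p g y) \<le> D"
  unfolding wpoly_def
proof (rule degree_sum_le)
  fix r assume "r \<in> {..D}"
  have "degree ([:1, -1 :: complex:] ^ (D - r)) \<le> D - r"
    using degree_power_le[of "[:1, -1 :: complex:]" "D - r"] by simp
  moreover have "degree (monom (of_int ((nab p ^^ r) g y)) r :: complex poly) \<le> r" by (rule degree_monom_le)
  ultimately show "degree ([:1, -1:] ^ (D - r) * monom (of_int ((nab p ^^ r) g y)) r :: complex poly) \<le> D"
    using \<open>r \<in> {..D}\<close> by (intro order.trans[OF degree_mult_le]) auto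
qed auto

lemma coeff_Ints_mult:
  assumes "\<And>i. coeff P i \<in> \<int>" "\<And>i. coeff Q i \<in> \<int>"
  shows "coeff (P * Q :: complex poly) i \<in> \<int>"
  using assms by (auto simp: coeff_mult intro!: Ints_sum Ints_mult)

lemma coeff_Ints_power:
  assumes "\<And>i. coeff P i \<in> \<int>"
  shows "coeff (P ^ n :: complex poly) i \<in> \<int>"
  using assms by (induction n arbitrary: i) (auto intro!: coeff_Ints_mult simp: coeff_1)

lemma coeff_wpoly_Ints: "coeff (wpoly D p g y) i \<in> \<int>"
proof -
  have "coeff ([:1, -1 :: complex:]) i \<in> \<int>" for i
    by (auto simp: coeff_pCons split: nat.split)
  then show ?thesis unfolding wpoly_def
    by (auto simp: coeff_sum intro!: Ints_sum coeff_Ints_mult coeff_Ints_power)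
qed

lemma coeff_0_wpoly: "coeff (wpoly D p g y) 0 = of_int (g y)"
proof -
  have "coeff (wpoly D p g y) 0 = (\<Sum>r\<le>D. if r = 0 then of_int (g y) else 0)"
    unfolding wpoly_def coeff_sum
    by (intro sum.cong) (auto simp: coeff_mult coeff_0_power)
  then show ?thesis by simp
qed

lemma norm_coeff_le: "norm (coeff P i) \<le> (\<Sum>j\<le>degree P. norm (coeff P j))" for P :: "complex poly"
proof (cases "i \<le> degree P")
  case True
  then show ?thesis by (intro member_le_sum) auto
next
  case False
  then show ?thesis by (simp add: coeff_eq_0 sum_nonneg)
qed

text \<open>Only the summand r = 0 reaches the constant coefficient, which is therefore G(y), of
  exact order y^e; as p <= y, no other coefficient is of larger order. At a small argument the
  constant term thus dominates. Dividing by the leading coefficient fixes the sign; the bound is on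
  the real part so that sums of such terms cannot cancel.\<close>

lemma wpoly_bounds:
  fixes G :: "int poly"
  assumes G: "G \<noteq> 0"
  obtains y0 C where "y0 \<ge> 1" "C > 0"
    "\<And>p y j. y0 \<le> y \<Longrightarrow> 0 \<le> p \<Longrightarrow> p \<le> y \<Longrightarrow> norm (coeff (wpoly D p (poly G) y) j) \<le> C * real_of_int y ^ degree G"
    "\<And>p y. y0 \<le> y \<Longrightarrow> Re (coeff (wpoly D p (poly G) y) 0 / of_int (lead_coeff G)) \<ge> real_of_int y ^ degree G / 2"
proof -
  define e where "e = degree G"
  define l where "l = lead_coeff G"
  have l: "l \<noteq> 0" using G by (simp add: l_def)
  obtain C where C: "C > 0" "\<And>p y r N. 0 \<le> p \<Longrightarrow> 0 \<le> y \<Longrightarrow> r \<le> D \<Longrightarrow> real_of_int p \<le> N \<Longrightarrow> real_of_int y \<le> N \<Longrightarrow>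
    \<bar>real_of_int ((nab p ^^ r) (poly G) y)\<bar> \<le> C * (1 + N) ^ e"
    using nab_funpow_poly_bound[of D G] unfolding e_def by blast
  define B where "B r = (\<Sum>j\<le>degree ([:1, -1 :: complex:] ^ (D - r)). norm (coeff ([:1, -1 :: complex:] ^ (D - r)) j))" for r
  have B: "norm (coeff ([:1, -1 :: complex:] ^ (D - r)) j) \<le> B r" for r j
    unfolding B_def by (rule norm_coeff_le)
  have B0: "B r \<ge> 0" for r by (auto simp: B_def intro: sum_nonneg)
  define C' where "C' = (\<Sum>r\<le>D. B r * (C * 2 ^ e)) + 1"
  have C': "C' > 0" using B0 C(1) by (auto simp: C'_def intro!: add_nonneg_pos sum_nonneg)
  define A where "A = (\<Sum>i<e. \<bar>coeff G i\<bar>)"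
  have A: "A \<ge> 0" by (auto simp: A_def intro: sum_nonneg)
  \<comment> \<open>From this point on the lower-order part of G(y) is at most y^e / 2.\<close>
  define y0 where "y0 = 2 * A + 1"
  have bound: "norm (coeff (wpoly D p (poly G) y) j) \<le> C' * real_of_int y ^ e" if *: "y0 \<le> y" "0 \<le> p" "p \<le> y" for p y j
  proof -
    have y1: "1 \<le> y" using * A by (simp add: y0_def)
    have "norm (coeff (wpoly D p (poly G) y) j) \<le> (\<Sum>r\<le>D. norm (coeff ([:1, -1 :: complex:] ^ (D - r) * monom (of_int ((nab p ^^ r) (poly G) y)) r) j))"
      unfolding wpoly_def coeff_sum by (rule norm_sum)
    also have "\<dots> \<le> (\<Sum>r\<le>D. B r * (C * 2 ^ e) * real_of_int y ^ e)"
    proof (rule sum_mono)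
      fix r assume r: "r \<in> {..D}"
      have "\<bar>real_of_int ((nab p ^^ r) (poly G) y)\<bar> \<le> C * (1 + real_of_int y) ^ e"
        using * r y1 by (intro C(2)) auto
      also have "\<dots> \<le> C * (2 * real_of_int y) ^ e" using y1 C(1) by (intro mult_left_mono power_mono) auto
      finally have c: "\<bar>real_of_int ((nab p ^^ r) (poly G) y)\<bar> \<le> C * 2 ^ e * real_of_int y ^ e"
        by (simp add: power_mult_distrib mult_ac)
      have "norm (coeff ([:1, -1 :: complex:] ^ (D - r) * monom (of_int ((nab p ^^ r) (poly G) y)) r) j)
         \<le> B r * \<bar>real_of_int ((nab p ^^ r) (poly G) y)\<bar>"
      proof (cases "j < r")
        case True
        then show ?thesis using B0 by (simp add: mult.commute[of _ "monom _ _"] coeff_monom_mult)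
      next
        case False
        have "norm (coeff ([:1, -1 :: complex:] ^ (D - r)) (j - r)) * \<bar>real_of_int ((nab p ^^ r) (poly G) y)\<bar>
          \<le> B r * \<bar>real_of_int ((nab p ^^ r) (poly G) y)\<bar>"
          by (intro mult_right_mono B) auto
        then show ?thesis using False
          by (simp add: mult.commute[of _ "monom _ _"] coeff_monom_mult norm_mult mult.commute)
      qed
      also have "\<dots> \<le> B r * (C * 2 ^ e * real_of_int y ^ e)" using c B0 by (intro mult_left_mono) auto
      finally show "norm (coeff ([:1, -1 :: complex:] ^ (D - r) * monom (of_int ((nab p ^^ r) (poly G) y)) r) j)
         \<le> B r * (C * 2 ^ e) * real_of_int y ^ e" by (simp add: mult_ac)
    qed
    also have "\<dots> = (\<Sum>r\<le>D. B r * (C * 2 ^ e)) * real_of_int y ^ e" by (simp add: sum_distrib_right)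
    also have "\<dots> \<le> C' * real_of_int y ^ e" using y1 by (intro mult_right_mono) (auto simp: C'_def)
    finally show ?thesis .
  qed
  have low: "Re (coeff (wpoly D p (poly G) y) 0 / of_int l) \<ge> real_of_int y ^ e / 2" if y: "y0 \<le> y" for p y
  proof -
    have y1: "1 \<le> y" using y A by (simp add: y0_def)
    define R where "R = (\<Sum>i<e. coeff G i * y ^ i)"
    have Gy: "poly G y = l * y ^ e + R"
      by (simp add: poly_altdef R_def l_def e_def lessThan_Suc_atMost[symmetric])
    have "\<bar>R\<bar> * y \<le> A * y ^ e"
    proof -
      have "\<bar>R\<bar> \<le> (\<Sum>i<e. \<bar>coeff G i\<bar> * y ^ i)" unfolding R_def
        using y1 by (intro order.trans[OF sum_abs]) (simp add: abs_mult)
      then have "\<bar>R\<bar> * y \<le> (\<Sum>i<e. \<bar>coeff G i\<bar> * y ^ i) * y" using y1 by (intro mult_right_mono) auto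
      also have "\<dots> = (\<Sum>i<e. \<bar>coeff G i\<bar> * y ^ Suc i)" by (simp add: sum_distrib_left mult_ac)
      also have "\<dots> \<le> (\<Sum>i<e. \<bar>coeff G i\<bar> * y ^ e)"
        using y1 by (intro sum_mono mult_left_mono power_increasing) auto
      finally show ?thesis by (simp add: A_def sum_distrib_right)
    qed
    moreover have "\<bar>R\<bar> * (2 * A) \<le> \<bar>R\<bar> * y" using y by (intro mult_left_mono) (auto simp: y0_def)
    ultimately have "2 * \<bar>R\<bar> * A \<le> A * y ^ e" by (simp add: mult_ac)
    have R2: "2 * \<bar>R\<bar> \<le> y ^ e"
    proof (cases "A = 0")
      case True
      then have "\<bar>R\<bar> * y \<le> 0" using \<open>\<bar>R\<bar> * y \<le> A * y ^ e\<close> by simp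
      then have "R = 0" using y1 by (simp add: mult_le_0_iff)
      then show ?thesis using y1 by simp
    next
      case False
      then have "A > 0" using A by simp
      then show ?thesis using \<open>2 * \<bar>R\<bar> * A \<le> A * y ^ e\<close> by (metis mult.commute mult_le_cancel_left_pos)
    qed
    have "coeff (wpoly D p (poly G) y) 0 / of_int l = of_real (real_of_int (poly G y) / real_of_int l)"
      by (simp add: coeff_0_wpoly)
    then have "Re (coeff (wpoly D p (poly G) y) 0 / of_int l) = real_of_int (poly G y) / real_of_int l"
      by (simp only: Re_complex_of_real)
    also have "\<dots> = real_of_int y ^ e + real_of_int R / real_of_int l"
      using l by (simp add: Gy field_simps)
    finally have eq: "Re (coeff (wpoly D p (poly G) y) 0 / of_int l) = real_of_int y ^ e + real_of_int R / real_of_int l" .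
    have l1: "\<bar>real_of_int l\<bar> \<ge> 1" using l by linarith
    have "\<bar>real_of_int R / real_of_int l\<bar> \<le> \<bar>real_of_int R\<bar>"
      unfolding abs_divide using l1 l by (simp add: divide_le_eq mult_le_cancel_left1)
    also have "\<dots> \<le> real_of_int y ^ e / 2"
    proof -
      have "real_of_int (2 * \<bar>R\<bar>) \<le> real_of_int (y ^ e)" using R2 by (simp only: of_int_le_iff)
      then show ?thesis by simp
    qed
    finally show ?thesis using eq by linarith
  qed
  show thesis using that[of y0 C'] bound low C' A by (simp add: y0_def e_def l_def)
qed

text \<open>A polynomial with period \<sigma> takes the value P(0) at all multiples of \<sigma>,
  hence is constant. This is where non-constancy of f enters.\<close>

lemma nab_poly_nonzero:
  fixes P :: "int poly"
  assumes "degree P > 0" "\<sigma> \<noteq> 0"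
  obtains G where "G \<noteq> 0" "nab \<sigma> (poly P) = poly G"
proof -
  define G where "G = pcompose P [:\<sigma>, 1:] - P"
  have G: "nab \<sigma> (poly P) = poly G" by (simp add: nab_poly G_def)
  have "G \<noteq> 0"
  proof
    assume "G = 0"
    then have per: "poly P (y + \<sigma>) = poly P y" for y
      using fun_cong[OF G, of y] by (simp add: nab_def)
    have *: "poly P (int k * \<sigma>) = poly P 0" for k
    proof (induction k)
      case (Suc k)
      then show ?case using per[of "int k * \<sigma>"] by (simp add: algebra_simps)
    qed auto
    define R where "R = P - [:poly P 0:]"
    have "R \<noteq> 0"
    proof
      assume "R = 0"
      then have "P = [:poly P 0:]" by (simp add: R_def)
      then have "degree P = 0" by (metis degree_pCons_0)
      then show False using assms(1) by simp
    qed
    have "range (\<lambda>k. int k * \<sigma>) \<subseteq> {y. poly R y = 0}" using * by (auto simp: R_def)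
    moreover have "infinite (range (\<lambda>k. int k * \<sigma>))"
      using assms(2) by (intro range_inj_infinite) (auto simp: inj_on_def)
    ultimately show False using poly_roots_finite[OF \<open>R \<noteq> 0\<close>] finite_subset by blast
  qed
  then show thesis using that G by blast
qed

text \<open>Levels measure integers on a logarithmic scale; this turns polynomial bounds for values
  of f into levels that are linear in n.\<close>

lemma poly_growth_le_power2:
  obtains L0 where "L0 \<ge> 1" "\<And>n. C * (real n + 1) ^ e \<le> 2 ^ (n + L0)"
proof -
  obtain K where K: "K > 0" "\<And>n. (real n + 1) ^ e * (1 / 2) ^ n \<le> K"
    by (rule poly_power_bound[of "1 / 2" e]) simp_all
  obtain L where L: "max C 1 * K < 2 ^ L" using real_arch_pow[of 2 "max C 1 * K"] by auto
  have "C * (real n + 1) ^ e \<le> 2 ^ (n + Suc L)" for n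
  proof -
    have "(real n + 1) ^ e = ((real n + 1) ^ e * (1 / 2) ^ n) * 2 ^ n" by (simp add: power_one_over)
    also have "\<dots> \<le> K * 2 ^ n" using K(2) by (intro mult_right_mono) auto
    finally have "max C 1 * (real n + 1) ^ e \<le> max C 1 * (K * 2 ^ n)" by (intro mult_left_mono) auto
    also have "\<dots> \<le> 2 ^ L * 2 ^ n"
      unfolding mult.assoc[symmetric] using L by (intro mult_right_mono) auto
    also have "\<dots> \<le> 2 ^ (n + Suc L)" by (simp add: power_add)
    finally have "max C 1 * (real n + 1) ^ e \<le> 2 ^ (n + Suc L)" .
    moreover have "C * (real n + 1) ^ e \<le> max C 1 * (real n + 1) ^ e" by (intro mult_right_mono) auto
    ultimately show ?thesis by linarith
  qed
  then show thesis by (intro that[of "Suc L"]) simp_all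
qed

lemma abs_le_power2_of_real:
  assumes "\<bar>real_of_int n\<bar> \<le> 2 ^ L"
  shows "\<bar>n\<bar> \<le> 2 ^ L"
proof -
  have "real_of_int \<bar>n\<bar> \<le> real_of_int (2 ^ L)" using assms by simp
  then show ?thesis by (simp only: of_int_le_iff)
qed

section \<open>Arithmetic size of the mismatch series\<close>

locale filtration =
  fixes Z :: "nat \<Rightarrow> complex set" and \<kappa> :: real and \<beta> S :: complex
  assumes kappa: "0 < \<kappa>" "\<kappa> \<le> 1"
    and Z_mono: "\<And>L M. L \<le> M \<Longrightarrow> Z L \<subseteq> Z M"
    and Z_mult: "\<And>L M u v. u \<in> Z L \<Longrightarrow> v \<in> Z M \<Longrightarrow> u * v \<in> Z (L + M)"
    and Z_add: "\<And>L u v. u \<in> Z L \<Longrightarrow> v \<in> Z L \<Longrightarrow> u + v \<in> Z (L + 1)"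
    and Z_int: "\<And>L n. 1 \<le> L \<Longrightarrow> \<bar>n\<bar> \<le> 2 ^ L \<Longrightarrow> of_int n \<in> Z L"
    and Z_beta: "\<beta> \<in> Z 1" and Z_S: "S \<in> Z 1"
    and Z_lower: "\<And>L \<rho>. 1 \<le> L \<Longrightarrow> \<rho> \<in> Z L \<Longrightarrow> \<rho> \<noteq> 0 \<Longrightarrow> \<kappa> ^ L \<le> norm \<rho>"
begin

lemma Z_le: "u \<in> Z L \<Longrightarrow> L \<le> M \<Longrightarrow> u \<in> Z M"
  by (rule subsetD[OF Z_mono])

lemma Z_0: "1 \<le> L \<Longrightarrow> 0 \<in> Z L" and Z_1: "1 \<le> L \<Longrightarrow> 1 \<in> Z L"
  using Z_int[of L 0] Z_int[of L 1] by simp_all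

text \<open>One level per summand instead of a logarithm; affordable because only sums with O(q)
  terms occur.\<close>

lemma Z_sum:
  assumes "finite A" "1 \<le> L" "\<And>i. i \<in> A \<Longrightarrow> u i \<in> Z L"
  shows "(\<Sum>i\<in>A. u i) \<in> Z (L + card A)"
  using assms
proof (induction A rule: finite_induct)
  case (insert i A)
  have "u i \<in> Z (L + card A)" using insert.prems by (auto intro: Z_le[of "u i" L])
  moreover have "(\<Sum>i\<in>A. u i) \<in> Z (L + card A)" using insert.prems by (intro insert.IH) auto
  ultimately have "u i + (\<Sum>i\<in>A. u i) \<in> Z (L + card A + 1)" by (rule Z_add)
  then show ?case using insert.hyps by simp
qed (simp add: Z_0)

lemma Z_power:
  assumes "u \<in> Z L"
  shows "u ^ k \<in> Z (L * k + 1)"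
proof (induction k)
  case 0
  show ?case using Z_1 by simp
next
  case (Suc k)
  have "u * u ^ k \<in> Z (L + (L * k + 1))" by (rule Z_mult[OF assms Suc.IH])
  then show ?case by (simp only: power_Suc mult_Suc_right add.assoc)
qed

lemma Z_beta_power: "\<beta> ^ k \<in> Z (k + 1)"
  using Z_power[OF Z_beta, of k] by simp

lemma Z_beta_power_minus_1: "\<beta> ^ k - 1 \<in> Z (k + 2)"
proof -
  have "of_int (- 1) \<in> Z (k + 1)" using one_le_power[of "2 :: int" "k + 1"] by (intro Z_int) auto
  then show ?thesis using Z_add[OF Z_beta_power[of k], of "- 1"] by simp
qed

lemma Z_beta_power_minus_1_power:
  assumes "k \<le> D" "1 \<le> q"
  shows "(\<beta> ^ q - 1) ^ k \<in> Z ((3 * D + 1) * q)"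
proof -
  have "(\<beta> ^ q - 1) ^ k \<in> Z ((q + 2) * k + 1)" by (rule Z_power[OF Z_beta_power_minus_1])
  then show ?thesis
  proof (rule Z_le)
    have "q + 2 \<le> 3 * q" using assms(2) by simp
    then have "(q + 2) * k \<le> (3 * q) * D" using assms(1) by (rule mult_le_mono)
    then have "(q + 2) * k + 1 \<le> (3 * q) * D + 1 * q" using assms(2) by linarith
    also have "\<dots> = (3 * D + 1) * q" by (simp only: distrib_right mult.assoc mult.commute[of q D])
    finally show "(q + 2) * k + 1 \<le> (3 * D + 1) * q" .
  qed
qed

end

locale word_filtration = filtration + rotation_word +
  assumes x_eq: "x = inverse \<beta>" and beta: "norm \<beta> > 1"
begin

lemma beta0: "\<beta> \<noteq> 0" using beta by auto

lemma beta_power_x: "k \<le> m \<Longrightarrow> \<beta> ^ m * x ^ k = \<beta> ^ (m - k)"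
  using beta0 by (simp add: x_eq power_diff power_inverse field_simps)

text \<open>The product has D factors in total, and each receives one \<beta>^q: the factor 1 - x^q
  becomes \<beta>^q - 1 and x^q becomes 1. So this power clears all denominators.\<close>

lemma beta_power_Y:
  assumes "r \<le> D"
  shows "\<beta> ^ (q * D) * ((1 - x ^ q) ^ (D - r) * (x ^ q) ^ r) = (\<beta> ^ q - 1) ^ (D - r)"
proof -
  have "\<beta> ^ (q * D) = (\<beta> ^ q) ^ (D - r) * (\<beta> ^ q) ^ r"
    using assms by (simp flip: power_mult power_add add: algebra_simps)
  then have "\<beta> ^ (q * D) * ((1 - x ^ q) ^ (D - r) * (x ^ q) ^ r) =
      (\<beta> ^ q * (1 - x ^ q)) ^ (D - r) * (\<beta> ^ q * x ^ q) ^ r"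
    by (simp add: power_mult_distrib)
  also have "\<beta> ^ q * x ^ q = 1" using beta_power_x[of q q] by simp
  finally show ?thesis using beta_power_x[of q q] by (simp add: right_diff_distrib)
qed

text \<open>Level of a single mismatch term, with a constant uniform in the shift. It is needed for
  removing an early mismatch from the series.\<close>

lemma Z_wpoly:
  fixes G :: "int poly"
  obtains C where "\<And>p q y N. 0 \<le> p \<Longrightarrow> p \<le> int q \<Longrightarrow> 1 \<le> q \<Longrightarrow> 0 \<le> y \<Longrightarrow> y \<le> int N \<Longrightarrow>
    \<beta> ^ (q * D) * poly (wpoly D p (poly G) y) (x ^ q) \<in> Z (C * (q + N))"
proof -
  obtain C where C: "C > 0" "\<And>p y r N. 0 \<le> p \<Longrightarrow> 0 \<le> y \<Longrightarrow> r \<le> D \<Longrightarrow> real_of_int p \<le> N \<Longrightarrow> real_of_int y \<le> N \<Longrightarrow>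
    \<bar>real_of_int ((nab p ^^ r) (poly G) y)\<bar> \<le> C * (1 + N) ^ degree G"
    using nab_funpow_poly_bound[of D G] by blast
  obtain L0 where L0: "L0 \<ge> 1" "\<And>n. C * (real n + 1) ^ degree G \<le> 2 ^ (n + L0)"
    using poly_growth_le_power2 by blast
  show thesis
  proof (rule that)
    fix p :: int and q :: nat and y :: int and N :: nat
    assume *: "0 \<le> p" "p \<le> int q" "1 \<le> q" "0 \<le> y" "y \<le> int N"
    have trm: "(\<beta> ^ q - 1) ^ (D - r) * of_int ((nab p ^^ r) (poly G) y) \<in> Z ((3 * D + 1) * q + (q + N + L0))"
      if r: "r \<le> D" for r
    proof (intro Z_mult Z_beta_power_minus_1_power Z_int)
      have "\<bar>real_of_int ((nab p ^^ r) (poly G) y)\<bar> \<le> C * (1 + real (q + N)) ^ degree G"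
        using * r by (intro C(2)) auto
      also have "\<dots> \<le> 2 ^ (q + N + L0)" using L0(2)[of "q + N"] by (simp add: add.commute)
      finally show "\<bar>(nab p ^^ r) (poly G) y\<bar> \<le> 2 ^ (q + N + L0)" by (rule abs_le_power2_of_real)
    qed (use * in auto)
    have "\<beta> ^ (q * D) * poly (wpoly D p (poly G) y) (x ^ q) =
      (\<Sum>r\<le>D. (\<beta> ^ (q * D) * ((1 - x ^ q) ^ (D - r) * (x ^ q) ^ r)) * of_int ((nab p ^^ r) (poly G) y))"
      by (simp add: wpoly_def poly_sum poly_monom sum_distrib_left mult_ac)
    also have "\<dots> = (\<Sum>r\<le>D. (\<beta> ^ q - 1) ^ (D - r) * of_int ((nab p ^^ r) (poly G) y))"
      by (intro sum.cong refl, subst beta_power_Y) auto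
    also have "\<dots> \<in> Z (((3 * D + 1) * q + (q + N + L0)) + card {..D})"
      using L0 trm by (intro Z_sum) auto
    finally have "\<beta> ^ (q * D) * poly (wpoly D p (poly G) y) (x ^ q) \<in> Z (((3 * D + 1) * q + (q + N + L0)) + card {..D})" .
    then show "\<beta> ^ (q * D) * poly (wpoly D p (poly G) y) (x ^ q) \<in> Z ((4 * D + L0 + 3) * (q + N))"
    proof (rule Z_le)
      have "((3 * D + 1) * q + (q + N + L0)) + card {..D} = (3 * D + 2) * q + N + (L0 + D + 1) * 1"
        unfolding card_atMost by (simp add: distrib_left distrib_right)
      also have "\<dots> \<le> (3 * D + 2) * q + N + (L0 + D + 1) * q" using * by (intro add_mono mult_le_mono2 order_refl)
      also have "\<dots> = (4 * D + L0 + 3) * q + 1 * N" by (simp add: distrib_right)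
      also have "\<dots> \<le> (4 * D + L0 + 3) * q + (4 * D + L0 + 3) * N" by (intro add_left_mono mult_le_mono1) simp
      also have "\<dots> = (4 * D + L0 + 3) * (q + N)" by (simp only: distrib_left)
      finally show "((3 * D + 1) * q + (q + N + L0)) + card {..D} \<le> (4 * D + L0 + 3) * (q + N)" .
    qed
  qed
qed

end

locale word_transcendence = word_filtration +
  fixes f :: "int poly"
  assumes S_eq: "S = Ser (poly f)"
begin

text \<open>An infinite series receives a level because \<open>Ser_mismatch\<close> expresses it by
  S, of level 1, and a finite sum of level O(q). Multiplying that identity by \<beta>^(q(D+1))
  clears the denominators; one \<beta>^q cancels against the x^q in front of the series.\<close>

lemma Z_mismatch_sum:
  obtains C where "\<And>q p \<sigma> Mis. word_shift s x q p \<sigma> Mis \<Longrightarrow> 0 \<le> p \<Longrightarrow> p \<le> int q \<Longrightarrow> 1 \<le> q \<Longrightarrow>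
    \<beta> ^ (q * degree f) * (\<Sum>n. (if n \<in> Mis then poly (wpoly (degree f) p (nab \<sigma> (poly f)) (s n + p)) (x ^ q) else 0) * x ^ n)
      \<in> Z (C * q)"
proof -
  define D where "D = degree f"
  obtain C where C: "C > 0" "\<And>p y r N. 0 \<le> p \<Longrightarrow> 0 \<le> y \<Longrightarrow> r \<le> D \<Longrightarrow> real_of_int p \<le> N \<Longrightarrow> real_of_int y \<le> N \<Longrightarrow>
    \<bar>real_of_int ((nab p ^^ r) (poly f) y)\<bar> \<le> C * (1 + N) ^ degree f"
    using nab_funpow_poly_bound[of D f] by blast
  obtain L0 where L0: "L0 \<ge> 1" "\<And>n. C * (real n + 1) ^ degree f \<le> 2 ^ (n + L0)"
    using poly_growth_le_power2 by blast
  show thesis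
  proof (rule that)
    fix q :: nat and p \<sigma> :: int and Mis :: "nat set"
    assume ws: "word_shift s x q p \<sigma> Mis" and *: "0 \<le> p" "p \<le> int q" "1 \<le> q"
    interpret word_shift s x q p \<sigma> Mis by (rule ws)
    define X where "X = (\<Sum>n. (if n \<in> Mis then poly (wpoly D p (nab \<sigma> (poly f)) (s n + p)) (x ^ q) else 0) * x ^ n)"
    have inner: "\<beta> ^ q * (\<Sum>n<q. of_int ((nab p ^^ r) (poly f) (s n)) * x ^ n) \<in> Z ((q + L0) + (q + 1) + q)"
      if r: "r \<le> D" for r
    proof -
      have "\<beta> ^ q * (\<Sum>n<q. of_int ((nab p ^^ r) (poly f) (s n)) * x ^ n) = (\<Sum>n<q. of_int ((nab p ^^ r) (poly f) (s n)) * \<beta> ^ (q - n))"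
        unfolding sum_distrib_left
      proof (rule sum.cong[OF refl])
        fix n assume "n \<in> {..<q}"
        then show "\<beta> ^ q * (of_int ((nab p ^^ r) (poly f) (s n)) * x ^ n) = of_int ((nab p ^^ r) (poly f) (s n)) * \<beta> ^ (q - n)"
          using beta_power_x[of n q] by (simp add: mult.left_commute)
      qed
      also have "\<dots> \<in> Z ((q + L0) + (q + 1) + card {..<q})"
      proof (rule Z_sum)
        fix n assume n: "n \<in> {..<q}"
        have "of_int ((nab p ^^ r) (poly f) (s n)) \<in> Z (q + L0)"
        proof (rule Z_int)
          have "\<bar>real_of_int ((nab p ^^ r) (poly f) (s n))\<bar> \<le> C * (1 + real q) ^ degree f"
            using * r n s_bound[of n] by (intro C(2)) auto
          also have "\<dots> \<le> 2 ^ (q + L0)" using L0(2)[of q] by (simp add: add.commute)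
          finally show "\<bar>(nab p ^^ r) (poly f) (s n)\<bar> \<le> 2 ^ (q + L0)" by (rule abs_le_power2_of_real)
        qed (use L0 in auto)
        moreover have "\<beta> ^ (q - n) \<in> Z (q + 1)" using Z_beta_power by (rule Z_le) auto
        ultimately show "of_int ((nab p ^^ r) (poly f) (s n)) * \<beta> ^ (q - n) \<in> Z ((q + L0) + (q + 1))"
          by (rule Z_mult)
      qed auto
      finally show ?thesis by simp
    qed
    have known: "\<beta> ^ (q * (D + 1)) * Known f \<in> Z (((3 * D + 1) * q + ((q + L0) + (q + 1) + q)) + card {..D})"
    proof -
      have "\<beta> ^ (q * (D + 1)) * Known f = (\<Sum>r\<le>D. (\<beta> ^ (q * D) * ((1 - x ^ q) ^ (D - r) * (x ^ q) ^ r)) *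
          (\<beta> ^ q * (\<Sum>n<q. of_int ((nab p ^^ r) (poly f) (s n)) * x ^ n)))"
        unfolding Known_def D_def[symmetric] sum_distrib_left[of "\<beta> ^ (q * (D + 1))"]
        by (intro sum.cong refl) (simp add: power_add mult_ac)
      also have "\<dots> = (\<Sum>r\<le>D. (\<beta> ^ q - 1) ^ (D - r) *
          (\<beta> ^ q * (\<Sum>n<q. of_int ((nab p ^^ r) (poly f) (s n)) * x ^ n)))"
        by (intro sum.cong refl, subst beta_power_Y) auto
      also have "\<dots> \<in> Z (((3 * D + 1) * q + ((q + L0) + (q + 1) + q)) + card {..D})"
        by (intro Z_sum Z_mult[OF Z_beta_power_minus_1_power inner]) (use * in auto)
      finally show ?thesis .
    qed
    define LL where "LL = (3 * D + 1) * q + ((q + L0) + (q + 1) + q) + card {..D}"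
    have main: "\<beta> ^ (q * (D + 1)) * ((1 - x ^ q) ^ (D + 1) * S) \<in> Z ((3 * (D + 1) + 1) * q + 1)"
    proof -
      have "\<beta> ^ (q * (D + 1)) * ((1 - x ^ q) ^ (D + 1) * S) = (\<beta> ^ (q * (D + 1)) * ((1 - x ^ q) ^ (D + 1 - 0) * (x ^ q) ^ 0)) * S"
        by (simp only: power_0 diff_zero mult_1_right mult.assoc)
      also have "\<dots> = (\<beta> ^ q - 1) ^ (D + 1 - 0) * S" by (subst beta_power_Y) simp_all
      also have "\<dots> \<in> Z ((3 * (D + 1) + 1) * q + 1)"
        using * by (intro Z_mult[OF Z_beta_power_minus_1_power Z_S]) auto
      finally show ?thesis .
    qed
    have "\<beta> ^ (q * (D + 1)) * x ^ q = \<beta> ^ (q * D)"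
      using beta_power_x[of q "q * (D + 1)"] by simp
    then have "\<beta> ^ (q * D) * X = \<beta> ^ (q * (D + 1)) * (x ^ q * X)"
      by (simp only: mult.assoc[symmetric])
    also have "x ^ q * X = (1 - x ^ q) ^ (D + 1) * S - Known f"
      unfolding X_def D_def S_eq by (rule Ser_mismatch(2)[of f, symmetric])
    also have "\<beta> ^ (q * (D + 1)) * \<dots> = \<beta> ^ (q * (D + 1)) * ((1 - x ^ q) ^ (D + 1) * S) + of_int (- 1) * (\<beta> ^ (q * (D + 1)) * Known f)"
      by (simp only: right_diff_distrib of_int_minus of_int_1 mult_minus_left mult_1_left add_uminus_conv_diff)
    also have "\<dots> \<in> Z ((1 + LL + ((3 * (D + 1) + 1) * q + 1)) + 1)"
    proof (rule Z_add)
      show "\<beta> ^ (q * (D + 1)) * ((1 - x ^ q) ^ (D + 1) * S) \<in> Z (1 + LL + ((3 * (D + 1) + 1) * q + 1))"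
        using main by (rule Z_le) auto
      have "of_int (- 1) * (\<beta> ^ (q * (D + 1)) * Known f) \<in> Z (1 + LL)"
      proof (rule Z_mult)
        show "of_int (- 1) \<in> Z 1" by (rule Z_int) auto
        show "\<beta> ^ (q * (D + 1)) * Known f \<in> Z LL" using known unfolding LL_def .
      qed
      then show "of_int (- 1) * (\<beta> ^ (q * (D + 1)) * Known f) \<in> Z (1 + LL + ((3 * (D + 1) + 1) * q + 1))"
        by (rule Z_le) auto
    qed
    finally have "\<beta> ^ (q * D) * X \<in> Z ((1 + LL + ((3 * (D + 1) + 1) * q + 1)) + 1)" .
    then have "\<beta> ^ (q * D) * X \<in> Z ((20 * D + 20 * L0 + 20) * q)"
    proof (rule Z_le)
      have "(1 + LL + ((3 * (D + 1) + 1) * q + 1)) + 1 = (6 * D + 8) * q + (L0 + D + 5) * 1"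
        unfolding LL_def card_atMost by (simp add: distrib_left distrib_right)
      also have "\<dots> \<le> (6 * D + 8) * q + (L0 + D + 5) * q" using * by (intro add_mono mult_le_mono2 order_refl)
      also have "\<dots> = (7 * D + L0 + 13) * q" by (simp add: distrib_right)
      also have "\<dots> \<le> (20 * D + 20 * L0 + 20) * q" by (rule mult_le_mono1) simp
      finally show "(1 + LL + ((3 * (D + 1) + 1) * q + 1)) + 1 \<le> (20 * D + 20 * L0 + 20) * q" .
    qed
    then show "\<beta> ^ (q * degree f) * (\<Sum>n. (if n \<in> Mis then poly (wpoly (degree f) p (nab \<sigma> (poly f)) (s n + p)) (x ^ q) else 0) * x ^ n)
      \<in> Z ((20 * D + 20 * L0 + 20) * q)" by (simp only: X_def D_def)
  qed
qed

end

section \<open>Irrational rotations and Farey neighbours\<close>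

lemma irrational_multiple_ne:
  assumes "\<theta> \<notin> \<rat>" "n \<noteq> (0 :: int)"
  shows "of_int n * \<theta> \<noteq> of_int t"
proof
  assume "of_int n * \<theta> = of_int t"
  then have "\<theta> = of_int t / of_int n" using assms(2) by (simp add: field_simps)
  then show False using assms(1) by (metis Rats_divide Rats_of_int)
qed

lemma int_multiple_gt: "0 < e \<Longrightarrow> - e < of_int b * (e :: real) \<Longrightarrow> 0 \<le> b"
proof -
  assume e: "0 < e" "- e < of_int b * e"
  then have "(- 1) * e < of_int b * e" by simp
  then have "- 1 < real_of_int b" using e(1) by (simp only: mult_less_cancel_right_pos)
  then show "0 \<le> b" by linarith
qed

lemma int_multiple_less: "0 < e \<Longrightarrow> of_int b * (e :: real) < e \<Longrightarrow> b \<le> 0"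
  using int_multiple_gt[of e "- b"] by simp

locale irrational_rotation =
  fixes \<theta> \<alpha> :: real
  assumes theta: "0 < \<theta>" "\<theta> < 1" "\<theta> \<notin> \<rat>" and alpha: "0 \<le> \<alpha>" "\<alpha> < 1"
begin

definition s :: "nat \<Rightarrow> int" where "s n = \<lfloor>real n * \<theta> + \<alpha>\<rfloor>"

lemma s_le: "of_int (s n) \<le> real n * \<theta> + \<alpha>" and s_gt: "real n * \<theta> + \<alpha> < of_int (s n) + 1"
  unfolding s_def by linarith+

lemma s_eqI: "of_int k \<le> real n * \<theta> + \<alpha> \<Longrightarrow> real n * \<theta> + \<alpha> < of_int k + 1 \<Longrightarrow> s n = k"
  unfolding s_def by (rule floor_unique)

lemma s_range: "0 \<le> s n" "s n \<le> int n"
proof -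
  show "0 \<le> s n" unfolding s_def using theta alpha by simp
  have "real n * \<theta> \<le> real n * 1" using theta by (intro mult_left_mono) auto
  then show "s n \<le> int n" using s_le[of n] alpha by linarith
qed

end

locale unimodular_pair = irrational_rotation +
  fixes q Q :: nat and p P :: int
  assumes q: "1 \<le> q" and Q: "1 \<le> Q"
    and eta_pos: "of_int p < real q * \<theta>" and eta'_pos: "real Q * \<theta> < of_int P"
    and det: "P * int q - p * int Q = 1"
begin

definition "\<eta> = real q * \<theta> - of_int p"
definition "\<eta>' = of_int P - real Q * \<theta>"

lemma eta: "0 < \<eta>" "0 < \<eta>'"
  using eta_pos eta'_pos by (auto simp: \<eta>_def \<eta>'_def)

text \<open>The determinant condition, rewritten in the two approximation errors. It yields \<eta> <
  1/Q and \<eta>' < 1/q.\<close>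

lemma eta_relation: "\<eta> * real Q + \<eta>' * real q = 1"
proof -
  have "\<eta> * real Q + \<eta>' * real q = of_int (P * int q - p * int Q)"
    by (simp add: \<eta>_def \<eta>'_def algebra_simps)
  then show ?thesis by (simp add: det)
qed

lemma eta_bounds: "\<eta> * real Q < 1" "\<eta>' * real q < 1" "\<eta> < 1" "\<eta>' < 1"
proof -
  have pos: "0 < \<eta> * real Q" "0 < \<eta>' * real q" using eta q Q by auto
  show *: "\<eta> * real Q < 1" "\<eta>' * real q < 1" using eta_relation pos by linarith+
  have "\<eta> * 1 \<le> \<eta> * real Q" "\<eta>' * 1 \<le> \<eta>' * real q" using eta q Q by (intro mult_left_mono; simp)+
  with * show "\<eta> < 1" "\<eta>' < 1" by linarith+
qed

lemma p_range: "0 \<le> p" "p \<le> int q" and P_range: "0 \<le> P" "P \<le> int Q"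
proof -
  have "real q * \<theta> \<le> real q * 1" "real Q * \<theta> \<le> real Q * 1" "0 \<le> real q * \<theta>" "0 \<le> real Q * \<theta>"
    using theta mult_left_mono[of \<theta> 1 "real q"] mult_left_mono[of \<theta> 1 "real Q"] by auto
  with eta_bounds eta show "0 \<le> p" "p \<le> int q" "0 \<le> P" "P \<le> int Q"
    unfolding \<eta>_def \<eta>'_def by linarith+
qed

text \<open>Modulo 1, the shift by q moves n\<theta> + \<alpha> up by \<eta> and the shift by Q
  moves it down by \<eta>'. Mismatches are the positions where this crosses an integer.\<close>

definition "MisU = {n. real n * \<theta> + \<alpha> - of_int (s n) \<ge> 1 - \<eta>}"
definition "MisD = {n. real n * \<theta> + \<alpha> - of_int (s n) < \<eta>'}"

lemma shift_up: "s (n + q) = s n + p + (if n \<in> MisU then 1 else 0)"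
  using s_le[of n] s_gt[of n] eta eta_bounds
  by (intro s_eqI) (auto simp: MisU_def \<eta>_def algebra_simps)

lemma shift_down: "s (n + Q) = s n + P + (if n \<in> MisD then - 1 else 0)"
  using s_le[of n] s_gt[of n] eta eta_bounds
  by (intro s_eqI) (auto simp: MisD_def \<eta>'_def algebra_simps)

text \<open>Coordinates of \<open>(w, t)\<close> in the basis \<open>(Q, P)\<close>, \<open>(q, p)\<close> of the lattice of integer points.\<close>
definition "crd1 w t = t * int q - w * p"
definition "crd2 w t = w * P - t * int Q"

lemma crd: "w = crd1 w t * int Q + crd2 w t * int q" "t = crd1 w t * P + crd2 w t * p"
proof -
  have "crd1 w t * int Q + crd2 w t * int q = w * (P * int q - p * int Q)"
    by (simp add: crd1_def crd2_def algebra_simps)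
  then show "w = crd1 w t * int Q + crd2 w t * int q" by (simp add: det)
  have "crd1 w t * P + crd2 w t * p = t * (P * int q - p * int Q)"
    by (simp add: crd1_def crd2_def algebra_simps)
  then show "t = crd1 w t * P + crd2 w t * p" by (simp add: det)
qed

lemma crd_value: "of_int w * \<theta> - of_int t = - of_int (crd1 w t) * \<eta>' + of_int (crd2 w t) * \<eta>"
proof -
  have "of_int w * \<theta> - of_int t = of_int (crd1 w t * int Q + crd2 w t * int q) * \<theta> - of_int (crd1 w t * P + crd2 w t * p)"
    by (simp only: crd[symmetric])
  then show ?thesis by (simp add: \<eta>_def \<eta>'_def algebra_simps)
qed

text \<open>With (w, t) = i (Q, P) + b (q, p) the value is b\<eta> - i\<eta>'. If it is smaller than
  \<eta> in modulus, i and b cannot have opposite signs, and i = 0 forces b = 0. So a positive w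
  contains at least one full Q.\<close>

lemma gap_up:
  assumes "w > 0" "\<bar>of_int w * \<theta> - of_int t\<bar> < \<eta>"
  shows "int Q \<le> w"
proof -
  define i where "i = crd1 w t"
  define b where "b = crd2 w t"
  have w: "w = i * int Q + b * int q" unfolding i_def b_def by (rule crd)
  have v: "- \<eta> < - of_int i * \<eta>' + of_int b * \<eta>" "- of_int i * \<eta>' + of_int b * \<eta> < \<eta>"
    using assms(2) unfolding crd_value i_def b_def by linarith+
  consider "i \<ge> 1" | "i = 0" | "i \<le> - 1" by linarith
  then show ?thesis
  proof cases
    case 1
    have "0 \<le> of_int i * \<eta>'" using 1 eta by simp
    then have "- \<eta> < of_int b * \<eta>" using v by linarith
    then have "b \<ge> 0" using eta int_multiple_gt by blast
    then have "1 * int Q + 0 \<le> i * int Q + b * int q" using 1 by (intro add_mono mult_right_mono) auto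
    then show ?thesis using w by simp
  next
    case 2
    then have "- \<eta> < of_int b * \<eta>" "of_int b * \<eta> < \<eta>" using v by auto
    then have "b = 0" using eta int_multiple_gt int_multiple_less by (metis order.antisym)
    then show ?thesis using w 2 assms(1) by simp
  next
    case 3
    have "of_int i * \<eta>' \<le> 0" using 3 eta by (simp add: mult_le_0_iff)
    then have "of_int b * \<eta> < \<eta>" using v by linarith
    then have "b \<le> 0" using eta int_multiple_less by blast
    then have "i * int Q + b * int q \<le> 0" using 3 by (intro add_nonpos_nonpos) (auto simp: mult_le_0_iff)
    then show ?thesis using w assms(1) by simp
  qed
qed

lemma gap_down:
  assumes "w > 0" "\<bar>of_int w * \<theta> - of_int t\<bar> < \<eta>'"
  shows "int q \<le> w"
proof -
  define i where "i = crd1 w t"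
  define b where "b = crd2 w t"
  have w: "w = i * int Q + b * int q" unfolding i_def b_def by (rule crd)
  have v: "- \<eta>' < - of_int i * \<eta>' + of_int b * \<eta>" "- of_int i * \<eta>' + of_int b * \<eta> < \<eta>'"
    using assms(2) unfolding crd_value i_def b_def by linarith+
  consider "b \<ge> 1" | "b = 0" | "b \<le> - 1" by linarith
  then show ?thesis
  proof cases
    case 1
    have "0 \<le> of_int b * \<eta>" using 1 eta by simp
    then have "- \<eta>' < of_int i * \<eta>'" using v by linarith
    then have "i \<ge> 0" using eta int_multiple_gt by blast
    then have "0 + 1 * int q \<le> i * int Q + b * int q" using 1 by (intro add_mono mult_right_mono) auto
    then show ?thesis using w by simp
  next
    case 2
    then have "- \<eta>' < of_int i * \<eta>'" "of_int i * \<eta>' < \<eta>'" using v by auto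
    then have "i = 0" using eta int_multiple_gt int_multiple_less by (metis order.antisym)
    then show ?thesis using w 2 assms(1) by simp
  next
    case 3
    have "of_int b * \<eta> \<le> 0" using 3 eta by (simp add: mult_le_0_iff)
    then have "of_int i * \<eta>' < \<eta>'" using v by linarith
    then have "i \<le> 0" using eta int_multiple_less by blast
    then have "i * int Q + b * int q \<le> 0" using 3 by (intro add_nonpos_nonpos) (auto simp: mult_le_0_iff)
    then show ?thesis using w assms(1) by simp
  qed
qed

lemma MisU_gap: "n \<in> MisU \<Longrightarrow> m \<in> MisU \<Longrightarrow> n < m \<Longrightarrow> n + Q \<le> m"
  using gap_up[of "int m - int n" "s m - s n"] s_gt[of n] s_gt[of m]
  by (auto simp: MisU_def abs_less_iff algebra_simps)

lemma MisD_gap: "n \<in> MisD \<Longrightarrow> m \<in> MisD \<Longrightarrow> n < m \<Longrightarrow> n + q \<le> m"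
  using gap_down[of "int m - int n" "s m - s n"] s_le[of n] s_le[of m]
  by (auto simp: MisD_def abs_less_iff algebra_simps)

end

context irrational_rotation
begin

text \<open>Without mismatches beyond N, s would be exactly linear along a progression of step k.
  Its distance to n\<theta> + \<alpha> would then grow without bound, since k\<theta> is not an
  integer.\<close>

lemma mismatch_unbounded:
  fixes k :: nat and r \<sigma> :: int
  assumes k: "1 \<le> k" and sh: "\<And>n. s (n + k) = s n + r + (if n \<in> M then \<sigma> else 0)"
  shows "\<exists>n\<in>M. N \<le> n"
proof (rule ccontr)
  assume "\<not> ?thesis"
  then have none: "n \<notin> M" if "n \<ge> N" for n using that by blast
  have eq: "s (N + j * k) = s N + int j * r" for j
  proof (induction j)
    case (Suc j)
    have "s (N + j * k + k) = s (N + j * k) + r" using sh[of "N + j * k"] none by simp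
    then show ?case using Suc by (simp add: algebra_simps)
  qed auto
  define d where "d = real k * \<theta> - of_int r"
  have d: "d \<noteq> 0" using irrational_multiple_ne[OF theta(3), of "int k" r] k by (simp add: d_def)
  have bound: "real j * \<bar>d\<bar> \<le> 1" for j
  proof -
    have "real j * d = (real (N + j * k) * \<theta> + \<alpha> - of_int (s (N + j * k))) - (real N * \<theta> + \<alpha> - of_int (s N))"
      unfolding eq by (simp add: d_def algebra_simps)
    then have "\<bar>real j * d\<bar> \<le> 1"
      using s_le[of N] s_gt[of N] s_le[of "N + j * k"] s_gt[of "N + j * k"] by linarith
    then show ?thesis by (simp add: abs_mult)
  qed
  obtain j :: nat where "1 / \<bar>d\<bar> < real j" using reals_Archimedean2 by blast
  then have "1 < real j * \<bar>d\<bar>" using d by (simp add: divide_less_eq)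
  then show False using bound[of j] by simp
qed

lemma unimodular_pairI:
  assumes "1 \<le> q" "1 \<le> Q" "of_int p < real q * \<theta>" "real Q * \<theta> < of_int P" "P * int q - p * int Q = 1"
  shows "unimodular_pair \<theta> \<alpha> q Q p P"
  using assms by unfold_locales auto

text \<open>Descent by mediants: the mediant replaces the neighbour on its own side of \<theta>, and
  the sum of the denominators grows.\<close>

lemma farey_pairs: "\<exists>q Q p P. unimodular_pair \<theta> \<alpha> q Q p P \<and> N \<le> q + Q"
proof (induction N)
  case 0
  have "unimodular_pair \<theta> \<alpha> 1 1 0 1" using theta by (intro unimodular_pairI) auto
  then show ?case by blast
next
  case (Suc N)
  then obtain q Q p P where pr: "unimodular_pair \<theta> \<alpha> q Q p P" and N: "N \<le> q + Q" by blast
  interpret unimodular_pair \<theta> \<alpha> q Q p P by (rule pr)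
  have ne: "real (q + Q) * \<theta> \<noteq> of_int (p + P)"
    using irrational_multiple_ne[OF theta(3), of "int (q + Q)" "p + P"] q by simp
  show ?case
  proof (cases "of_int (p + P) < real (q + Q) * \<theta>")
    case True
    have "unimodular_pair \<theta> \<alpha> (q + Q) Q (p + P) P"
      using True q Q eta'_pos det by (intro unimodular_pairI) (auto simp: algebra_simps)
    then show ?thesis using N Q by (intro exI[of _ "q + Q"] exI[of _ Q] exI[of _ "p + P"] exI[of _ P]) auto
  next
    case False
    then have "real (q + Q) * \<theta> < of_int (p + P)" using ne by linarith
    then have "unimodular_pair \<theta> \<alpha> q (q + Q) p (p + P)"
      using q Q eta_pos det by (intro unimodular_pairI) (auto simp: algebra_simps)
    then show ?thesis using N q by (intro exI[of _ q] exI[of _ "q + Q"] exI[of _ p] exI[of _ "p + P"]) auto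
  qed
qed

section \<open>Reduction to badly approximable slopes\<close>

definition badly_approximable :: "real \<Rightarrow> bool" where
  "badly_approximable c \<longleftrightarrow> 0 < c \<and> (\<forall>w t. w > (0 :: int) \<longrightarrow> c / of_int w \<le> \<bar>of_int w * \<theta> - of_int t\<bar>)"

lemma distance_pos_upto: "\<exists>\<mu>>0. \<forall>w t. 0 < w \<and> w \<le> int W \<longrightarrow> \<mu> \<le> \<bar>of_int w * \<theta> - of_int t\<bar>"
proof (induction W)
  case 0
  show ?case by (intro exI[of _ 1]) auto
next
  case (Suc W)
  then obtain \<mu> where mu: "\<mu> > 0" "\<And>w t. 0 < w \<Longrightarrow> w \<le> int W \<Longrightarrow> \<mu> \<le> \<bar>of_int w * \<theta> - of_int t\<bar>" by blast
  define z where "z = real_of_int (int (Suc W)) * \<theta>"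
  define \<nu> where "\<nu> = \<bar>z - of_int (round z)\<bar>"
  have "\<nu> > 0" using irrational_multiple_ne[OF theta(3), of "int (Suc W)" "round z"]
    by (auto simp: \<nu>_def z_def)
  moreover have "\<nu> \<le> \<bar>z - of_int t\<bar>" for t unfolding \<nu>_def by (rule round_diff_minimal)
  ultimately show ?case
  proof (intro exI[of _ "min \<mu> \<nu>"] conjI allI impI)
    fix w t assume w: "0 < w \<and> w \<le> int (Suc W)" and nu: "\<And>t. \<nu> \<le> \<bar>z - of_int t\<bar>"
    show "min \<mu> \<nu> \<le> \<bar>of_int w * \<theta> - of_int t\<bar>"
    proof (cases "w = int (Suc W)")
      case True
      then show ?thesis using nu[of t] by (simp add: z_def)
    next
      case False
      then show ?thesis using mu(2)[of w t] w by simp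
    qed
  qed (use mu in auto)
qed

text \<open>A reduced fraction that approximates \<theta> unusually well is one member of the pair;
  the sign of its error tells on which side it lies. The other member is the partner with the
  largest denominator that still lies on the opposite side, roughly 1/|\<epsilon>|.\<close>

lemma unbalanced_pairs:
  assumes "\<And>c. \<not> badly_approximable c" and M: "1 \<le> M"
  shows "\<exists>q Q p P. unimodular_pair \<theta> \<alpha> q Q p P \<and> (W \<le> q \<and> M * q \<le> Q \<or> W \<le> Q \<and> M * Q \<le> q)"
proof -
  obtain \<mu> where mu: "\<mu> > 0" "\<And>w t. 0 < w \<Longrightarrow> w \<le> int W \<Longrightarrow> \<mu> \<le> \<bar>of_int w * \<theta> - of_int t\<bar>"
    using distance_pos_upto[of W] by blast
  \<comment> \<open>The bound \<mu> excludes denominators up to W even after the fraction is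
    reduced; 1/(M + 1) forces the ratio M between the two denominators.\<close>
  define c where "c = min \<mu> (1 / (real M + 1))"
  have c: "c > 0" "c \<le> \<mu>" "c \<le> 1 / (real M + 1)" using mu by (auto simp: c_def)
  from assms(1)[of c] c obtain w t :: int where wt: "w > 0" "\<bar>of_int w * \<theta> - of_int t\<bar> < c / of_int w"
    unfolding badly_approximable_def by (meson not_le)
  define g where "g = gcd w t"
  have g: "g \<ge> 1" using wt(1) by (simp add: g_def int_one_le_iff_zero_less)
  define w0 where "w0 = w div g"
  define t0 where "t0 = t div g"
  have w: "w = g * w0" and t: "t = g * t0" by (auto simp: w0_def t0_def g_def)
  have w0: "w0 \<ge> 1" using wt(1) g unfolding w by (simp add: zero_less_mult_iff)
  have cop: "coprime w0 t0" unfolding w0_def t0_def g_def using wt(1) by (intro div_gcd_coprime) auto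
  define \<epsilon> where "\<epsilon> = of_int w0 * \<theta> - of_int t0"
  have "of_int g * \<bar>\<epsilon>\<bar> = \<bar>of_int w * \<theta> - of_int t\<bar>"
  proof -
    have "of_int w * \<theta> - of_int t = of_int g * \<epsilon>" by (simp add: w t \<epsilon>_def algebra_simps)
    then show ?thesis using g by (simp add: abs_mult)
  qed
  moreover have "1 * \<bar>\<epsilon>\<bar> \<le> of_int g * \<bar>\<epsilon>\<bar>" using g by (intro mult_right_mono) auto
  moreover have "c / of_int w \<le> c / of_int w0"
  proof -
    have "1 * w0 \<le> g * w0" using g w0 by (intro mult_right_mono) auto
    then show ?thesis using c w0 unfolding w by (intro divide_left_mono mult_pos_pos) (auto simp: w[symmetric] wt)
  qed
  ultimately have eps: "\<bar>\<epsilon>\<bar> < c / of_int w0" using wt(2) by linarith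
  have w0W: "w0 > int W"
  proof (rule ccontr)
    assume "\<not> ?thesis"
    then have "\<mu> \<le> \<bar>\<epsilon>\<bar>" unfolding \<epsilon>_def using w0 by (intro mu(2)) auto
    also have "\<dots> < c / of_int w0" by (rule eps)
    also have "\<dots> \<le> c / 1" using c w0 by (intro divide_left_mono) auto
    finally show False using c by simp
  qed
  have eps0: "\<epsilon> \<noteq> 0" using irrational_multiple_ne[OF theta(3), of w0 t0] w0 by (simp add: \<epsilon>_def)
  obtain u v where uv: "u * w0 + v * t0 = 1" using cop bezout_int[of w0 t0] by auto
  \<comment> \<open>The determinant condition fixes the partner denominator modulo w0. Below
    1/|\<epsilon>| the partner lies on the other side of \<theta>, and a window of length w0 meets
    every residue class.\<close>
  have ex: "\<exists>j. 1 / \<bar>\<epsilon>\<bar> - of_int w0 \<le> of_int (k + j * w0) \<and> of_int (k + j * w0) < 1 / \<bar>\<epsilon>\<bar>" for k :: int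
  proof -
    define j where "j = \<lceil>(1 / \<bar>\<epsilon>\<bar> - of_int k) / of_int w0\<rceil> - 1"
    have "of_int j < (1 / \<bar>\<epsilon>\<bar> - of_int k) / of_int w0" "(1 / \<bar>\<epsilon>\<bar> - of_int k) / of_int w0 \<le> of_int j + 1"
      unfolding j_def by linarith+
    then have "of_int j * of_int w0 < 1 / \<bar>\<epsilon>\<bar> - of_int k" "1 / \<bar>\<epsilon>\<bar> - of_int k \<le> (of_int j + 1) * of_int w0"
      using w0 by (auto simp: less_divide_eq divide_le_eq)
    then show ?thesis by (intro exI[of _ j]) (auto simp: algebra_simps)
  qed
  have big: "real M * of_int w0 < 1 / \<bar>\<epsilon>\<bar> - of_int w0"
  proof -
    have "c * (real M + 1) \<le> 1" using c(3) by (simp add: field_simps)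
    then have "c * (real M + 1) * of_int w0 \<le> 1 * of_int w0" using w0 by (intro mult_right_mono) auto
    then have "(real M + 1) * of_int w0 \<le> of_int w0 / c" using c(1)
      by (simp add: le_divide_eq mult_ac)
    also have "\<dots> < 1 / \<bar>\<epsilon>\<bar>" using eps eps0 c w0 by (simp add: field_simps)
    finally show ?thesis by (simp add: algebra_simps)
  qed
  have Mw0: "1 \<le> real M * of_int w0" using M w0 mult_mono[of 1 "real M" 1 "of_int w0"] by simp
  show ?thesis
  proof (cases "\<epsilon> > 0")
    case True
    obtain j where j: "1 / \<bar>\<epsilon>\<bar> - of_int w0 \<le> of_int (- v + j * w0)" "of_int (- v + j * w0) < 1 / \<bar>\<epsilon>\<bar>"
      using ex[of "- v"] by blast
    define Q where "Q = - v + j * w0"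
    define P where "P = u + j * t0"
    have det: "P * w0 - t0 * Q = 1" using uv by (simp add: P_def Q_def algebra_simps)
    have QM: "real M * of_int w0 < of_int Q" using big j(1) by (simp add: Q_def)
    have Q1: "Q \<ge> 1" using QM Mw0 by linarith
    have "of_int w0 * (of_int P - of_int Q * \<theta>) = 1 - of_int Q * \<epsilon>"
    proof -
      have "of_int (P * w0 - t0 * Q) = (1 :: real)" by (simp add: det)
      then show ?thesis by (simp add: \<epsilon>_def algebra_simps)
    qed
    also have "\<dots> > 0" using j(2)[folded Q_def] True by (simp add: less_divide_eq)
    finally have "of_int Q * \<theta> < of_int P" using w0 by (simp add: zero_less_mult_iff)
    then have "unimodular_pair \<theta> \<alpha> (nat w0) (nat Q) t0 P"
      using True w0 Q1 det by (intro unimodular_pairI) (auto simp: \<epsilon>_def)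
    moreover have "M * nat w0 \<le> nat Q"
    proof -
      have "real_of_int (int M * w0) < of_int Q" using QM by simp
      then have "int M * w0 < Q" by (simp only: of_int_less_iff)
      then show ?thesis using w0 Q1 by (simp add: nat_le_iff le_nat_iff)
    qed
    ultimately show ?thesis using w0W by (intro exI[of _ "nat w0"] exI[of _ "nat Q"] exI[of _ t0] exI[of _ P]) auto
  next
    case False
    then have neg: "\<epsilon> < 0" using eps0 by simp
    obtain j where j: "1 / \<bar>\<epsilon>\<bar> - of_int w0 \<le> of_int (v + j * w0)" "of_int (v + j * w0) < 1 / \<bar>\<epsilon>\<bar>"
      using ex[of v] by blast
    define q where "q = v + j * w0"
    define p where "p = - u + j * t0"
    have det: "t0 * q - p * w0 = 1" using uv by (simp add: p_def q_def algebra_simps)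
    have QM: "real M * of_int w0 < of_int q" using big j(1) by (simp add: q_def)
    have q1: "q \<ge> 1" using QM Mw0 by linarith
    have "of_int w0 * (of_int q * \<theta> - of_int p) = 1 + of_int q * \<epsilon>"
    proof -
      have "of_int (t0 * q - p * w0) = (1 :: real)" by (simp add: det)
      then show ?thesis by (simp add: \<epsilon>_def algebra_simps)
    qed
    also have "\<dots> > 0"
    proof -
      have "of_int q * \<bar>\<epsilon>\<bar> < 1" using j(2)[folded q_def] neg pos_less_divide_eq[of "\<bar>\<epsilon>\<bar>" "of_int q" 1] by simp
      then show ?thesis using neg by simp
    qed
    finally have "of_int p < of_int q * \<theta>" using w0 by (simp add: zero_less_mult_iff)
    then have "unimodular_pair \<theta> \<alpha> (nat q) (nat w0) p t0"
      using neg w0 q1 det by (intro unimodular_pairI) (auto simp: \<epsilon>_def)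
    moreover have "M * nat w0 \<le> nat q"
    proof -
      have "real_of_int (int M * w0) < of_int q" using QM by simp
      then have "int M * w0 < q" by (simp only: of_int_less_iff)
      then show ?thesis using w0 q1 by (simp add: nat_le_iff le_nat_iff)
    qed
    ultimately show ?thesis using w0W by (intro exI[of _ "nat q"] exI[of _ "nat w0"] exI[of _ p] exI[of _ t0]) auto
  qed
qed

end

text \<open>The term at m + t, divided by the first one at m, is at most a constant times (t + 1)^e
  |x|^t, uniformly in q, since m + t + q <= (m + q)(t + 1). If the next index is at least g0 later,
  the remaining terms add up to less than half of the first.\<close>

lemma sparse_series_bounds:
  fixes x :: complex and c1 C1 :: real and e :: nat
  assumes x: "x \<noteq> 0" "norm x < 1" and c1: "0 < c1" "0 < C1"
  obtains K g0 where "K > 0"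
    "\<And>Mis w q g m. (\<And>n. n \<in> Mis \<Longrightarrow> c1 * real (n + q) ^ e \<le> norm (w n) \<and> norm (w n) \<le> C1 * real (n + q) ^ e) \<Longrightarrow>
       1 \<le> q \<Longrightarrow> g0 \<le> g \<Longrightarrow> m \<in> Mis \<Longrightarrow> (\<And>n. n \<in> Mis \<Longrightarrow> m < n \<Longrightarrow> m + g \<le> n) \<Longrightarrow>
       (\<Sum>n. (if n \<in> Mis \<and> m \<le> n then w n else 0) * x ^ n) \<noteq> 0 \<and>
       norm (\<Sum>n. (if n \<in> Mis \<and> m \<le> n then w n else 0) * x ^ n) \<le> K * norm x ^ m * real (m + q) ^ e"
proof -
  define r where "r = norm x"
  have r: "0 < r" "r < 1" using x by (auto simp: r_def)
  define h where "h t = (real t + 1) ^ e * r ^ t" for t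
  have h: "summable h" "\<And>t. h t \<ge> 0" unfolding h_def using r by (auto intro!: summable_poly_power)
  have "(\<lambda>g. \<Sum>t. h (t + g)) \<longlonglongrightarrow> 0" by (rule suminf_exist_split2[OF h(1)])
  then have "\<forall>\<^sub>F g in sequentially. (\<Sum>t. h (t + g)) < c1 / (2 * C1)"
    using c1 by (intro order_tendstoD) auto
  then obtain g1 where g1: "\<And>g. g \<ge> g1 \<Longrightarrow> (\<Sum>t. h (t + g)) < c1 / (2 * C1)"
    by (auto simp: eventually_sequentially)
  define g0 where "g0 = max g1 1"
  define K where "K = C1 * (suminf h + 1)"
  have K: "K > 0" using c1 suminf_nonneg[OF h] by (simp add: K_def)
  show thesis
  proof (rule that[of K g0])
    show "K > 0" by (rule K)
    fix Mis :: "nat set" and w :: "nat \<Rightarrow> complex" and q g m :: nat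
    assume w: "\<And>n. n \<in> Mis \<Longrightarrow> c1 * real (n + q) ^ e \<le> norm (w n) \<and> norm (w n) \<le> C1 * real (n + q) ^ e"
      and q: "1 \<le> q" and g: "g0 \<le> g" and m: "m \<in> Mis" and gap: "\<And>n. n \<in> Mis \<Longrightarrow> m < n \<Longrightarrow> m + g \<le> n"
    define T where "T n = (if n \<in> Mis \<and> m \<le> n then w n else 0) * x ^ n" for n
    define v where "v t = (if m + t \<in> Mis then w (m + t) else 0)" for t
    define R where "R = real (m + q) ^ e"
    have R: "R > 0" using q by (simp add: R_def)
    have vb: "norm (v t * x ^ t) \<le> C1 * R * h t" for t
    proof (cases "m + t \<in> Mis")
      case True
      have "1 * real t \<le> real (m + q) * real t" using q by (intro mult_right_mono) auto
      then have "real (m + t + q) \<le> real (m + q) * (real t + 1)" by (simp add: distrib_left)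
      then have "real (m + t + q) ^ e \<le> R * (real t + 1) ^ e"
        unfolding R_def power_mult_distrib[symmetric] by (intro power_mono) auto
      then have "C1 * real (m + t + q) ^ e \<le> C1 * (R * (real t + 1) ^ e)" using c1 by (intro mult_left_mono) auto
      moreover have "norm (v t) \<le> C1 * real (m + t + q) ^ e" using w[OF True] True by (simp add: v_def)
      ultimately have "norm (v t) \<le> C1 * (R * (real t + 1) ^ e)" by linarith
      then have "norm (v t) * r ^ t \<le> C1 * (R * (real t + 1) ^ e) * r ^ t" using r by (intro mult_right_mono) auto
      then show ?thesis by (simp add: norm_mult norm_power r_def h_def mult_ac)
    next
      case False
      then show ?thesis using c1 R h by (simp add: v_def)
    qed
    have sv: "summable (\<lambda>t. norm (v t * x ^ t))"
      by (rule summable_comparison_test[OF _ summable_mult[OF h(1), of "C1 * R"]]) (use vb in auto)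
    have sv': "summable (\<lambda>t. v t * x ^ t)" using sv by (rule summable_norm_cancel)
    have shiftT: "T (t + m) = x ^ m * (v t * x ^ t)" for t by (simp add: T_def v_def power_add add.commute)
    have sT: "summable (\<lambda>t. T (t + m))" unfolding shiftT by (intro summable_mult sv')
    then have "summable T" by (simp only: summable_iff_shift)
    then have "suminf T = (\<Sum>t. T (t + m)) + (\<Sum>t<m. T t)" by (rule suminf_split_initial_segment)
    also have "(\<Sum>t<m. T t) = 0" by (intro sum.neutral) (auto simp: T_def)
    also have "(\<Sum>t. T (t + m)) = x ^ m * (\<Sum>t. v t * x ^ t)" unfolding shiftT by (rule suminf_mult[OF sv'])
    finally have T: "suminf T = x ^ m * (\<Sum>t. v t * x ^ t)" by simp
    have upper: "norm (\<Sum>t. v t * x ^ t) \<le> K * R"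
    proof -
      have "norm (\<Sum>t. v t * x ^ t) \<le> (\<Sum>t. norm (v t * x ^ t))" by (rule summable_norm[OF sv])
      also have "\<dots> \<le> (\<Sum>t. C1 * R * h t)" by (intro suminf_le vb sv summable_mult h)
      also have "\<dots> = C1 * R * suminf h" by (rule suminf_mult[OF h(1)])
      also have "\<dots> \<le> K * R" using c1 R by (simp add: K_def mult_ac)
      finally show ?thesis .
    qed
    have lower: "(\<Sum>t. v t * x ^ t) \<noteq> 0"
    proof
      assume zero: "(\<Sum>t. v t * x ^ t) = 0"
      have "(\<Sum>t. v t * x ^ t) = (\<Sum>t. v (t + g) * x ^ (t + g)) + (\<Sum>t<g. v t * x ^ t)"
        by (rule suminf_split_initial_segment[OF sv'])
      also have "(\<Sum>t<g. v t * x ^ t) = (\<Sum>t<g. if t = 0 then w m else 0)"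
      proof (rule sum.cong[OF refl])
        fix t assume t: "t \<in> {..<g}"
        show "v t * x ^ t = (if t = 0 then w m else 0)"
        proof (cases "t = 0")
          case False
          then have "m + t \<notin> Mis" using gap[of "m + t"] t by auto
          then show ?thesis using False by (simp add: v_def)
        qed (use m in \<open>simp add: v_def\<close>)
      qed
      also have "\<dots> = w m" using g by (simp add: g0_def)
      finally have "w m = - (\<Sum>t. v (t + g) * x ^ (t + g))" using zero by (simp add: eq_neg_iff_add_eq_0 add.commute)
      then have "norm (w m) = norm (\<Sum>t. v (t + g) * x ^ (t + g))" by simp
      also have "\<dots> \<le> (\<Sum>t. norm (v (t + g) * x ^ (t + g)))"
        by (intro summable_norm) (rule summable_ignore_initial_segment[OF sv])
      also have "\<dots> \<le> (\<Sum>t. C1 * R * h (t + g))"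
        by (intro suminf_le vb summable_mult summable_ignore_initial_segment[OF sv] summable_ignore_initial_segment[OF h(1)])
      also have "\<dots> = C1 * R * (\<Sum>t. h (t + g))"
        by (intro suminf_mult summable_ignore_initial_segment[OF h(1)])
      also have "\<dots> < C1 * R * (c1 / (2 * C1))" using g1[of g] g c1 R by (intro mult_strict_left_mono) (auto simp: g0_def)
      also have "\<dots> = c1 * R / 2" using c1 by simp
      finally have "norm (w m) < c1 * R / 2" .
      moreover have "c1 * R \<le> norm (w m)" using w[OF m] by (simp add: R_def)
      ultimately show False using c1 R by (smt (verit) mult_pos_pos field_sum_of_halves)
    qed
    show "(\<Sum>n. (if n \<in> Mis \<and> m \<le> n then w n else 0) * x ^ n) \<noteq> 0 \<and>
       norm (\<Sum>n. (if n \<in> Mis \<and> m \<le> n then w n else 0) * x ^ n) \<le> K * norm x ^ m * real (m + q) ^ e"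
      unfolding T_def[symmetric] T using lower upper x
      by (simp add: norm_mult norm_power R_def mult_left_mono mult_ac)
  qed
qed

text \<open>The situation to be refuted: the sum S belongs to a filtration with Liouville's bound,
  as it would if it were algebraic.\<close>

locale hecke_mahler = irrational_rotation \<theta> \<alpha> + filtration Z \<kappa> \<beta> S
  for \<theta> \<alpha> :: real and Z \<kappa> \<beta> S +
  fixes f :: "int poly"
  assumes beta_gt_1: "norm \<beta> > 1" and deg_f: "degree f > 0"
    and S_def': "S = (\<Sum>n. of_int (poly f (s n)) * inverse \<beta> ^ n)"
begin

sublocale word_transcendence Z \<kappa> \<beta> S s "inverse \<beta>" f
proof
  show "norm (inverse \<beta>) < 1" using beta_gt_1 by (simp add: norm_inverse inverse_less_1_iff)
  then have "rotation_word s (inverse \<beta>)" using s_range by unfold_locales auto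
  then show "S = rotation_word.Ser s (inverse \<beta>) (poly f)" using S_def' by (simp add: rotation_word.Ser_def)
qed (use s_range beta_gt_1 in auto)

abbreviation "x \<equiv> inverse \<beta>"

definition wval :: "int \<Rightarrow> int \<Rightarrow> nat \<Rightarrow> nat \<Rightarrow> complex" where
  "wval \<sigma> p q n = poly (wpoly (degree f) p (nab \<sigma> (poly f)) (s n + p)) (x ^ q)"

lemma x_nonzero: "x \<noteq> 0" and norm_x: "0 < norm x" "norm x < 1"
  using beta_gt_1 x by auto

lemma y_bounds:
  assumes "real q * \<theta> - 1 \<le> of_int p" "p \<le> int q" "4 / \<theta> \<le> real q"
  shows "\<theta> / 2 * real (n + q) \<le> of_int (s n + p)" "of_int (s n + p) \<le> real (n + q)"
proof -
  \<comment> \<open>The floor in s n and the rounding in p lose at most 1 each; half of q\<theta>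
    pays for both.\<close>
  have "4 \<le> real q * \<theta>" using assms(3) theta by (simp add: divide_le_eq)
  moreover have "0 \<le> real n * \<theta>" using theta by simp
  ultimately show "\<theta> / 2 * real (n + q) \<le> of_int (s n + p)"
    using s_gt[of n] alpha assms(1) by (simp add: algebra_simps)
  show "of_int (s n + p) \<le> real (n + q)" using s_range[of n] assms(2) by linarith
qed

text \<open>The argument s n + p is comparable with n + q, and x^q is small, so the constant
  coefficient of the mismatch polynomial decides the size. It contributes at least y^e / 2 and the
  others at most y^e / 4 once q is large.\<close>

lemma wval_bounds:
  assumes sigma: "\<sigma> \<noteq> 0"
  obtains c1 C1 q0 e where "0 < c1" "0 < C1" "1 \<le> q0"
    "\<And>p q n. q0 \<le> q \<Longrightarrow> 0 \<le> p \<Longrightarrow> p \<le> int q \<Longrightarrow> real q * \<theta> - 1 \<le> of_int p \<Longrightarrow>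
       c1 * real (n + q) ^ e \<le> norm (wval \<sigma> p q n) \<and> norm (wval \<sigma> p q n) \<le> C1 * real (n + q) ^ e"
proof -
  define D where "D = degree f"
  obtain G where G: "G \<noteq> 0" "nab \<sigma> (poly f) = poly G" using nab_poly_nonzero[OF deg_f sigma] .
  define e where "e = degree G"
  define l where "l = lead_coeff G"
  have l: "1 \<le> \<bar>real_of_int l\<bar>" using G(1) leading_coeff_0_iff[of G] unfolding l_def by linarith
  obtain y0 C where yC: "y0 \<ge> 1" "C > 0"
    "\<And>p y j. y0 \<le> y \<Longrightarrow> 0 \<le> p \<Longrightarrow> p \<le> y \<Longrightarrow> norm (coeff (wpoly D p (poly G) y) j) \<le> C * real_of_int y ^ e"
    "\<And>p y. y0 \<le> y \<Longrightarrow> Re (coeff (wpoly D p (poly G) y) 0 / of_int l) \<ge> real_of_int y ^ e / 2"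
    using wpoly_bounds[OF G(1), of D] unfolding e_def l_def by blast
  have "(\<lambda>q. real D * C * norm x ^ q) \<longlonglongrightarrow> real D * C * 0"
    using norm_x by (intro tendsto_mult_left LIMSEQ_power_zero) auto
  then have "\<forall>\<^sub>F q in sequentially. real D * C * norm x ^ q < 1 / 4"
    by (intro order_tendstoD) auto
  then obtain q1 where q1: "\<And>q. q \<ge> q1 \<Longrightarrow> real D * C * norm x ^ q < 1 / 4"
    by (auto simp: eventually_sequentially)
  define A where "A = nat \<lceil>4 / \<theta>\<rceil>"
  define B where "B = nat \<lceil>(real_of_int y0 + 1) / \<theta>\<rceil>"
  have AB: "4 / \<theta> \<le> real A" "(real_of_int y0 + 1) / \<theta> \<le> real B"
    unfolding A_def B_def by (rule real_nat_ceiling_ge)+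
  define q0 where "q0 = max q1 (A + B + 1)"
  define c1 where "c1 = (\<theta> / 2) ^ e / 4"
  define C1 where "C1 = (real D + 1) * C"
  show thesis
  proof (rule that[of c1 C1 q0 e])
    show "0 < c1" "0 < C1" "1 \<le> q0" using theta yC by (auto simp: c1_def C1_def q0_def)
    fix p :: int and q n :: nat
    assume q: "q0 \<le> q" and p: "0 \<le> p" "p \<le> int q" "real q * \<theta> - 1 \<le> of_int p"
    define y where "y = s n + p"
    have "real A \<le> real q" "real B \<le> real q" using q by (auto simp: q0_def)
    with AB have qq: "4 / \<theta> \<le> real q" "(real_of_int y0 + 1) / \<theta> \<le> real q" by linarith+
    have "real_of_int y0 + 1 \<le> real q * \<theta>" using qq(2) theta by (simp add: divide_le_eq)
    then have "y0 \<le> p" using p(3) by linarith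
    then have y: "y0 \<le> y" "p \<le> y" "1 \<le> y" using s_range(1)[of n] yC(1) by (auto simp: y_def)
    have yb: "\<theta> / 2 * real (n + q) \<le> of_int y" "of_int y \<le> real (n + q)"
      using y_bounds[OF p(3,2) qq(1)] by (auto simp: y_def)
    define P where "P = wpoly D p (poly G) y"
    define Y where "Y = x ^ q"
    have Y1: "norm Y \<le> 1" unfolding Y_def norm_power using norm_x by (intro power_le_one) auto
    have wv: "wval \<sigma> p q n = poly P Y" by (simp add: wval_def P_def Y_def D_def G(2) y_def)
    have "poly P Y = (\<Sum>j\<le>D. coeff P j * Y ^ j)"
      using poly_as_sum_of_monoms'[of P D] degree_wpoly[of D p "poly G" y]
      by (metis (no_types, lifting) P_def poly_monom poly_sum sum.cong)
    then have split: "poly P Y = coeff P 0 + (\<Sum>j<D. coeff P (Suc j) * Y ^ Suc j)"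
      by (simp only: lessThan_Suc_atMost[symmetric] sum.lessThan_Suc_shift) simp
    have cb: "norm (coeff P j) \<le> C * real_of_int y ^ e" for j
      unfolding P_def using y p by (intro yC(3)) auto
    have Cy: "0 \<le> C * real_of_int y ^ e" using yC y by simp
    have rest: "norm (\<Sum>j<D. coeff P (Suc j) * Y ^ Suc j) \<le> real D * (C * real_of_int y ^ e * norm Y)"
    proof -
      have "norm (\<Sum>j<D. coeff P (Suc j) * Y ^ Suc j) \<le> (\<Sum>j<D. C * real_of_int y ^ e * norm Y)"
      proof (rule sum_norm_le)
        fix j
        have "norm Y ^ Suc j \<le> norm Y ^ 1" using Y1 by (intro power_decreasing) auto
        then show "norm (coeff P (Suc j) * Y ^ Suc j) \<le> C * real_of_int y ^ e * norm Y"
          unfolding norm_mult norm_power using cb Cy by (intro mult_mono) auto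
      qed
      then show ?thesis by simp
    qed
    have up: "norm (poly P Y) \<le> C1 * real_of_int y ^ e"
    proof -
      have "norm (poly P Y) \<le> C * real_of_int y ^ e + real D * (C * real_of_int y ^ e * norm Y)"
        unfolding split by (intro order.trans[OF norm_triangle_ineq] add_mono cb rest)
      also have "\<dots> \<le> C * real_of_int y ^ e + real D * (C * real_of_int y ^ e * 1)"
        using Y1 Cy by (intro add_left_mono mult_left_mono) auto
      finally show ?thesis by (simp add: C1_def algebra_simps)
    qed
    have low: "real_of_int y ^ e / 4 \<le> norm (poly P Y)"
    proof -
      have "real_of_int y ^ e / 2 \<le> Re (coeff P 0 / of_int l)" unfolding P_def using y by (intro yC(4)) auto
      also have "\<dots> \<le> norm (coeff P 0 / of_int l)" by (rule complex_Re_le_cmod)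
      also have "\<dots> = norm (coeff P 0) / \<bar>real_of_int l\<bar>" by (simp add: norm_divide)
      also have "\<dots> \<le> norm (coeff P 0) / 1" using l by (intro divide_left_mono) auto
      finally have a: "real_of_int y ^ e / 2 \<le> norm (coeff P 0)" by simp
      have "real D * (C * real_of_int y ^ e * norm Y) = (real D * C * norm x ^ q) * real_of_int y ^ e"
        by (simp add: Y_def norm_power)
      also have "\<dots> \<le> (1 / 4) * real_of_int y ^ e"
        using q1[of q] q y by (intro mult_right_mono) (auto simp: q0_def)
      finally have "norm (\<Sum>j<D. coeff P (Suc j) * Y ^ Suc j) \<le> real_of_int y ^ e / 4" using rest by linarith
      then show ?thesis using a norm_diff_ineq[of "coeff P 0" "\<Sum>j<D. coeff P (Suc j) * Y ^ Suc j"]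
        unfolding split by linarith
    qed
    have "c1 * real (n + q) ^ e = (\<theta> / 2 * real (n + q)) ^ e / 4" by (simp add: c1_def power_mult_distrib power_divide)
    also have "\<dots> \<le> real_of_int y ^ e / 4" using yb theta by (intro divide_right_mono power_mono) auto
    finally have "c1 * real (n + q) ^ e \<le> norm (poly P Y)" using low by linarith
    moreover have "C1 * real_of_int y ^ e \<le> C1 * real (n + q) ^ e"
      using yb(2) y \<open>0 < C1\<close> by (intro mult_left_mono power_mono) auto
    ultimately show "c1 * real (n + q) ^ e \<le> norm (wval \<sigma> p q n) \<and> norm (wval \<sigma> p q n) \<le> C1 * real (n + q) ^ e"
      unfolding wv using up by linarith
  qed
qed

end

context hecke_mahler
begin

text \<open>
  Drop the first mismatch \<open>n0\<close> if \<open>n0 < k * q\<close>, which costs a factor \<open>\<beta>^n0\<close>. The gaps are at least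
  \<open>2 * k\<^sup>2 * q\<close>, so the next mismatch is at least \<open>k * (q + n0)\<close>. Its term dominates the rest of the
  series, which is therefore nonzero but smaller than the Liouville bound \<open>\<delta>^(q + n0)\<close>.
\<close>
lemma no_unbalanced_shift:
  assumes sigma: "\<sigma> \<noteq> 0"
  obtains M q0 where "1 \<le> M"
    "\<And>q p Mis g. word_shift s x q p \<sigma> Mis \<Longrightarrow> 0 \<le> p \<Longrightarrow> p \<le> int q \<Longrightarrow> real q * \<theta> - 1 \<le> of_int p \<Longrightarrow>
      (\<And>n m. n \<in> Mis \<Longrightarrow> m \<in> Mis \<Longrightarrow> n < m \<Longrightarrow> n + g \<le> m) \<Longrightarrow> (\<And>N. \<exists>n\<in>Mis. N \<le> n) \<Longrightarrow>
      q0 \<le> q \<Longrightarrow> M * q \<le> g \<Longrightarrow> False"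
proof -
  define D where "D = degree f"
  define r where "r = norm x"
  have r: "0 < r" "r < 1" using norm_x by (auto simp: r_def)
  obtain G where G: "nab \<sigma> (poly f) = poly G" using nab_poly_nonzero[OF deg_f sigma] by blast
  obtain c1 C1 q1 e where c: "0 < c1" "0 < C1" "1 \<le> q1"
    "\<And>p q n. q1 \<le> q \<Longrightarrow> 0 \<le> p \<Longrightarrow> p \<le> int q \<Longrightarrow> real q * \<theta> - 1 \<le> of_int p \<Longrightarrow>
       c1 * real (n + q) ^ e \<le> norm (wval \<sigma> p q n) \<and> norm (wval \<sigma> p q n) \<le> C1 * real (n + q) ^ e"
    by (fact wval_bounds[OF sigma])
  obtain K g0 where K: "K > 0" and sparse: "\<And>Mis w q g m. (\<And>n. n \<in> Mis \<Longrightarrow> c1 * real (n + q) ^ e \<le> norm (w n) \<and> norm (w n) \<le> C1 * real (n + q) ^ e) \<Longrightarrow>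
       1 \<le> q \<Longrightarrow> g0 \<le> g \<Longrightarrow> m \<in> Mis \<Longrightarrow> (\<And>n. n \<in> Mis \<Longrightarrow> m < n \<Longrightarrow> m + g \<le> n) \<Longrightarrow>
       (\<Sum>n. (if n \<in> Mis \<and> m \<le> n then w n else 0) * x ^ n) \<noteq> 0 \<and>
       norm (\<Sum>n. (if n \<in> Mis \<and> m \<le> n then w n else 0) * x ^ n) \<le> K * norm x ^ m * real (m + q) ^ e"
    by (fact sparse_series_bounds[OF x_nonzero norm_x(2) c(1,2), of e])
  obtain A1 where A1: "\<And>p q y N. 0 \<le> p \<Longrightarrow> p \<le> int q \<Longrightarrow> 1 \<le> q \<Longrightarrow> 0 \<le> y \<Longrightarrow> y \<le> int N \<Longrightarrow>
    \<beta> ^ (q * D) * poly (wpoly D p (poly G) y) (x ^ q) \<in> Z (A1 * (q + N))"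
    by (fact Z_wpoly[of D G])
  obtain A2 where A2: "\<And>q p \<sigma> Mis. word_shift s x q p \<sigma> Mis \<Longrightarrow> 0 \<le> p \<Longrightarrow> p \<le> int q \<Longrightarrow> 1 \<le> q \<Longrightarrow>
    \<beta> ^ (q * D) * (\<Sum>n. (if n \<in> Mis then wval \<sigma> p q n else 0) * x ^ n) \<in> Z (A2 * q)"
    unfolding wval_def D_def by (fact Z_mismatch_sum)
  define A where "A = 2 * A1 + A2 + 4"
  \<comment> \<open>Liouville's bound per unit of q + L, after division by the clearing power of
    \<beta>, whose exponent is at most (D + 1)(q + L).\<close>
  define \<delta> where "\<delta> = \<kappa> ^ A * r ^ (D + 1)"
  have delta: "0 < \<delta>" using kappa r by (simp add: \<delta>_def)
  have sr: "0 \<le> sqrt r" "sqrt r < 1" using r by auto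
  obtain K' where K': "K' > 0" "\<And>n. (real n + 1) ^ e * sqrt r ^ n \<le> K'"
    using poly_power_bound[OF sr] by blast
  \<comment> \<open>The factor r^m is split into two square roots: one absorbs the polynomial factor
    (m + 1)^e, the other gives (\<delta>/2)^R because m >= k * R. The remaining 2^(-R) beats the
    constant \<open>E\<close> as soon as q >= q2.\<close>
  obtain k0 where k0: "sqrt r ^ k0 < \<delta> / 2" using real_arch_pow_inv[of "\<delta> / 2" "sqrt r"] delta sr by auto
  define k where "k = k0 + 1"
  have k: "sqrt r ^ k \<le> \<delta> / 2"
  proof -
    have "sqrt r ^ k \<le> sqrt r ^ k0" unfolding k_def using sr by (intro power_decreasing) auto
    then show ?thesis using k0 by simp
  qed
  define E where "E = K * 2 ^ e * K'"
  obtain q2 where q2: "E < 2 ^ q2" using real_arch_pow[of 2 E] by auto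
  define M where "M = 2 * k * k"
  define q0 where "q0 = max q1 (max q2 g0)"
  show thesis
  proof (rule that[of M q0])
    show "1 \<le> M" by (simp add: M_def k_def)
    fix q p Mis g
    assume ws: "word_shift s x q p \<sigma> Mis" and p: "0 \<le> p" "p \<le> int q" "real q * \<theta> - 1 \<le> of_int p"
      and gap: "\<And>n m. n \<in> Mis \<Longrightarrow> m \<in> Mis \<Longrightarrow> n < m \<Longrightarrow> n + g \<le> m"
      and unb: "\<And>N. \<exists>n\<in>Mis. N \<le> n" and q: "q0 \<le> q" and Mq: "M * q \<le> g"
    interpret word_shift s x q p \<sigma> Mis by (rule ws)
    have q1: "q1 \<le> q" "1 \<le> q" "q2 \<le> q" "g0 \<le> q" using q c(3) by (auto simp: q0_def)
    have "1 * q \<le> M * q" by (intro mult_le_mono1) (simp add: M_def k_def)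
    then have qg: "q \<le> g" "g0 \<le> g" using Mq q1 by linarith+
    define w where "w n = wval \<sigma> p q n" for n
    have wb: "c1 * real (n + q) ^ e \<le> norm (w n) \<and> norm (w n) \<le> C1 * real (n + q) ^ e" for n
      unfolding w_def using c(4)[OF q1(1) p] .
    have key: False if m: "m \<in> Mis" "k * (q + L) \<le> m"
      and T: "\<beta> ^ (q * D + L) * (\<Sum>n. (if n \<in> Mis \<and> m \<le> n then w n else 0) * x ^ n) \<in> Z (A * (q + L))" for m L
    proof -
      define U where "U = (\<Sum>n. (if n \<in> Mis \<and> m \<le> n then w n else 0) * x ^ n)"
      have U: "U \<noteq> 0" "norm U \<le> K * r ^ m * real (m + q) ^ e"
        using sparse[of Mis q w g m, OF wb q1(2) qg(2) m(1) gap[OF m(1)]] unfolding U_def r_def by blast+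
      define R where "R = q + L"
      have R: "1 \<le> R" "q \<le> R" using q1 by (auto simp: R_def)
      have "\<kappa> ^ (A * R) \<le> norm (\<beta> ^ (q * D + L) * U)"
        using T U(1) beta0 R unfolding U_def[symmetric] R_def[symmetric] by (intro Z_lower) (auto simp: A_def)
      also have "\<dots> = norm \<beta> ^ (q * D + L) * norm U" by (simp add: norm_mult norm_power)
      also have "\<dots> \<le> norm \<beta> ^ ((D + 1) * R) * norm U"
        using beta by (intro mult_right_mono power_increasing) (auto simp: R_def algebra_simps)
      finally have 1: "\<kappa> ^ (A * R) \<le> norm \<beta> ^ ((D + 1) * R) * norm U" .
      have rb: "r * norm \<beta> = 1" using beta0 by (simp add: r_def norm_inverse)
      have "\<delta> ^ R = \<kappa> ^ (A * R) * r ^ ((D + 1) * R)" by (simp only: \<delta>_def power_mult_distrib power_mult)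
      also have "\<dots> \<le> (norm \<beta> ^ ((D + 1) * R) * norm U) * r ^ ((D + 1) * R)"
        using 1 r by (intro mult_right_mono) auto
      also have "\<dots> = (r * norm \<beta>) ^ ((D + 1) * R) * norm U" by (simp only: power_mult_distrib mult_ac)
      also have "\<dots> = norm U" by (simp add: rb)
      finally have "\<delta> ^ R \<le> norm U" .
      also have "\<dots> \<le> K * r ^ m * real (m + q) ^ e" by (rule U(2))
      also have "\<dots> \<le> K * r ^ m * (2 * (real m + 1)) ^ e"
      proof -
        have "1 * (q + L) \<le> k * (q + L)" by (rule mult_le_mono1) (simp add: k_def)
        then have "1 * (q + L) \<le> m" using m(2) by (rule order.trans)
        then have "q \<le> m" by simp
        then have "real (m + q) \<le> 2 * (real m + 1)" by simp
        then show ?thesis using K r by (intro mult_left_mono power_mono) auto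
      qed
      also have "\<dots> = K * 2 ^ e * ((real m + 1) ^ e * sqrt r ^ m) * sqrt r ^ m"
      proof -
        have "r ^ m = sqrt r ^ m * sqrt r ^ m" using r by (simp flip: power_mult_distrib)
        then show ?thesis by (simp only: power_mult_distrib mult_ac)
      qed
      also have "\<dots> \<le> K * 2 ^ e * K' * (\<delta> / 2) ^ R"
      proof (intro mult_mono mult_left_mono K'(2))
        have "sqrt r ^ m \<le> sqrt r ^ (k * R)" using m(2) sr unfolding R_def by (intro power_decreasing) auto
        also have "\<dots> = (sqrt r ^ k) ^ R" by (rule power_mult)
        also have "\<dots> \<le> (\<delta> / 2) ^ R" using k sr by (intro power_mono) auto
        finally show "sqrt r ^ m \<le> (\<delta> / 2) ^ R" .
      qed (use K K' r in auto)
      finally have "\<delta> ^ R \<le> E * (\<delta> / 2) ^ R" by (simp add: E_def)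
      then have "\<delta> ^ R * 2 ^ R \<le> E * \<delta> ^ R" by (simp add: power_divide field_simps)
      then have "2 ^ R \<le> E" using delta by (simp add: mult.commute)
      moreover have "(2 :: real) ^ q2 \<le> 2 ^ R" using q1 R by (intro power_increasing) auto
      ultimately show False using q2 by linarith
    qed
    define n0 where "n0 = (LEAST n. n \<in> Mis)"
    have n0: "n0 \<in> Mis" unfolding n0_def using unb[of 0] by (auto intro: LeastI)
    have n0_le: "n \<in> Mis \<Longrightarrow> n0 \<le> n" for n unfolding n0_def by (rule Least_le)
    have full: "\<beta> ^ (q * D) * (\<Sum>n. (if n \<in> Mis then w n else 0) * x ^ n) \<in> Z (A2 * q)"
      unfolding w_def using A2[OF ws p(1,2) q1(2)] .
    show False
    proof (cases "k * q \<le> n0")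
      case True
      have "(\<lambda>n. (if n \<in> Mis \<and> n0 \<le> n then w n else 0) * x ^ n) = (\<lambda>n. (if n \<in> Mis then w n else 0) * x ^ n)"
        using n0_le by auto
      moreover have "A2 * q \<le> A * (q + 0)" by (simp add: A_def)
      ultimately show False using key[of n0 0] n0 True full Z_le by auto
    next
      case False
      define n1 where "n1 = (LEAST n. n \<in> Mis \<and> n0 < n)"
      have "\<exists>n. n \<in> Mis \<and> n0 < n" using unb[of "Suc n0"] by auto
      then have n1: "n1 \<in> Mis" "n0 < n1" unfolding n1_def by (metis (mono_tags, lifting) LeastI)+
      have n1_le: "n \<in> Mis \<Longrightarrow> n0 < n \<Longrightarrow> n1 \<le> n" for n unfolding n1_def by (intro Least_le) auto
      have "k * (q + n0) \<le> k * (q + k * q)" using False by (intro mult_le_mono2 add_mono) auto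
      also have "\<dots> \<le> k * (k * q + k * q)" by (intro mult_le_mono2 add_mono) (auto simp: k_def)
      also have "\<dots> = M * q" by (simp add: M_def algebra_simps)
      also have "\<dots> \<le> n1" using Mq gap[OF n0 n1] by linarith
      finally have n1_big: "k * (q + n0) \<le> n1" .
      define F where "F n = (if n \<in> Mis then w n else 0) * x ^ n" for n
      have sF: "summable F" using Ser_mismatch(1)[of f] unfolding F_def w_def wval_def .
      have "(\<lambda>n. (if n \<in> Mis \<and> n1 \<le> n then w n else 0) * x ^ n) = (\<lambda>n. F n - (if n = n0 then w n0 * x ^ n0 else 0))"
        using n0_le n1_le n1 n0 by (force simp: F_def)
      moreover have "(\<lambda>n. F n - (if n = n0 then w n0 * x ^ n0 else 0)) sums (suminf F - w n0 * x ^ n0)"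
        using sums_diff[OF summable_sums[OF sF] sums_single[of n0 "\<lambda>_. w n0 * x ^ n0"]] by simp
      ultimately have eq: "(\<Sum>n. (if n \<in> Mis \<and> n1 \<le> n then w n else 0) * x ^ n) = suminf F - w n0 * x ^ n0"
        by (simp add: sums_iff)
      have "\<beta> ^ (q * D + n0) * (suminf F - w n0 * x ^ n0) =
          \<beta> ^ n0 * (\<beta> ^ (q * D) * suminf F) + of_int (- 1) * (\<beta> ^ (q * D) * w n0)"
        using beta_power_x[of n0 n0] by (simp add: power_add right_diff_distrib mult_ac)
      also have "\<dots> \<in> Z ((n0 + 1 + A2 * q + (1 + A1 * (q + (n0 + q)))) + 1)"
      proof (rule Z_add)
        have "\<beta> ^ n0 * (\<beta> ^ (q * D) * suminf F) \<in> Z (n0 + 1 + A2 * q)"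
          using full unfolding F_def by (intro Z_mult Z_beta_power)
        then show "\<beta> ^ n0 * (\<beta> ^ (q * D) * suminf F) \<in> Z (n0 + 1 + A2 * q + (1 + A1 * (q + (n0 + q))))"
          by (rule Z_le) simp
        have "\<beta> ^ (q * D) * w n0 \<in> Z (A1 * (q + (n0 + q)))"
          unfolding w_def wval_def G D_def[symmetric] using p s_range[of n0] q1 by (intro A1) auto
        moreover have "of_int (- 1) \<in> Z 1" by (rule Z_int) auto
        ultimately have "of_int (- 1) * (\<beta> ^ (q * D) * w n0) \<in> Z (1 + A1 * (q + (n0 + q)))" by (intro Z_mult)
        then show "of_int (- 1) * (\<beta> ^ (q * D) * w n0) \<in> Z (n0 + 1 + A2 * q + (1 + A1 * (q + (n0 + q))))"
          by (rule Z_le) simp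
      qed
      finally have "\<beta> ^ (q * D + n0) * (suminf F - w n0 * x ^ n0) \<in> Z ((n0 + 1 + A2 * q + (1 + A1 * (q + (n0 + q)))) + 1)" .
      moreover have "(n0 + 1 + A2 * q + (1 + A1 * (q + (n0 + q)))) + 1 \<le> A * (q + n0)"
        unfolding A_def add_mult_distrib add_mult_distrib2 using q1(2) by linarith
      ultimately have "\<beta> ^ (q * D + n0) * (suminf F - w n0 * x ^ n0) \<in> Z (A * (q + n0))" by (rule Z_le)
      then show False using key[of n1 n0] n1(1) n1_big unfolding eq by blast
    qed
  qed
qed

text \<open>In an unbalanced pair the smaller denominator serves as the shift and the larger one as
  the gap. Which of the two lies below \<theta> decides between \<open>MisU\<close> with \<sigma> =
  1 and \<open>MisD\<close> with \<sigma> = -1, so both signs are needed.\<close>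

theorem badly_approximable_theta: "\<exists>c. badly_approximable c"
proof (rule ccontr)
  assume "\<not> ?thesis"
  then have nb: "\<And>c. \<not> badly_approximable c" by blast
  have m1: "- 1 \<noteq> (0 :: int)" by simp
  obtain M1 W1 where 1: "1 \<le> M1" "\<And>q p Mis g. word_shift s x q p 1 Mis \<Longrightarrow> 0 \<le> p \<Longrightarrow> p \<le> int q \<Longrightarrow> real q * \<theta> - 1 \<le> of_int p \<Longrightarrow>
      (\<And>n m. n \<in> Mis \<Longrightarrow> m \<in> Mis \<Longrightarrow> n < m \<Longrightarrow> n + g \<le> m) \<Longrightarrow> (\<And>N. \<exists>n\<in>Mis. N \<le> n) \<Longrightarrow>
      W1 \<le> q \<Longrightarrow> M1 * q \<le> g \<Longrightarrow> False"
    by (fact no_unbalanced_shift[OF one_neq_zero])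
  obtain M2 W2 where 2: "1 \<le> M2" "\<And>q p Mis g. word_shift s x q p (- 1) Mis \<Longrightarrow> 0 \<le> p \<Longrightarrow> p \<le> int q \<Longrightarrow> real q * \<theta> - 1 \<le> of_int p \<Longrightarrow>
      (\<And>n m. n \<in> Mis \<Longrightarrow> m \<in> Mis \<Longrightarrow> n < m \<Longrightarrow> n + g \<le> m) \<Longrightarrow> (\<And>N. \<exists>n\<in>Mis. N \<le> n) \<Longrightarrow>
      W2 \<le> q \<Longrightarrow> M2 * q \<le> g \<Longrightarrow> False"
    by (fact no_unbalanced_shift[OF m1])
  have "1 \<le> max M1 M2" using 1(1) by simp
  from unbalanced_pairs[OF nb this, of "max W1 W2"]
  obtain q Q p P where pr: "unimodular_pair \<theta> \<alpha> q Q p P"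
    and cs: "max W1 W2 \<le> q \<and> max M1 M2 * q \<le> Q \<or> max W1 W2 \<le> Q \<and> max M1 M2 * Q \<le> q" by blast
  interpret unimodular_pair \<theta> \<alpha> q Q p P by (rule pr)
  have le: "M1 * n \<le> max M1 M2 * n" "M2 * n \<le> max M1 M2 * n" for n by (auto intro: mult_le_mono1)
  from cs show False
  proof
    assume a: "max W1 W2 \<le> q \<and> max M1 M2 * q \<le> Q"
    show False
    proof (rule 1(2)[of q p MisU Q])
      show "word_shift s x q p 1 MisU" using shift_up by unfold_locales auto
      show "\<exists>n\<in>MisU. N \<le> n" for N using mismatch_unbounded[OF q shift_up] .
      show "real q * \<theta> - 1 \<le> of_int p" using eta_bounds by (simp add: \<eta>_def)
      show "M1 * q \<le> Q" using a le(1)[of q] by linarith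
    qed (use p_range MisU_gap a in auto)
  next
    assume a: "max W1 W2 \<le> Q \<and> max M1 M2 * Q \<le> q"
    show False
    proof (rule 2(2)[of Q P MisD q])
      show "word_shift s x Q P (- 1) MisD" using shift_down by unfold_locales auto
      show "\<exists>n\<in>MisD. N \<le> n" for N using mismatch_unbounded[OF Q shift_down] .
      show "real Q * \<theta> - 1 \<le> of_int P" using eta'_pos by simp
      show "M2 * Q \<le> q" using a le(2)[of Q] by linarith
    qed (use P_range MisD_gap a in auto)
  qed
qed

end

section \<open>Transcendence of Sturmian series\<close>

text \<open>
  A series of type \<^typ>\<open>complex poly fps\<close> stands for \<open>F(X, Y)\<close>, with \<open>X\<close> the series variable and \<open>Y\<close> the
  polynomial variable; \<open>fev y\<close> substitutes \<open>Y = y\<close>.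
\<close>
definition fev :: "complex \<Rightarrow> complex poly fps \<Rightarrow> complex fps" where
  "fev y F = Abs_fps (\<lambda>i. poly (fps_nth F i) y)"

lemma fev_nth [simp]: "fps_nth (fev y F) i = poly (fps_nth F i) y"
  by (simp add: fev_def)

lemma fev_add: "fev y (F + G) = fev y F + fev y G"
  by (rule fps_ext) simp

lemma fev_0: "fev y 0 = 0"
  by (rule fps_ext) simp

lemma fev_mult: "fev y (F * G) = fev y F * fev y G"
  by (rule fps_ext) (simp add: fps_mult_nth poly_sum)

lemma fev_1: "fev y 1 = 1"
  by (rule fps_ext) simp

lemma fev_power: "fev y (F ^ n) = fev y F ^ n"
  by (induction n) (auto simp: fev_1 fev_mult)

lemma fev_const: "fev y (fps_const p) = fps_const (poly p y)"
  by (rule fps_ext) simp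

lemma fev_X: "fev y fps_X = fps_X"
  by (rule fps_ext) (simp add: fps_X_def)

definition Phi :: "complex poly fps \<Rightarrow> nat \<times> nat \<times> nat \<Rightarrow> complex poly fps" where
  "Phi G = (\<lambda>(a, b, t). fps_X ^ a * fps_const (monom 1 b) * G ^ t)"

lemma fev_Phi: "fev y (Phi G (a, b, t)) = fps_X ^ a * fps_const (y ^ b) * fev y G ^ t"
  by (simp add: Phi_def fev_mult fev_power fev_const fev_X poly_monom)

lemma eval_Phi:
  assumes "norm x < fps_conv_radius (fev y G)"
  shows "norm x < fps_conv_radius (fev y (Phi G k))"
    and "eval_fps (fev y (Phi G k)) x = x ^ fst k * y ^ fst (snd k) * eval_fps (fev y G) x ^ snd (snd k)"
proof -
  obtain a b t where k: "k = (a, b, t)" by (cases k) auto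
  have c: "fps_conv_radius (fps_X ^ a * fps_const (y ^ b)) = \<infinity>"
    using fps_conv_radius_mult[of "fps_X ^ a" "fps_const (y ^ b)"] by simp
  have p: "norm x < fps_conv_radius (fev y G ^ t)"
    using assms fps_conv_radius_power[of "fev y G" t] by (rule less_le_trans)
  show "norm x < fps_conv_radius (fev y (Phi G k))"
    unfolding k fev_Phi using fps_conv_radius_mult[of "fps_X ^ a * fps_const (y ^ b)" "fev y G ^ t"] c p
    by (simp add: less_le_trans)
  show "eval_fps (fev y (Phi G k)) x = x ^ fst k * y ^ fst (snd k) * eval_fps (fev y G) x ^ snd (snd k)"
    unfolding k fev_Phi using assms p c by (simp add: eval_fps_mult eval_fps_power)
qed

definition combo :: "complex poly fps \<Rightarrow> (nat \<times> nat \<times> nat) set \<Rightarrow> (nat \<times> nat \<times> nat \<Rightarrow> complex) \<Rightarrow> complex poly fps" where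
  "combo G A c = (\<Sum>k\<in>A. fps_const [:c k:] * Phi G k)"

lemma eval_combo:
  assumes A: "finite A" and x: "norm x < fps_conv_radius (fev y G)"
  shows "norm x < fps_conv_radius (fev y (combo G A c)) \<and>
    eval_fps (fev y (combo G A c)) x = (\<Sum>k\<in>A. c k * (x ^ fst k * y ^ fst (snd k) * eval_fps (fev y G) x ^ snd (snd k)))"
  using A unfolding combo_def
proof (induction A rule: finite_induct)
  case empty
  show ?case by (simp add: fev_0)
next
  case (insert k A)
  have 1: "norm x < fps_conv_radius (fps_const (c k) * fev y (Phi G k))"
    by (rule less_le_trans[OF _ fps_conv_radius_mult]) (use eval_Phi(1)[OF x] in simp)
  have 2: "eval_fps (fps_const (c k) * fev y (Phi G k)) x = c k * (x ^ fst k * y ^ fst (snd k) * eval_fps (fev y G) x ^ snd (snd k))"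
    using eval_Phi[OF x] by (subst eval_fps_mult) auto
  have 3: "fev y (\<Sum>k\<in>insert k A. fps_const [:c k:] * Phi G k) = fps_const (c k) * fev y (Phi G k) + fev y (\<Sum>k\<in>A. fps_const [:c k:] * Phi G k)"
    using insert.hyps by (simp add: fev_add fev_mult fev_const)
  show ?case unfolding 3
  proof
    show "norm x < fps_conv_radius (fps_const (c k) * fev y (Phi G k) + fev y (\<Sum>k\<in>A. fps_const [:c k:] * Phi G k))"
      by (rule less_le_trans[OF _ fps_conv_radius_add]) (use 1 insert.IH in simp)
    show "eval_fps (fps_const (c k) * fev y (Phi G k) + fev y (\<Sum>k\<in>A. fps_const [:c k:] * Phi G k)) x =
       (\<Sum>k\<in>insert k A. c k * (x ^ fst k * y ^ fst (snd k) * eval_fps (fev y G) x ^ snd (snd k)))"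
      using insert 1 2 by (subst eval_fps_add) auto
  qed
qed

lemma norm_poly_minus_coeff_0:
  fixes P :: "complex poly"
  assumes "degree P \<le> D" "\<And>j. norm (coeff P j) \<le> K" "norm y \<le> 1"
  shows "norm (poly P y - coeff P 0) \<le> real D * K * norm y"
proof -
  have "poly P y = (\<Sum>j\<le>D. coeff P j * y ^ j)"
    using poly_as_sum_of_monoms'[OF assms(1)] by (metis (no_types, lifting) poly_monom poly_sum sum.cong)
  then have split: "poly P y - coeff P 0 = (\<Sum>j<D. coeff P (Suc j) * y ^ Suc j)"
    by (simp only: lessThan_Suc_atMost[symmetric] sum.lessThan_Suc_shift) simp
  have "norm (\<Sum>j<D. coeff P (Suc j) * y ^ Suc j) \<le> (\<Sum>j<D. K * norm y)"
  proof (rule sum_norm_le)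
    fix j
    have "norm y ^ Suc j \<le> norm y ^ 1" using assms(3) by (intro power_decreasing) auto
    then show "norm (coeff P (Suc j) * y ^ Suc j) \<le> K * norm y"
      unfolding norm_mult norm_power using assms(2) order.trans[OF norm_ge_zero assms(2)] by (intro mult_mono) auto
  qed
  then show ?thesis unfolding split by simp
qed

text \<open>The phase is determined modulo 1 by i\<theta>, whose fractional parts are dense by
  Kronecker's theorem, and the bounds on b confine it to [0, 1].\<close>

lemma small_phase_exists:
  fixes \<theta> \<kappa> \<epsilon> :: real
  assumes theta: "\<theta> \<notin> \<rat>" and eps: "0 < \<epsilon>" "\<epsilon> \<le> 1"
    and b: "\<And>i. real i * \<theta> + \<kappa> - 1 \<le> of_int (b i)" "\<And>i. of_int (b i) \<le> real i * \<theta> + \<kappa>"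
  shows "\<exists>i. 0 < of_int (b i) - real i * \<theta> + 1 - \<kappa> \<and> of_int (b i) - real i * \<theta> + 1 - \<kappa> < \<epsilon>"
proof -
  \<comment> \<open>If i\<theta> is close to this value modulo 1, the phase is close to \<epsilon>/2
    modulo 1. The integer ambiguity \<open>d\<close> vanishes because it is smaller than 1 in
    modulus.\<close>
  define a where "a = frac (1 - \<kappa> - \<epsilon> / 2)"
  have a: "0 \<le> a" "a \<le> 1" unfolding a_def using frac_lt_1[of "1 - \<kappa> - \<epsilon> / 2"] by auto
  obtain i where i: "\<bar>frac (real i * \<theta>) - a\<bar> < \<epsilon> / 4"
    using Kronecker_approx_1_explicit[OF theta a, of "\<epsilon> / 4"] eps by auto
  define z where "z = \<epsilon> / 2 + a - frac (real i * \<theta>)"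
  define d where "d = of_int (b i) - real i * \<theta> + 1 - \<kappa> - z"
  have z: "\<epsilon> / 4 < z" "z < 3 / 4 * \<epsilon>" using i unfolding z_def by linarith+
  define n where "n = b i - \<lfloor>real i * \<theta>\<rfloor> + \<lfloor>1 - \<kappa> - \<epsilon> / 2\<rfloor>"
  have "d = of_int n"
    by (simp add: d_def z_def a_def frac_def n_def)
  moreover have "\<bar>d\<bar> < 1" using b[of i] z eps unfolding d_def by linarith
  ultimately have "\<bar>real_of_int n\<bar> < 1" by simp
  then have "n = 0" by linarith
  then have "d = 0" using \<open>d = of_int n\<close> by simp
  then show ?thesis using z eps by (intro exI[of _ i]) (auto simp: d_def)
qed

text \<open>Terms of phase 0 form the limit h; the constant coefficients with positive phase form T,
  which tends to 0 by Tannery's theorem; the other coefficients contribute O(y). All terms of T have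
  nonnegative real part, so one term of phase \<eta> already bounds |T| below by a multiple of
  y^\<eta>.\<close>

lemma phase_series_asymptotics:
  fixes \<theta> \<kappa> u K c :: real and b :: "nat \<Rightarrow> nat" and w :: "nat \<Rightarrow> complex poly"
  defines "ph \<equiv> \<lambda>i. real (b i) - real i * \<theta> + 1 - \<kappa>"
  defines "H \<equiv> \<lambda>y. (\<Sum>i. of_real (u ^ i * y powr ph i) * poly (w i) (of_real y))"
  assumes theta: "\<theta> \<notin> \<rat>" and u: "0 < u" "u < 1"
    and b: "\<And>i. real i * \<theta> + \<kappa> - 1 \<le> real (b i)" "\<And>i. real (b i) \<le> real i * \<theta> + \<kappa>"
    and w: "\<And>i. degree (w i) \<le> D" "\<And>i j. norm (coeff (w i) j) \<le> K * (real i + 1) ^ e"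
    and c: "0 < c" "\<And>i. c \<le> Re (coeff (w i) 0)"
  obtains h where "(H \<longlongrightarrow> h) (at_right 0)"
    "\<And>\<epsilon>. 0 < \<epsilon> \<Longrightarrow> \<exists>c0>0. \<exists>\<eta><\<epsilon>. \<forall>\<^sub>F y in at_right 0. c0 * y powr \<eta> \<le> norm (H y - h)"
proof -
  have ph: "0 \<le> ph i" "ph i \<le> 1" for i using b[of i] by (auto simp: ph_def)
  define v where "v i = coeff (w i) 0" for i
  have K: "0 \<le> K" using order.trans[OF norm_ge_zero w(2)[of 0 0]] by simp
  define h where "h = (\<Sum>i. if ph i = 0 then of_real (u ^ i) * v i else 0)"
  define T where "T y i = (if ph i = 0 then 0 else of_real (u ^ i * y powr ph i) * v i)" for y i
  define M where "M i = K * ((real i + 1) ^ e * u ^ i)" for i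
  have sM: "summable M" unfolding M_def using u by (intro summable_mult summable_poly_power) auto
  have M0: "0 \<le> M i" for i using K u by (simp add: M_def)
  have pw: "y powr ph i \<le> 1" if "0 < y" "y < 1" for y i
    using that by (intro powr_le1 ph) auto
  have vM: "u ^ i * norm (v i) \<le> M i" for i
    using mult_left_mono[OF w(2)[of i 0], of "u ^ i"] u by (simp add: v_def M_def mult_ac)
  have TM: "norm (T y i) \<le> M i" if "0 < y" "y < 1" for y i
  proof -
    have "(u ^ i * norm (v i)) * y powr ph i \<le> M i * 1"
      using pw[OF that] vM M0 u by (intro mult_mono) auto
    then show ?thesis using u M0 by (auto simp: T_def norm_mult norm_power mult_ac)
  qed
  have sT: "summable (T y)" if "0 < y" "y < 1" for y
    by (rule summable_comparison_test[OF _ sM]) (use TM[OF that] in auto)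
  have sh: "summable (\<lambda>i. if ph i = 0 then of_real (u ^ i) * v i else 0)"
    by (rule summable_comparison_test[OF _ sM]) (use vM M0 u in \<open>auto simp: norm_mult norm_power\<close>)
  have tail: "norm (H y - h - suminf (T y)) \<le> real D * suminf M * y" if y: "0 < y" "y < 1" for y
  proof -
    define A where "A i = of_real (u ^ i * y powr ph i) * (poly (w i) (of_real y) - v i)" for i
    have Ab: "norm (A i) \<le> real D * M i * y" for i
    proof -
      have "norm (poly (w i) (of_real y) - v i) \<le> real D * (K * (real i + 1) ^ e) * norm (of_real y :: complex)"
        unfolding v_def using w y by (intro norm_poly_minus_coeff_0) auto
      then have "(u ^ i * y powr ph i) * norm (poly (w i) (of_real y) - v i) \<le> (u ^ i * 1) * (real D * (K * (real i + 1) ^ e) * y)"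
        using pw[OF y] u y by (intro mult_mono) auto
      then show ?thesis using u by (simp add: A_def norm_mult norm_power M_def mult_ac)
    qed
    have sB: "summable (\<lambda>i. real D * M i * y)" by (intro summable_mult2 summable_mult sM)
    have sA': "summable (\<lambda>i. norm (A i))" by (rule summable_comparison_test[OF _ sB]) (use Ab in auto)
    then have sA: "summable A" by (rule summable_norm_cancel)
    have "of_real (u ^ i * y powr ph i) * poly (w i) (of_real y) =
        A i + ((if ph i = 0 then of_real (u ^ i) * v i else 0) + T y i)" for i
      using y by (auto simp: A_def T_def algebra_simps)
    then have "H y = suminf A + (h + suminf (T y))"
      unfolding H_def h_def using sA sh sT[OF y] by (simp add: suminf_add summable_add)
    then have "norm (H y - h - suminf (T y)) = norm (suminf A)" by simp
    also have "\<dots> \<le> (\<Sum>i. norm (A i))" by (rule summable_norm[OF sA'])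
    also have "\<dots> \<le> (\<Sum>i. real D * M i * y)" by (intro suminf_le Ab sA' sB)
    also have "\<dots> = real D * suminf M * y"
      using sM by (simp add: suminf_mult suminf_mult2[symmetric] summable_mult)
    finally show ?thesis .
  qed
  have ev01: "\<forall>\<^sub>F y in at_right (0::real). 0 < y \<and> y < 1"
    using eventually_at_right_less[of "0::real"] eventually_at_right_real[of 0 1] by (auto elim: eventually_elim2)
  have limT: "((\<lambda>y. suminf (T y)) \<longlongrightarrow> suminf (\<lambda>_. 0)) (at_right 0)"
  proof (rule tannerys_theorem[THEN conjunct2, THEN conjunct2])
    show "((\<lambda>y. T y i) \<longlongrightarrow> 0) (at_right 0)" for i
    proof (cases "ph i = 0")
      case False
      then have "0 < ph i" using ph[of i] by simp
      then have "((\<lambda>y. y powr ph i) \<longlongrightarrow> 0) (at_right 0)" by real_asymp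
      then have "((\<lambda>y. of_real (u ^ i * y powr ph i) * v i) \<longlongrightarrow> of_real (u ^ i * 0) * v i) (at_right 0)"
        by (intro tendsto_intros)
      then show ?thesis using False by (simp add: T_def)
    qed (simp add: T_def)
    show "\<forall>\<^sub>F (i, y) in at_top \<times>\<^sub>F at_right 0. norm (T y i) \<le> M i"
      unfolding eventually_prod_filter
      by (intro exI[of _ "\<lambda>_. True"] exI[of _ "\<lambda>y. 0 < y \<and> y < 1"]) (use ev01 TM in auto)
  qed (use sM in auto)
  have null: "((\<lambda>y. real D * suminf M * y) \<longlongrightarrow> 0) (at_right 0)"
    by (intro tendsto_mult_right_zero tendsto_ident_at)
  have "\<forall>\<^sub>F y in at_right 0. norm (H y - h - suminf (T y)) \<le> real D * suminf M * y"
    using ev01 by (rule eventually_mono) (use tail in blast)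
  then have tail0: "((\<lambda>y. H y - h - suminf (T y)) \<longlongrightarrow> 0) (at_right 0)"
    using null by (rule Lim_null_comparison)
  have "((\<lambda>y. (H y - h - suminf (T y)) + suminf (T y) + h) \<longlongrightarrow> 0 + 0 + h) (at_right 0)"
    using limT by (intro tendsto_add tail0 tendsto_const) simp
  then have lim: "(H \<longlongrightarrow> h) (at_right 0)" by simp
  show thesis
  proof (rule that[OF lim])
    fix \<epsilon> :: real assume eps: "0 < \<epsilon>"
    \<comment> \<open>A phase below 1/2, in particular below 1, makes the O(y) error negligible
      against y^phase.\<close>
    have "\<exists>i. 0 < of_int (int (b i)) - real i * \<theta> + 1 - \<kappa> \<and> of_int (int (b i)) - real i * \<theta> + 1 - \<kappa> < min \<epsilon> (1/2)"
      by (rule small_phase_exists) (use theta eps b in auto)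
    then obtain i where i: "0 < ph i" "ph i < min \<epsilon> (1/2)"
      unfolding ph_def of_int_of_nat_eq by blast
    define c0 where "c0 = c * u ^ i / 2"
    have c0: "c0 > 0" using c u by (simp add: c0_def)
    have "((\<lambda>y. real D * suminf M * y powr (1 - ph i)) \<longlongrightarrow> real D * suminf M * 0) (at_right 0)"
    proof (intro tendsto_mult_left)
      have "0 < 1 - ph i" using i by simp
      then show "((\<lambda>y. y powr (1 - ph i)) \<longlongrightarrow> 0) (at_right 0)" by real_asymp
    qed
    then have "\<forall>\<^sub>F y in at_right 0. real D * suminf M * y powr (1 - ph i) < c0"
      using c0 by (intro order_tendstoD) auto
    then have "\<forall>\<^sub>F y in at_right 0. c0 * y powr ph i \<le> norm (H y - h)"
      using ev01
    proof eventually_elim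
      case (elim y)
      then have y: "0 < y" "y < 1" by auto
      have "y = y powr (1 - ph i) * y powr ph i" using y by (simp flip: powr_add)
      then have "real D * suminf M * y = (real D * suminf M * y powr (1 - ph i)) * y powr ph i" by simp
      also have "\<dots> \<le> c0 * y powr ph i" using elim by (intro mult_right_mono) auto
      finally have small: "real D * suminf M * y \<le> c0 * y powr ph i" .
      have nonneg: "0 \<le> Re (T y j)" for j
        using c(1) c(2)[of j] u y by (auto simp: T_def v_def intro!: mult_nonneg_nonneg)
      have "2 * c0 * y powr ph i = (u ^ i * y powr ph i) * c" by (simp add: c0_def)
      also have "\<dots> \<le> (u ^ i * y powr ph i) * Re (v i)" unfolding v_def using c u by (intro mult_left_mono) auto
      also have "\<dots> = Re (T y i)" using i by (simp add: T_def)
      also have "\<dots> \<le> (\<Sum>j. Re (T y j))"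
        using sum_le_suminf[OF summable_Re[OF sT[OF y]], of "{i}"] nonneg by simp
      also have "\<dots> = Re (suminf (T y))" by (rule Re_suminf[OF sT[OF y], symmetric])
      also have "\<dots> \<le> norm (suminf (T y))" by (rule complex_Re_le_cmod)
      also have "\<dots> \<le> norm (H y - h) + norm (H y - h - suminf (T y))"
        using norm_triangle_ineq4[of "H y - h" "H y - h - suminf (T y)"] by simp
      also have "\<dots> \<le> norm (H y - h) + c0 * y powr ph i" using tail[OF y] small by linarith
      finally show ?case by linarith
    qed
    then show "\<exists>c0>0. \<exists>\<eta><\<epsilon>. \<forall>\<^sub>F y in at_right 0. c0 * y powr \<eta> \<le> norm (H y - h)"
      using c0 i by (intro exI[of _ c0] conjI exI[of _ "ph i"]) auto
  qed
qed

text \<open>Splitting off the root h with its multiplicity m gives |q(H)| >= const * |H - h|^m. A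
  slow exponent \<eta> with m\<eta> < d then contradicts the bound by y^d; the choice of \<epsilon>
  with m + 1 in place of m covers m = 0.\<close>

lemma poly_limit_obstruction:
  fixes H :: "real \<Rightarrow> complex" and q :: "complex poly"
  assumes lim: "(H \<longlongrightarrow> h) (at_right 0)"
    and slow: "\<And>\<epsilon>. 0 < \<epsilon> \<Longrightarrow> \<exists>c0>0. \<exists>\<eta><\<epsilon>. \<forall>\<^sub>F y in at_right 0. c0 * y powr \<eta> \<le> norm (H y - h)"
    and q: "q \<noteq> 0" and d: "0 < d"
    and small: "\<forall>\<^sub>F y in at_right 0. norm (poly q (H y)) \<le> C * y powr d"
  shows False
proof -
  define m where "m = order h q"
  obtain q1 where q1: "q = [:- h, 1:] ^ m * q1" "\<not> [:- h, 1:] dvd q1"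
    using order_decomp[OF q, of h] unfolding m_def by blast
  have nz: "poly q1 h \<noteq> 0" using q1(2) by (simp add: poly_eq_0_iff_dvd)
  have "((\<lambda>y. norm (poly q1 (H y))) \<longlongrightarrow> norm (poly q1 h)) (at_right 0)"
    using lim by (intro tendsto_norm tendsto_poly)
  then have ev1: "\<forall>\<^sub>F y in at_right 0. norm (poly q1 h) / 2 < norm (poly q1 (H y))"
    using nz by (intro order_tendstoD) auto
  define \<epsilon> where "\<epsilon> = d / (2 * (real m + 1))"
  have "\<epsilon> > 0" using d by (simp add: \<epsilon>_def)
  from slow[OF this] obtain c0 \<eta> where c0: "c0 > 0" "\<eta> < \<epsilon>"
    and ev2: "\<forall>\<^sub>F y in at_right 0. c0 * y powr \<eta> \<le> norm (H y - h)" by blast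
  have "\<eta> * real m \<le> \<epsilon> * real m" using c0 by (intro mult_right_mono) auto
  also have "\<dots> < d" unfolding \<epsilon>_def using d by (simp add: divide_less_eq algebra_simps add_nonneg_pos)
  finally have ex: "0 < d - \<eta> * real m" by simp
  define A where "A = c0 ^ m * norm (poly q1 h) / 2"
  have A: "A > 0" using c0 nz by (simp add: A_def)
  have ev3: "\<forall>\<^sub>F y in at_right (0::real). 0 < y" by (rule eventually_at_right_less)
  have "((\<lambda>y. y powr (d - \<eta> * real m)) \<longlongrightarrow> 0) (at_right 0)" using ex by real_asymp
  then have "((\<lambda>y. C * y powr (d - \<eta> * real m)) \<longlongrightarrow> 0) (at_right 0)"
    by (rule tendsto_mult_right_zero)
  then have "\<forall>\<^sub>F y in at_right 0. C * y powr (d - \<eta> * real m) < A" using A by (rule order_tendstoD)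
  with ev1 ev2 ev3 small have "\<forall>\<^sub>F y in at_right (0::real). False"
  proof eventually_elim
    case (elim y)
    have "norm (poly q (H y)) = norm (H y - h) ^ m * norm (poly q1 (H y))"
      by (simp add: q1(1) norm_mult norm_power)
    moreover have "(c0 * y powr \<eta>) ^ m * (norm (poly q1 h) / 2) \<le> norm (H y - h) ^ m * norm (poly q1 (H y))"
      using elim c0 by (intro mult_mono power_mono) auto
    moreover have "(c0 * y powr \<eta>) ^ m * (norm (poly q1 h) / 2) = A * y powr (\<eta> * real m)"
      using elim by (simp add: A_def power_mult_distrib powr_power mult.commute[of _ \<eta>])
    moreover have "C * y powr d = (C * y powr (d - \<eta> * real m)) * y powr (\<eta> * real m)"
      using elim by (simp flip: powr_add)
    moreover have "(C * y powr (d - \<eta> * real m)) * y powr (\<eta> * real m) < A * y powr (\<eta> * real m)"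
      using elim by (intro mult_strict_right_mono) auto
    ultimately show ?case using elim by linarith
  qed
  then show False by (simp add: eventually_False trivial_limit_at_right_real)
qed

text \<open>
  Substitute \<open>X = u Y^(-\<theta>)\<close> and let \<open>Y\<close> tend to \<open>0\<close> from above. Then \<open>H = Y^(1 - \<kappa>) G\<close> has a limit, but the
  phases \<open>b i - i \<theta> + 1 - \<kappa>\<close> are arbitrarily small and positive, so \<open>H\<close> approaches it more slowly than any
  power of \<open>Y\<close>. Monomials \<open>X^a Y^b G^t\<close> with the same \<open>t\<close> have distinct orders in \<open>Y\<close>, so the lowest-order
  terms of a relation form a nonzero polynomial in \<open>H\<close> that is as small as a power of \<open>Y\<close>.
\<close>
theorem sturmian_series_transcendental:
  fixes \<theta> \<kappa> K c :: real and b :: "nat \<Rightarrow> nat" and w :: "nat \<Rightarrow> complex poly"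
  assumes theta: "\<theta> \<notin> \<rat>"
    and b: "\<And>i. real i * \<theta> + \<kappa> - 1 \<le> real (b i)" "\<And>i. real (b i) \<le> real i * \<theta> + \<kappa>"
    and w: "\<And>i. degree (w i) \<le> D" "\<And>i j. norm (coeff (w i) j) \<le> K * (real i + 1) ^ e"
    and c: "0 < c" "\<And>i. c \<le> Re (coeff (w i) 0)"
    and A: "finite A" and k: "k0 \<in> A" "p k0 \<noteq> 0"
  shows "combo (Abs_fps (\<lambda>i. monom 1 (b i) * w i)) A p \<noteq> 0"
proof
  define G where "G = Abs_fps (\<lambda>i. monom 1 (b i) * w i)"
  assume "combo (Abs_fps (\<lambda>i. monom 1 (b i) * w i)) A p = 0"
  then have zero: "combo G A p = 0" by (simp add: G_def)
  define u where "u = (1 / 2 :: real)"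
  have u: "0 < u" "u < 1" by (auto simp: u_def)
  define ph where "ph i = real (b i) - real i * \<theta> + 1 - \<kappa>" for i
  define H where "H y = (\<Sum>i. of_real (u ^ i * y powr ph i) * poly (w i) (of_real y))" for y
  have K: "0 \<le> K" using order.trans[OF norm_ge_zero w(2)[of 0 0]] by simp
  have ph: "0 \<le> ph i" "ph i \<le> 1" for i using b[of i] by (auto simp: ph_def)
  obtain h where h: "(H \<longlongrightarrow> h) (at_right 0)"
    "\<And>\<epsilon>. 0 < \<epsilon> \<Longrightarrow> \<exists>c0>0. \<exists>\<eta><\<epsilon>. \<forall>\<^sub>F y in at_right 0. c0 * y powr \<eta> \<le> norm (H y - h)"
    unfolding H_def[abs_def] ph_def by (fact phase_series_asymptotics[OF theta u b w c])
  have val_eq: "eval_fps (fev (of_real y) G) (of_real (u * y powr (- \<theta>))) = of_real (y powr (\<kappa> - 1)) * H y"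
    and radius: "norm (of_real (u * y powr (- \<theta>)) :: complex) < fps_conv_radius (fev (of_real y) G)" if y: "0 < y" "y < 1" for y
  proof -
    have nth: "fps_nth (fev (of_real y) G) i * of_real (v * y powr (- \<theta>)) ^ i =
        of_real (y powr (\<kappa> - 1)) * (of_real (v ^ i * y powr ph i) * poly (w i) (of_real y))" for i v
    proof -
      have "y ^ b i * (y powr (- \<theta>)) ^ i = y powr (\<kappa> - 1) * y powr ph i"
      proof -
        have e: "y ^ b i = y powr real (b i)" "(y powr (- \<theta>)) ^ i = y powr (real i * (- \<theta>))"
          using y by (simp add: powr_realpow, simp add: powr_power)
        show ?thesis unfolding e powr_add[symmetric] ph_def by (simp add: algebra_simps)
      qed
      then have "complex_of_real (y ^ b i * (y powr (- \<theta>)) ^ i) = complex_of_real (y powr (\<kappa> - 1) * y powr ph i)" by simp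
      then show ?thesis by (simp add: G_def poly_monom power_mult_distrib mult_ac)
    qed
    have wb: "norm (poly (w i) (of_real y)) \<le> (real D + 1) * (K * (real i + 1) ^ e)" for i
    proof -
      have "norm (poly (w i) (of_real y) - coeff (w i) 0) \<le> real D * (K * (real i + 1) ^ e) * norm (of_real y :: complex)"
        using w y by (intro norm_poly_minus_coeff_0) auto
      also have "\<dots> \<le> real D * (K * (real i + 1) ^ e) * 1" using K y by (intro mult_left_mono) auto
      finally have "norm (poly (w i) (of_real y) - coeff (w i) 0) \<le> real D * (K * (real i + 1) ^ e)" by simp
      moreover have "norm (coeff (w i) 0) \<le> K * (real i + 1) ^ e" by (rule w)
      ultimately show ?thesis
        using norm_triangle_ineq[of "poly (w i) (of_real y) - coeff (w i) 0" "coeff (w i) 0"] by (simp add: algebra_simps)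
    qed
    have sm: "summable (\<lambda>i. of_real (v ^ i * y powr ph i) * poly (w i) (of_real y))" if v: "0 < v" "v < 1" for v
    proof (rule summable_comparison_test)
      show "summable (\<lambda>i. (real D + 1) * K * ((real i + 1) ^ e * v ^ i))"
        using v by (intro summable_mult summable_poly_power) auto
      have "norm (of_real (v ^ i * y powr ph i) * poly (w i) (of_real y)) \<le> (real D + 1) * K * ((real i + 1) ^ e * v ^ i)" for i
      proof -
        have "y powr ph i \<le> 1" using y by (intro powr_le1 ph) auto
        then have "(v ^ i * y powr ph i) * norm (poly (w i) (of_real y)) \<le> (v ^ i * 1) * ((real D + 1) * (K * (real i + 1) ^ e))"
          using v wb[of i] by (intro mult_mono) auto
        then show ?thesis using v by (simp add: norm_mult norm_power mult_ac)
      qed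
      then show "\<exists>N. \<forall>i\<ge>N. norm (of_real (v ^ i * y powr ph i) * poly (w i) (of_real y)) \<le> (real D + 1) * K * ((real i + 1) ^ e * v ^ i)"
        by blast
    qed
    show "eval_fps (fev (of_real y) G) (of_real (u * y powr (- \<theta>))) = of_real (y powr (\<kappa> - 1)) * H y"
      unfolding eval_fps_def nth H_def by (intro suminf_mult sm) (auto simp: u_def)
    \<comment> \<open>Convergence at 3/4 in place of u = 1/2 puts the point strictly inside the disc
      of convergence.\<close>
    have "summable (\<lambda>i. fps_nth (fev (of_real y) G) i * of_real (3 / 4 * y powr (- \<theta>)) ^ i)"
      unfolding nth by (intro summable_mult sm) auto
    then have "norm (of_real (3 / 4 * y powr (- \<theta>)) :: complex) \<le> fps_conv_radius (fev (of_real y) G)"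
      unfolding fps_conv_radius_def by (rule conv_radius_geI)
    moreover have "norm (of_real (u * y powr (- \<theta>)) :: complex) < norm (of_real (3 / 4 * y powr (- \<theta>)) :: complex)"
      using y by (simp add: u_def norm_mult)
    ultimately show "norm (of_real (u * y powr (- \<theta>)) :: complex) < fps_conv_radius (fev (of_real y) G)"
      by (meson ereal_less_le less_le_trans less_ereal.simps(1))
  qed
  \<comment> \<open>Exponent of y in X^a Y^b G^t after the substitution; the last summand comes from
    G = y^(\<kappa> - 1) H.\<close>
  define ex where "ex k = real (fst (snd k)) - real (fst k) * \<theta> + (\<kappa> - 1) * real (snd (snd k))" for k :: "nat \<times> nat \<times> nat"
  have rel: "(\<Sum>k\<in>A. p k * of_real (u ^ fst k * y powr ex k) * H y ^ snd (snd k)) = 0" if y: "0 < y" "y < 1" for y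
  proof -
    have "0 = (\<Sum>k\<in>A. p k * (of_real (u * y powr (- \<theta>)) ^ fst k * of_real y ^ fst (snd k) * (of_real (y powr (\<kappa> - 1)) * H y) ^ snd (snd k)))"
      using eval_combo[OF A radius[OF y], of p] unfolding zero fev_0 val_eq[OF y] eval_fps_0 by simp
    also have "\<dots> = (\<Sum>k\<in>A. p k * of_real (u ^ fst k * y powr ex k) * H y ^ snd (snd k))"
    proof (rule sum.cong[OF refl])
      fix k
      have "(y powr (- \<theta>)) ^ fst k * y ^ fst (snd k) * (y powr (\<kappa> - 1)) ^ snd (snd k) = y powr ex k"
      proof -
        have e: "y ^ fst (snd k) = y powr real (fst (snd k))" "(y powr (- \<theta>)) ^ fst k = y powr (real (fst k) * (- \<theta>))"
          "(y powr (\<kappa> - 1)) ^ snd (snd k) = y powr (real (snd (snd k)) * (\<kappa> - 1))"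
          using y by (simp add: powr_realpow, simp add: powr_power, simp add: powr_power)
        show ?thesis unfolding e powr_add[symmetric] ex_def by (simp add: algebra_simps)
      qed
      then have "complex_of_real ((y powr (- \<theta>)) ^ fst k * y ^ fst (snd k) * (y powr (\<kappa> - 1)) ^ snd (snd k)) = of_real (y powr ex k)" by simp
      then show "p k * (of_real (u * y powr (- \<theta>)) ^ fst k * of_real y ^ fst (snd k) * (of_real (y powr (\<kappa> - 1)) * H y) ^ snd (snd k))
          = p k * of_real (u ^ fst k * y powr ex k) * H y ^ snd (snd k)"
        by (simp add: power_mult_distrib mult_ac)
    qed
    finally show ?thesis by simp
  qed
  define S where "S = {k\<in>A. p k \<noteq> 0}"
  have "k0 \<in> S" using k by (simp add: S_def)
  then have S: "finite S" "S \<noteq> {}" using A by (simp add: S_def, blast)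
  define lam where "lam = Min (ex ` S)"
  define S0 where "S0 = {k\<in>S. ex k = lam}"
  have lam_le: "lam \<le> ex k" if "k \<in> S" for k using S that by (simp add: lam_def)
  have "lam \<in> ex ` S" unfolding lam_def using S by (intro Min_in) auto
  then obtain k1 where k1: "k1 \<in> S0" by (auto simp: S0_def)
  \<comment> \<open>Gap between the lowest exponent and the next one; the 1 is a default for the
    case that all exponents are lowest.\<close>
  define d where "d = Min (insert 1 ((\<lambda>k. ex k - lam) ` (S - S0)))"
  have d: "0 < d" "\<And>k. k \<in> S - S0 \<Longrightarrow> d \<le> ex k - lam"
  proof -
    have "0 < z" if "z \<in> insert 1 ((\<lambda>k. ex k - lam) ` (S - S0))" for z
      using that lam_le by (fastforce simp: S0_def)
    then show "0 < d" unfolding d_def using S by (intro Min_gr_iff[THEN iffD2]) auto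
    show "d \<le> ex k - lam" if "k \<in> S - S0" for k unfolding d_def using S that by (intro Min_le) auto
  qed
  define q where "q = (\<Sum>k\<in>S0. monom (p k * of_real (u ^ fst k)) (snd (snd k)))"
  have fin0: "finite S0" using S by (simp add: S0_def)
  \<comment> \<open>Equal exponents and equal t leave b - a\<theta> = b' - a'\<theta>, so
    irrationality gives a = a' and b = b'. Hence no two lowest terms merge in a coefficient of
    \<open>q\<close>, and \<open>q\<close> is nonzero.\<close>
  have inj: "k = k'" if "k \<in> S0" "k' \<in> S0" "snd (snd k) = snd (snd k')" for k k'
  proof -
    have "real (fst (snd k)) - real (fst k) * \<theta> = real (fst (snd k')) - real (fst k') * \<theta>"
      using that by (simp add: S0_def ex_def)
    then have e: "of_int (int (fst k) - int (fst k')) * \<theta> = of_int (int (fst (snd k)) - int (fst (snd k')))"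
      by (simp add: algebra_simps)
    then have "int (fst k) - int (fst k') = 0" using irrational_multiple_ne[OF theta] by blast
    moreover from this e have "int (fst (snd k)) - int (fst (snd k')) = 0" by (simp only: of_int_0 mult_zero_left)
    ultimately show ?thesis using that(3) by (auto intro!: prod_eqI)
  qed
  have "coeff q (snd (snd k1)) = (\<Sum>k\<in>S0. if k = k1 then p k * of_real (u ^ fst k) else 0)"
    unfolding q_def coeff_sum using inj[OF _ k1] by (intro sum.cong) auto
  also have "\<dots> = p k1 * of_real (u ^ fst k1)" using k1 fin0 by simp
  finally have "coeff q (snd (snd k1)) \<noteq> 0" using k1 by (simp add: S0_def S_def u_def)
  then have q0: "q \<noteq> 0" by auto
  define B where "B = norm h + 1"
  define C where "C = (\<Sum>k\<in>S. norm (p k) * B ^ snd (snd k))"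
  have "((\<lambda>y. norm (H y)) \<longlongrightarrow> norm h) (at_right 0)" using h(1) by (rule tendsto_norm)
  then have evB: "\<forall>\<^sub>F y in at_right 0. norm (H y) < B" by (intro order_tendstoD) (auto simp: B_def)
  have ev01: "\<forall>\<^sub>F y in at_right (0::real). 0 < y \<and> y < 1"
    using eventually_at_right_less[of "0::real"] eventually_at_right_real[of 0 1] by (auto elim: eventually_elim2)
  have "\<forall>\<^sub>F y in at_right 0. norm (poly q (H y)) \<le> C * y powr d"
    using evB ev01
  proof eventually_elim
    case (elim y)
    then have y: "0 < y" "y < 1" by auto
    let ?g = "\<lambda>k. p k * of_real (u ^ fst k * y powr (ex k - lam)) * H y ^ snd (snd k)"
    have "0 = of_real (y powr (- lam)) * (\<Sum>k\<in>A. p k * of_real (u ^ fst k * y powr ex k) * H y ^ snd (snd k))"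
      using rel[OF y] by simp
    also have "\<dots> = (\<Sum>k\<in>A. ?g k)" unfolding sum_distrib_left
    proof (rule sum.cong[OF refl])
      fix k
      have "y powr (ex k - lam) = y powr (- lam) * y powr ex k" using y by (simp flip: powr_add)
      then show "of_real (y powr (- lam)) * (p k * of_real (u ^ fst k * y powr ex k) * H y ^ snd (snd k)) = ?g k" by (simp add: mult_ac)
    qed
    also have "\<dots> = (\<Sum>k\<in>S. ?g k)" unfolding S_def using A by (intro sum.mono_neutral_right) auto
    also have "\<dots> = (\<Sum>k\<in>S - S0. ?g k) + (\<Sum>k\<in>S0. ?g k)" using S by (intro sum.subset_diff) (auto simp: S0_def)
    also have "(\<Sum>k\<in>S0. ?g k) = poly q (H y)"
      unfolding q_def poly_sum using y by (intro sum.cong) (auto simp: S0_def poly_monom)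
    finally have "poly q (H y) = - (\<Sum>k\<in>S - S0. ?g k)" by (simp add: eq_neg_iff_add_eq_0 add.commute)
    then have "norm (poly q (H y)) = norm (\<Sum>k\<in>S - S0. ?g k)" by simp
    also have "\<dots> \<le> (\<Sum>k\<in>S - S0. norm (p k) * B ^ snd (snd k) * y powr d)"
    proof (rule sum_norm_le)
      fix k assume k: "k \<in> S - S0"
      have "y powr (ex k - lam) \<le> y powr d" using d(2)[OF k] y by (intro powr_mono') auto
      moreover have "u ^ fst k \<le> 1" unfolding u_def by (intro power_le_one) auto
      ultimately have "u ^ fst k * y powr (ex k - lam) \<le> 1 * y powr d" by (intro mult_mono) (auto simp: u_def)
      moreover have "norm (H y) ^ snd (snd k) \<le> B ^ snd (snd k)" using elim by (intro power_mono) auto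
      ultimately have "(norm (p k) * (u ^ fst k * y powr (ex k - lam))) * norm (H y) ^ snd (snd k) \<le> (norm (p k) * y powr d) * B ^ snd (snd k)"
        by (intro mult_mono mult_left_mono) (auto simp: u_def)
      then show "norm (?g k) \<le> norm (p k) * B ^ snd (snd k) * y powr d"
        by (simp add: norm_mult norm_power u_def mult_ac)
    qed
    also have "\<dots> \<le> (\<Sum>k\<in>S. norm (p k) * B ^ snd (snd k) * y powr d)"
      using S by (intro sum_mono2) (auto simp: B_def)
    also have "\<dots> = C * y powr d" by (simp add: C_def sum_distrib_right)
    finally show ?case .
  qed
  then show False using poly_limit_obstruction[OF h q0 d(1)] by blast
qed

section \<open>Uniform non-vanishing\<close>

text \<open>The slope B bounds the growth of the Sturmian exponents in Y, and m allows for the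
  degree of the weights. Products keep B and add the m's.\<close>

definition bdf :: "real \<Rightarrow> nat \<Rightarrow> nat \<Rightarrow> nat \<Rightarrow> complex poly fps \<Rightarrow> bool" where
  "bdf K e B m F \<longleftrightarrow> (\<forall>i j. norm (coeff (fps_nth F i) j) \<le> K * (real i + 1) ^ e \<and>
     (B * i + m < j \<longrightarrow> coeff (fps_nth F i) j = 0))"

lemma bdf_nonneg: "bdf K e B m F \<Longrightarrow> 0 \<le> K"
proof -
  assume "bdf K e B m F"
  then have "norm (coeff (fps_nth F 0) 0) \<le> K * (real 0 + 1) ^ e" unfolding bdf_def by blast
  then have "norm (coeff (fps_nth F 0) 0) \<le> K" by simp
  then show "0 \<le> K" by (rule order.trans[OF norm_ge_zero])
qed

lemma coeff_fps_mult:
  "coeff (fps_nth (F * G) i) j = (\<Sum>l\<le>i. \<Sum>h\<le>j. coeff (fps_nth F l) h * coeff (fps_nth G (i - l)) (j - h))"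
  by (simp add: fps_mult_nth coeff_sum coeff_mult atLeast0AtMost)

lemma bdf_mult:
  assumes F: "bdf K e B m F" and G: "bdf K' e' B m' G"
  shows "bdf (K * K' * real (B + m + m' + 1)) (e + e' + 2) B (m + m') (F * G)"
  unfolding bdf_def
proof (intro allI conjI impI)
  fix i j
  have K: "0 \<le> K" "0 \<le> K'" using bdf_nonneg[OF F] bdf_nonneg[OF G] by auto
  show zero: "coeff (fps_nth (F * G) i) j = 0" if j: "B * i + (m + m') < j" for j
    unfolding coeff_fps_mult
  proof (intro sum.neutral ballI)
    fix l h assume l: "l \<in> {..i}" and h: "h \<in> {..j}"
    have "B * l + B * (i - l) = B * i" using l by (metis atMost_iff distrib_left le_add_diff_inverse)
    then have "B * l + m < h \<or> B * (i - l) + m' < j - h" using j h by auto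
    then show "coeff (fps_nth F l) h * coeff (fps_nth G (i - l)) (j - h) = 0"
      using F G unfolding bdf_def by auto
  qed
  show "norm (coeff (fps_nth (F * G) i) j) \<le> K * K' * real (B + m + m' + 1) * (real i + 1) ^ (e + e' + 2)"
  proof (cases "B * i + (m + m') < j")
    case True
    then show ?thesis using zero K by simp
  next
    case False
    have t: "norm (coeff (fps_nth F l) h * coeff (fps_nth G (i - l)) h') \<le> K * K' * (real i + 1) ^ (e + e')" if "l \<in> {..i}" for l h h'
    proof -
      have "norm (coeff (fps_nth F l) h) \<le> K * (real l + 1) ^ e" using F by (simp add: bdf_def)
      also have "\<dots> \<le> K * (real i + 1) ^ e" using that K by (intro mult_left_mono power_mono) auto
      finally have 1: "norm (coeff (fps_nth F l) h) \<le> K * (real i + 1) ^ e" .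
      have "norm (coeff (fps_nth G (i - l)) h') \<le> K' * (real (i - l) + 1) ^ e'" using G by (simp add: bdf_def)
      also have "\<dots> \<le> K' * (real i + 1) ^ e'" using that K by (intro mult_left_mono power_mono) auto
      finally have 2: "norm (coeff (fps_nth G (i - l)) h') \<le> K' * (real i + 1) ^ e'" .
      have "norm (coeff (fps_nth F l) h) * norm (coeff (fps_nth G (i - l)) h') \<le> (K * (real i + 1) ^ e) * (K' * (real i + 1) ^ e')"
        using 1 2 K by (intro mult_mono) auto
      then show ?thesis by (simp add: norm_mult power_add mult_ac)
    qed
    have "norm (coeff (fps_nth (F * G) i) j) \<le> (\<Sum>l\<le>i. \<Sum>h\<le>j. K * K' * (real i + 1) ^ (e + e'))"
      unfolding coeff_fps_mult by (intro sum_norm_le t)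
    also have "\<dots> = K * K' * (real i + 1) ^ (e + e') * ((real i + 1) * (real j + 1))"
      by (simp add: mult_ac add.commute)
    also have "\<dots> \<le> K * K' * (real i + 1) ^ (e + e') * ((real i + 1) * (real (B + m + m' + 1) * (real i + 1)))"
    proof (intro mult_left_mono)
      have "j + 1 \<le> B * i + (m + m') + 1" using False by simp
      also have "\<dots> = B * i + (m + m' + 1) * 1" by simp
      also have "\<dots> \<le> B * (i + 1) + (m + m' + 1) * (i + 1)" by (intro add_mono mult_le_mono) auto
      also have "\<dots> = (B + m + m' + 1) * (i + 1)" by (simp only: distrib_right add.assoc)
      finally have "real (j + 1) \<le> real ((B + m + m' + 1) * (i + 1))" by (simp only: of_nat_le_iff)
      then show "real j + 1 \<le> real (B + m + m' + 1) * (real i + 1)" by (simp only: of_nat_mult of_nat_add of_nat_1)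
    qed (use K in auto)
    also have "\<dots> = K * K' * real (B + m + m' + 1) * (real i + 1) ^ (e + e' + 2)"
      by (simp add: power_add power2_eq_square mult_ac)
    finally show ?thesis .
  qed
qed

lemma bdf_mono:
  assumes "bdf K e B m F" "K \<le> K'" "e \<le> e'" "m \<le> m'"
  shows "bdf K' e' B m' F"
  unfolding bdf_def
proof (intro allI conjI impI)
  fix i j
  have "norm (coeff (fps_nth F i) j) \<le> K * (real i + 1) ^ e" using assms(1) by (simp add: bdf_def)
  also have "\<dots> \<le> K' * (real i + 1) ^ e'"
    using assms bdf_nonneg[OF assms(1)] by (intro mult_mono power_increasing) auto
  finally show "norm (coeff (fps_nth F i) j) \<le> K' * (real i + 1) ^ e'" .
  show "coeff (fps_nth F i) j = 0" if "B * i + m' < j" using assms that by (auto simp: bdf_def)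
qed

text \<open>The quantifier order matters: the new constants must serve all F at once, since F will
  run through the normalised series of all neighbour pairs.\<close>

lemma bdf_power:
  "\<exists>K' e'. \<forall>F. bdf K e B m F \<longrightarrow> bdf K' e' B (t * m) (F ^ t)"
proof (induction t)
  case 0
  have "bdf 1 0 B 0 1" by (auto simp: bdf_def coeff_1)
  then show ?case by auto
next
  case (Suc t)
  then obtain K' e' where IH: "\<And>F. bdf K e B m F \<Longrightarrow> bdf K' e' B (t * m) (F ^ t)" by blast
  have "bdf K e B m F \<Longrightarrow> bdf (K * K' * real (B + m + t * m + 1)) (e + e' + 2) B (Suc t * m) (F ^ Suc t)" for F
    unfolding power_Suc mult_Suc by (rule bdf_mult[OF _ IH])
  then show ?case by blast
qed

lemma bdf_Phi:
  "\<exists>K' e'. \<forall>F. bdf K e B m F \<longrightarrow> bdf K' e' B (b + t * m) (Phi F (a, b, t))"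
proof -
  obtain K' e' where pw: "\<And>F. bdf K e B m F \<Longrightarrow> bdf K' e' B (t * m) (F ^ t)" using bdf_power by blast
  have "bdf 1 0 B b (fps_X ^ a * fps_const (monom 1 b))"
    by (auto simp: bdf_def fps_X_power_mult_nth)
  from bdf_mult[OF this pw] show ?thesis unfolding Phi_def case_prod_conv by blast
qed

lemma bdf_Phi_box:
  assumes "finite A"
  shows "\<exists>K' e'. \<forall>F. bdf K e B m F \<longrightarrow> (\<forall>k\<in>A. bdf K' e' B (fst (snd k) + snd (snd k) * m) (Phi F k))"
  using assms
proof (induction A rule: finite_induct)
  case (insert k A)
  then obtain K1 e1 where 1: "\<And>F k. bdf K e B m F \<Longrightarrow> k \<in> A \<Longrightarrow> bdf K1 e1 B (fst (snd k) + snd (snd k) * m) (Phi F k)" by blast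
  obtain a b t where k: "k = (a, b, t)" by (cases k) auto
  obtain K2 e2 where 2: "\<And>F. bdf K e B m F \<Longrightarrow> bdf K2 e2 B (b + t * m) (Phi F (a, b, t))" using bdf_Phi by blast
  have "bdf K e B m F \<Longrightarrow> k' \<in> insert k A \<Longrightarrow> bdf (max K1 K2) (max e1 e2) B (fst (snd k') + snd (snd k') * m) (Phi F k')" for F k'
  proof -
    assume F: "bdf K e B m F" and k': "k' \<in> insert k A"
    show ?thesis
    proof (cases "k' \<in> A")
      case True
      from 1[OF F True] show ?thesis by (rule bdf_mono) auto
    next
      case False
      then have "k' = (a, b, t)" using k' k by simp
      moreover from 2[OF F] have "bdf (max K1 K2) (max e1 e2) B (b + t * m) (Phi F (a, b, t))" by (rule bdf_mono) auto
      ultimately show ?thesis by simp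
    qed
  qed
  then show ?case by blast
qed auto

lemma poly_bdf_bound:
  assumes F: "bdf K e B m F" and y: "norm y \<le> 1"
  shows "norm (poly (fps_nth F i) y) \<le> K * real (B + m + 1) * (real i + 1) ^ (e + 1)"
proof -
  have K: "0 \<le> K" using bdf_nonneg[OF F] .
  have "degree (fps_nth F i) \<le> B * i + m"
    by (rule degree_le) (use F in \<open>auto simp: bdf_def\<close>)
  then have "poly (fps_nth F i) y = (\<Sum>j\<le>B * i + m. coeff (fps_nth F i) j * y ^ j)"
    using poly_as_sum_of_monoms'[of "fps_nth F i" "B * i + m"] by (metis (no_types, lifting) poly_monom poly_sum sum.cong)
  then have "norm (poly (fps_nth F i) y) \<le> (\<Sum>j\<le>B * i + m. norm (coeff (fps_nth F i) j * y ^ j))"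
    by (simp add: norm_sum)
  also have "\<dots> \<le> (\<Sum>j\<le>B * i + m. K * (real i + 1) ^ e)"
  proof (rule sum_mono)
    fix j
    have "norm (coeff (fps_nth F i) j) * norm y ^ j \<le> (K * (real i + 1) ^ e) * 1"
      using F y K by (intro mult_mono power_le_one) (auto simp: bdf_def)
    then show "norm (coeff (fps_nth F i) j * y ^ j) \<le> K * (real i + 1) ^ e" by (simp add: norm_mult norm_power)
  qed
  also have "\<dots> = real (B * i + m + 1) * (K * (real i + 1) ^ e)" by simp
  also have "\<dots> \<le> (real (B + m + 1) * (real i + 1)) * (K * (real i + 1) ^ e)"
  proof (rule mult_right_mono)
    have "B * i + m + 1 = B * i + (m + 1) * 1" by simp
    also have "\<dots> \<le> B * (i + 1) + (m + 1) * (i + 1)" by (intro add_mono mult_le_mono) auto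
    also have "\<dots> = (B + m + 1) * (i + 1)" by (simp only: distrib_right add.assoc)
    finally have "real (B * i + m + 1) \<le> real ((B + m + 1) * (i + 1))" by (simp only: of_nat_le_iff)
    then show "real (B * i + m + 1) \<le> real (B + m + 1) * (real i + 1)" by (simp only: of_nat_mult of_nat_add of_nat_1)
  qed (use K in auto)
  finally show ?thesis by (simp add: mult_ac)
qed

lemma bdf_conv_radius:
  assumes F: "bdf K e B m F" and y: "norm y \<le> 1" and x: "norm x < 1"
  shows "norm x < fps_conv_radius (fev y F)"
proof -
  define r where "r = (norm x + 1) / 2"
  have r: "0 \<le> r" "r < 1" "norm x < r" using x by (auto simp: r_def add_nonneg_pos intro: add_nonneg_nonneg)
  have "summable (\<lambda>i. fps_nth (fev y F) i * of_real r ^ i)"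
  proof (rule summable_comparison_test)
    show "summable (\<lambda>i. K * real (B + m + 1) * ((real i + 1) ^ (e + 1) * r ^ i))"
      using r by (intro summable_mult summable_poly_power) auto
    have "norm (fps_nth (fev y F) i * of_real r ^ i) \<le> K * real (B + m + 1) * ((real i + 1) ^ (e + 1) * r ^ i)" for i
      using mult_right_mono[OF poly_bdf_bound[OF F y, of i], of "r ^ i"] r by (simp add: norm_mult norm_power mult_ac)
    then show "\<exists>N. \<forall>i\<ge>N. norm (fps_nth (fev y F) i * of_real r ^ i) \<le> K * real (B + m + 1) * ((real i + 1) ^ (e + 1) * r ^ i)" by blast
  qed
  then have "norm (of_real r :: complex) \<le> fps_conv_radius (fev y F)"
    unfolding fps_conv_radius_def by (rule conv_radius_geI)
  moreover have "ereal (norm x) < ereal (norm (of_real r :: complex))" using r by simp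
  ultimately show ?thesis by (rule less_le_trans[rotated])
qed

section \<open>Coefficientwise convergence and compactness\<close>

definition cvg :: "(nat \<Rightarrow> complex poly fps) \<Rightarrow> complex poly fps \<Rightarrow> bool" where
  "cvg F L \<longleftrightarrow> (\<forall>i j. (\<lambda>k. coeff (fps_nth (F k) i) j) \<longlonglongrightarrow> coeff (fps_nth L i) j)"

lemma cvg_mult: "cvg F L \<Longrightarrow> cvg G M \<Longrightarrow> cvg (\<lambda>k. F k * G k) (L * M)"
  unfolding cvg_def coeff_fps_mult by (intro allI tendsto_sum tendsto_mult) auto

lemma cvg_const: "cvg (\<lambda>_. L) L"
  by (simp add: cvg_def)

lemma cvg_power: "cvg F L \<Longrightarrow> cvg (\<lambda>k. F k ^ t) (L ^ t)"
proof (induction t)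
  case 0
  show ?case unfolding power_0 by (rule cvg_const)
next
  case (Suc t)
  show ?case unfolding power_Suc by (rule cvg_mult[OF Suc.prems Suc.IH[OF Suc.prems]])
qed

lemma cvg_Phi: "cvg F L \<Longrightarrow> cvg (\<lambda>k. Phi (F k) z) (Phi L z)"
  unfolding Phi_def case_prod_unfold by (rule cvg_mult[OF cvg_const cvg_power])

lemma cvg_sum: "(\<And>z. z \<in> A \<Longrightarrow> cvg (\<lambda>k. F z k) (L z)) \<Longrightarrow> cvg (\<lambda>k. \<Sum>z\<in>A. F z k) (\<Sum>z\<in>A. L z)"
  unfolding cvg_def fps_sum_nth coeff_sum by (intro allI tendsto_sum) blast

lemma cvg_combo:
  assumes "cvg F L" "\<And>z. z \<in> A \<Longrightarrow> (\<lambda>k. c k z) \<longlonglongrightarrow> c' z"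
  shows "cvg (\<lambda>k. combo (F k) A (c k)) (combo L A c')"
  unfolding combo_def
proof (rule cvg_sum)
  fix z assume "z \<in> A"
  then have c: "(\<lambda>k. c k z) \<longlonglongrightarrow> c' z" by (rule assms(2))
  have "cvg (\<lambda>k. fps_const [:c k z:]) (fps_const [:c' z:])"
    unfolding cvg_def
  proof (intro allI)
    fix i j
    show "(\<lambda>k. coeff (fps_nth (fps_const [:c k z:]) i) j) \<longlonglongrightarrow> coeff (fps_nth (fps_const [:c' z:]) i) j"
      using c by (cases i; cases j) simp_all
  qed
  then show "cvg (\<lambda>k. fps_const [:c k z:] * Phi (F k) z) (fps_const [:c' z:] * Phi L z)"
    by (rule cvg_mult[OF _ cvg_Phi[OF assms(1)]])
qed

lemma eventually_const_of_tendsto_nat: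
  fixes b :: "nat \<Rightarrow> nat"
  assumes "(\<lambda>k. complex_of_real (real (b k))) \<longlonglongrightarrow> l"
  obtains n where "\<forall>\<^sub>F k in sequentially. b k = n"
proof -
  have "(\<lambda>k. Re (complex_of_real (real (b k)))) \<longlonglongrightarrow> Re l" by (rule tendsto_Re[OF assms])
  then have "(\<lambda>k. real (b k)) \<longlonglongrightarrow> Re l" by (simp only: Re_complex_of_real)
  then have "\<forall>\<^sub>F k in sequentially. dist (real (b k)) (Re l) < 1 / 2" by (rule tendstoD) simp
  then have "\<forall>\<^sub>F k in sequentially. b k = nat \<lfloor>Re l + 1 / 2\<rfloor>"
  proof (rule eventually_mono)
    fix k assume "dist (real (b k)) (Re l) < 1 / 2"
    then have "real (b k) < Re l + 1 / 2" "Re l + 1 / 2 < real (b k) + 1" unfolding dist_real_def by linarith+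
    then have "\<lfloor>Re l + 1 / 2\<rfloor> = int (b k)" by (intro floor_unique) auto
    then show "b k = nat \<lfloor>Re l + 1 / 2\<rfloor>" by (simp only: nat_int)
  qed
  then show thesis by (rule that)
qed

text \<open>
  Compactness: all parameters converge along a subsequence, the limit slope is irrational by \<open>indep\<close>, and
  a nonzero coefficient of the limit combination persists.
\<close>
theorem uniform_nonvanishing:
  fixes th kap :: "nat \<Rightarrow> real" and b :: "nat \<Rightarrow> nat \<Rightarrow> nat" and w :: "nat \<Rightarrow> nat \<Rightarrow> complex poly"
    and c :: "nat \<Rightarrow> nat \<times> nat \<times> nat \<Rightarrow> complex" and B :: nat
  assumes th: "\<And>k. 0 \<le> th k" "\<And>k. th k \<le> real B" and kap: "\<And>k. 0 \<le> kap k" "\<And>k. kap k \<le> 1"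
    and indep: "\<And>u v :: int. u \<noteq> 0 \<Longrightarrow> \<exists>\<epsilon>>0. \<forall>\<^sub>F k in sequentially. \<epsilon> \<le> \<bar>of_int u * th k + of_int v\<bar>"
    and b: "\<And>k i. real i * th k + kap k - 1 \<le> real (b k i)" "\<And>k i. real (b k i) \<le> real i * th k + kap k"
    and w: "\<And>k i. degree (w k i) \<le> D" "\<And>k i j. norm (coeff (w k i) j) \<le> K * (real i + 1) ^ e"
    and pos: "0 < cp" "\<And>k i. cp \<le> Re (coeff (w k i) 0)"
    and A: "finite A" and c: "\<And>k. (\<Sum>z\<in>A. norm (c k z)) = 1"
  shows "\<exists>i j. \<exists>\<^sub>F k in sequentially. coeff (fps_nth (combo (Abs_fps (\<lambda>i. monom 1 (b k i) * w k i)) A (c k)) i) j \<noteq> 0"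
proof -
  define K' where "K' = max K 1"
  have K': "K' > 0" by (simp add: K'_def)
  \<comment> \<open>All parameters, scaled to modulus at most 1, are packed into one function on a
    countable set; the tag g tells them apart. A single diagonal argument then makes all of them
    converge.\<close>
  define f :: "nat \<Rightarrow> nat \<times> nat \<times> nat \<times> nat \<Rightarrow> complex" where
    "f k = (\<lambda>(g, i, j, t).
       if g = 0 then coeff (w k i) j / of_real (K' * (real i + 1) ^ e)
       else if g = 1 then of_real (real (b k i) / (real B * real i + 1))
       else if g = 2 then of_real (th k / (real B + 1))
       else if g = 3 then of_real (kap k)
       else if (i, j, t) \<in> A then c k (i, j, t) else 0)" for k
  have "norm (f k z) \<le> 1" for k z
  proof -
    obtain g i j t where z: "z = (g, i, j, t)" by (cases z) auto
    have 0: "norm (coeff (w k i) j / of_real (K' * (real i + 1) ^ e)) \<le> 1"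
    proof -
      have "norm (coeff (w k i) j) \<le> K * (real i + 1) ^ e" by (rule w)
      also have "\<dots> \<le> K' * (real i + 1) ^ e" by (intro mult_right_mono) (auto simp: K'_def)
      finally show ?thesis using K' by (simp add: norm_divide norm_mult norm_power divide_le_eq flip: of_real_mult of_real_power of_real_add)
    qed
    have "real (b k i) \<le> real i * real B + 1"
      using b(2)[of k i] kap(2)[of k] mult_left_mono[OF th(2)[of k], of "real i"] by simp
    then have 1: "norm (complex_of_real (real (b k i) / (real B * real i + 1))) \<le> 1"
      unfolding norm_of_real by (simp add: divide_le_eq mult.commute add_pos_nonneg add_nonneg_pos)
    have 2: "norm (complex_of_real (th k / (real B + 1))) \<le> 1"
      unfolding norm_of_real using th[of k] by (simp add: divide_le_eq)
    have 3: "norm (complex_of_real (kap k)) \<le> 1" unfolding norm_of_real using kap[of k] by simp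
    have 4: "norm (c k (i, j, t)) \<le> 1" if "(i, j, t) \<in> A"
      using member_le_sum[OF that, of "\<lambda>z. norm (c k z)"] A c[of k] by simp
    show ?thesis unfolding z f_def using 0 1 2 3 4 by auto
  qed
  then have fb: "\<And>k z. z \<in> UNIV \<Longrightarrow> norm (f k z) \<le> 1" by blast
  obtain r where r: "strict_mono r" and conv': "\<And>z. z \<in> UNIV \<Longrightarrow> \<exists>l. (\<lambda>k. f (r k) z) \<longlonglongrightarrow> l"
  proof (rule function_convergent_subsequence[of UNIV f 1])
    show "countable (UNIV :: (nat \<times> nat \<times> nat \<times> nat) set)" by (rule countableI_type)
    show "norm (f k z) \<le> 1" if "z \<in> UNIV" for k z by (rule fb[OF that])
    show thesis if "strict_mono r" "\<And>z. z \<in> UNIV \<Longrightarrow> \<exists>l. (\<lambda>k. f (r k) z) \<longlonglongrightarrow> l"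
      and "\<And>r. strict_mono r \<Longrightarrow> (\<And>z. z \<in> UNIV \<Longrightarrow> \<exists>l. (\<lambda>k. f (r k) z) \<longlonglongrightarrow> l) \<Longrightarrow> thesis" for r
      using that by blast
  qed
  have conv: "\<exists>l. (\<lambda>k. f (r k) z) \<longlonglongrightarrow> l" for z by (rule conv') simp
  have conv_w: "\<exists>l. (\<lambda>k. coeff (w (r k) i) j) \<longlonglongrightarrow> l" for i j
  proof -
    obtain l where "(\<lambda>k. f (r k) (0, i, j, 0)) \<longlonglongrightarrow> l" using conv by blast
    then have l: "(\<lambda>k. coeff (w (r k) i) j / of_real (K' * (real i + 1) ^ e)) \<longlonglongrightarrow> l"
      unfolding f_def by simp
    define s0 where "s0 = complex_of_real (K' * (real i + 1) ^ e)"
    have "s0 \<noteq> 0" unfolding s0_def of_real_eq_0_iff using K' by simp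
    then have cancel: "s0 * (X / s0) = X" for X by simp
    have "(\<lambda>k. s0 * (coeff (w (r k) i) j / s0)) \<longlonglongrightarrow> s0 * l"
      using l unfolding s0_def[symmetric] by (rule tendsto_mult_left)
    then show ?thesis unfolding cancel by blast
  qed
  then obtain wl where wl: "\<And>i j. (\<lambda>k. coeff (w (r k) i) j) \<longlonglongrightarrow> wl i j" by metis
  \<comment> \<open>A convergent sequence of integers is eventually constant, so each limit exponent
    is a natural number again.\<close>
  have conv_b: "\<exists>n. \<forall>\<^sub>F k in sequentially. b (r k) i = n" for i
  proof -
    obtain l where "(\<lambda>k. f (r k) (1, i, 0, 0)) \<longlonglongrightarrow> l" using conv by blast
    then have l: "(\<lambda>k. of_real (real B * real i + 1) * complex_of_real (real (b (r k) i) / (real B * real i + 1))) \<longlonglongrightarrow> of_real (real B * real i + 1) * l"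
      unfolding f_def by (intro tendsto_mult_left) simp
    have "0 < real B * real i + 1" by (intro add_nonneg_pos) auto
    then have "of_real (real B * real i + 1) * complex_of_real (real (b (r k) i) / (real B * real i + 1)) = complex_of_real (real (b (r k) i))" for k
      unfolding of_real_mult[symmetric] by simp
    with l have "(\<lambda>k. complex_of_real (real (b (r k) i))) \<longlonglongrightarrow> of_real (real B * real i + 1) * l" by (simp only:)
    then show ?thesis by (rule eventually_const_of_tendsto_nat) blast
  qed
  then obtain bl where bl: "\<And>i. \<forall>\<^sub>F k in sequentially. b (r k) i = bl i" by metis
  obtain thl where thl: "(\<lambda>k. th (r k)) \<longlonglongrightarrow> thl"
  proof -
    obtain l where "(\<lambda>k. f (r k) (2, 0, 0, 0)) \<longlonglongrightarrow> l" using conv by blast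
    then have "(\<lambda>k. (real B + 1) * Re (complex_of_real (th (r k) / (real B + 1)))) \<longlonglongrightarrow> (real B + 1) * Re l"
      unfolding f_def by (intro tendsto_mult_left tendsto_Re) simp
    then have "(\<lambda>k. th (r k)) \<longlonglongrightarrow> (real B + 1) * Re l" unfolding Re_complex_of_real by simp
    then show thesis by (rule that)
  qed
  obtain kapl where kapl: "(\<lambda>k. kap (r k)) \<longlonglongrightarrow> kapl"
  proof -
    obtain l where "(\<lambda>k. f (r k) (3, 0, 0, 0)) \<longlonglongrightarrow> l" using conv by blast
    then have "(\<lambda>k. Re (complex_of_real (kap (r k)))) \<longlonglongrightarrow> Re l"
      unfolding f_def by (intro tendsto_Re) simp
    then show thesis unfolding Re_complex_of_real by (rule that)
  qed
  have "\<exists>l. (\<lambda>k. c (r k) z) \<longlonglongrightarrow> l" if "z \<in> A" for z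
  proof -
    obtain i j t where z: "z = (i, j, t)" by (cases z) auto
    obtain l where "(\<lambda>k. f (r k) (4, i, j, t)) \<longlonglongrightarrow> l" using conv by blast
    then show ?thesis using that unfolding f_def z by auto
  qed
  then obtain cl where cl: "\<And>z. z \<in> A \<Longrightarrow> (\<lambda>k. c (r k) z) \<longlonglongrightarrow> cl z" by metis
  define W where "W i = (\<Sum>j\<le>D. monom (wl i j) j)" for i
  have wl0: "wl i j = 0" if "D < j" for i j
  proof -
    have "coeff (w (r k) i) j = 0" for k using w(1)[of "r k" i] that by (intro coeff_eq_0) simp
    with wl[of i j] have "(\<lambda>_ :: nat. 0) \<longlonglongrightarrow> wl i j" by (simp only:)
    then show ?thesis by (simp add: LIMSEQ_const_iff)
  qed
  have cW: "coeff (W i) j = wl i j" for i j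
  proof -
    have "coeff (W i) j = (\<Sum>j'\<le>D. if j' = j then wl i j' else 0)" by (simp add: W_def coeff_sum)
    then show ?thesis using wl0 by (auto simp: not_le)
  qed
  have degW: "degree (W i) \<le> D" for i by (rule degree_le) (simp add: cW wl0)
  have normW: "norm (coeff (W i) j) \<le> K * (real i + 1) ^ e" for i j
    unfolding cW by (rule Lim_bounded[OF tendsto_norm[OF wl], of 0]) (use w in auto)
  have posW: "cp \<le> Re (coeff (W i) 0)" for i
    unfolding cW by (rule Lim_bounded2[OF tendsto_Re[OF wl], of 0]) (use pos in auto)
  have bl1: "real i * thl + kapl - 1 \<le> real (bl i)" for i
  proof (rule tendsto_upperbound)
    show "(\<lambda>k. real i * th (r k) + kap (r k) - 1) \<longlonglongrightarrow> real i * thl + kapl - 1"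
      by (intro tendsto_intros thl kapl)
    show "\<forall>\<^sub>F k in sequentially. real i * th (r k) + kap (r k) - 1 \<le> real (bl i)"
      using bl[of i]
    proof eventually_elim
      case (elim k)
      then show ?case using b(1)[where i = i and k = "r k"] by simp
    qed
  qed simp
  have bl2: "real (bl i) \<le> real i * thl + kapl" for i
  proof (rule tendsto_lowerbound)
    show "(\<lambda>k. real i * th (r k) + kap (r k)) \<longlonglongrightarrow> real i * thl + kapl"
      by (intro tendsto_intros thl kapl)
    show "\<forall>\<^sub>F k in sequentially. real (bl i) \<le> real i * th (r k) + kap (r k)"
      using bl[of i]
    proof eventually_elim
      case (elim k)
      then show ?case using b(2)[where i = i and k = "r k"] by simp
    qed
  qed simp
  have sub: "\<forall>\<^sub>F k in sequentially. P (r k)" if "\<forall>\<^sub>F k in sequentially. P k" for P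
    using filterlim_subseq[OF r] that unfolding filterlim_iff by blast
  have irr: "thl \<notin> \<rat>"
  proof
    assume "thl \<in> \<rat>"
    then obtain m n :: int where mn: "n > 0" "thl = of_int m / of_int n" by (auto elim: Rats_cases')
    obtain \<epsilon> where eps: "\<epsilon> > 0" "\<forall>\<^sub>F k in sequentially. \<epsilon> \<le> \<bar>of_int n * th k + of_int (- m)\<bar>"
      using indep[of n "- m"] mn(1) by auto
    have "(\<lambda>k. \<bar>of_int n * th (r k) + of_int (- m)\<bar>) \<longlonglongrightarrow> \<bar>of_int n * thl + of_int (- m)\<bar>"
      by (intro tendsto_intros thl)
    moreover have "\<bar>of_int n * thl + of_int (- m)\<bar> = 0" using mn by simp
    ultimately have "(\<lambda>k. \<bar>of_int n * th (r k) + of_int (- m)\<bar>) \<longlonglongrightarrow> 0" by simp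
    then have "\<epsilon> \<le> 0" by (rule tendsto_lowerbound) (use sub[OF eps(2)] in auto)
    then show False using eps(1) by simp
  qed
  \<comment> \<open>The normalisation passes to the limit, so the limit relation still has a nonzero
    coefficient.\<close>
  have "(\<lambda>k. \<Sum>z\<in>A. norm (c (r k) z)) \<longlonglongrightarrow> (\<Sum>z\<in>A. norm (cl z))" by (intro tendsto_sum tendsto_norm cl)
  then have "(\<Sum>z\<in>A. norm (cl z)) = 1" unfolding c by (simp add: LIMSEQ_const_iff)
  then obtain z0 where z0: "z0 \<in> A" "cl z0 \<noteq> 0" by (metis norm_zero sum.neutral zero_neq_one)
  define L where "L = Abs_fps (\<lambda>i. monom 1 (bl i) * W i)"
  have cvgL: "cvg (\<lambda>k. Abs_fps (\<lambda>i. monom 1 (b (r k) i) * w (r k) i)) L"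
    unfolding cvg_def
  proof (intro allI)
    fix i j
    have "(\<lambda>k. if j < bl i then 0 else coeff (w (r k) i) (j - bl i)) \<longlonglongrightarrow> (if j < bl i then 0 else wl i (j - bl i))"
      using wl by auto
    moreover have "\<forall>\<^sub>F k in sequentially. (if j < bl i then 0 else coeff (w (r k) i) (j - bl i)) =
        coeff (fps_nth (Abs_fps (\<lambda>i. monom 1 (b (r k) i) * w (r k) i)) i) j"
      using bl[of i] by eventually_elim (simp add: coeff_monom_mult)
    ultimately show "(\<lambda>k. coeff (fps_nth (Abs_fps (\<lambda>i. monom 1 (b (r k) i) * w (r k) i)) i) j) \<longlonglongrightarrow> coeff (fps_nth L i) j"
      by (subst (asm) tendsto_cong) (auto simp: L_def coeff_monom_mult cW)
  qed
  have nz: "combo L A cl \<noteq> 0"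
    unfolding L_def by (rule sturmian_series_transcendental[where p = cl and ?k0.0 = z0, OF irr bl1 bl2 degW normW pos(1) posW A z0])
  have "\<exists>i j. coeff (fps_nth (combo L A cl) i) j \<noteq> 0"
  proof (rule ccontr)
    assume none: "\<not> ?thesis"
    have "fps_nth (combo L A cl) i = 0" for i
    proof (rule poly_eqI)
      fix j
      show "coeff (fps_nth (combo L A cl) i) j = coeff 0 j" unfolding coeff_0 using none by blast
    qed
    then have "combo L A cl = 0" by (intro fps_ext) simp
    then show False using nz by blast
  qed
  then obtain i j where ij: "coeff (fps_nth (combo L A cl) i) j \<noteq> 0" by blast
  have cc: "cvg (\<lambda>k. combo (Abs_fps (\<lambda>i. monom 1 (b (r k) i) * w (r k) i)) A (c (r k))) (combo L A cl)"
    using cvgL by (rule cvg_combo) (rule cl)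
  note lim = cc[unfolded cvg_def, rule_format, of i j]
  define P where "P k \<longleftrightarrow> coeff (fps_nth (combo (Abs_fps (\<lambda>i. monom 1 (b k i) * w k i)) A (c k)) i) j \<noteq> 0" for k
  have ev: "\<forall>\<^sub>F k in sequentially. P (r k)"
    unfolding P_def using lim ij by (rule tendsto_imp_eventually_ne)
  have "\<exists>\<^sub>F k in sequentially. P k"
  proof (rule ccontr)
    assume "\<not> (\<exists>\<^sub>F k in sequentially. P k)"
    then have "\<forall>\<^sub>F k in sequentially. \<not> P k" by (simp only: not_frequently)
    then have "\<forall>\<^sub>F k in sequentially. \<not> P (r k)" by (rule sub)
    with ev have "\<forall>\<^sub>F k in sequentially. False" by eventually_elim blast
    then show False by simp
  qed
  then have "\<exists>\<^sub>F k in sequentially. coeff (fps_nth (combo (Abs_fps (\<lambda>i. monom 1 (b k i) * w k i)) A (c k)) i) j \<noteq> 0"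
    unfolding P_def .
  then show ?thesis by blast
qed

section \<open>Enumerating the mismatches\<close>

context unimodular_pair
begin

text \<open>Moving from the first mismatch by iQ + bq changes the distance of the fractional part to
  1, in units of \<eta>, from \<open>offset\<close> to i * slope + offset - b. A mismatch requires
  this number to lie in (0, 1], which leaves exactly one b: the ceiling of i * slope + offset, minus
  1.\<close>

definition "slope = \<eta>' / \<eta>"
definition "first_mis = (LEAST n. n \<in> MisU)"
definition "offset = (1 - (real first_mis * \<theta> + \<alpha> - of_int (s first_mis))) / \<eta>"
definition "bexp i = nat (\<lceil>real i * slope + offset\<rceil> - 1)"
definition "mis_enum i = first_mis + i * Q + bexp i * q"

lemma first_mis: "first_mis \<in> MisU" and first_mis_le: "n \<in> MisU \<Longrightarrow> first_mis \<le> n"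
proof -
  show "first_mis \<in> MisU" unfolding first_mis_def
    using mismatch_unbounded[OF q shift_up, of 0] by (auto intro: LeastI)
  show "n \<in> MisU \<Longrightarrow> first_mis \<le> n" unfolding first_mis_def by (rule Least_le)
qed

lemma slope_pos: "0 < slope"
  using eta by (simp add: slope_def)

lemma offset: "0 < offset" "offset \<le> 1"
  using first_mis eta s_gt[of first_mis] by (auto simp: offset_def MisU_def divide_le_eq)

lemma offset_eta: "offset * \<eta> = 1 - (real first_mis * \<theta> + \<alpha> - of_int (s first_mis))"
  using eta by (simp add: offset_def)

lemma slope_eta: "slope * \<eta> = \<eta>'"
  using eta by (simp add: slope_def)

lemma bexp_int: "int (bexp i) = \<lceil>real i * slope + offset\<rceil> - 1"
proof -
  have "0 \<le> real i * slope" using slope_pos by simp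
  then have "1 \<le> \<lceil>real i * slope + offset\<rceil>" using offset by linarith
  then show ?thesis by (simp add: bexp_def)
qed

lemma bexp_bounds: "real i * slope + offset - 1 \<le> real (bexp i)" "real (bexp i) < real i * slope + offset"
proof -
  have "real (bexp i) = of_int (\<lceil>real i * slope + offset\<rceil> - 1)" by (simp only: bexp_int[symmetric] of_int_of_nat_eq)
  then show "real i * slope + offset - 1 \<le> real (bexp i)" "real (bexp i) < real i * slope + offset" by linarith+
qed

lemma mis_value:
  "real_of_int (int first_mis + i * int Q + b * int q) * \<theta> + \<alpha> - of_int (s first_mis + i * P + b * p)
    = 1 - (of_int i * slope + offset - of_int b) * \<eta>"
proof -
  have "(of_int i * slope + offset - of_int b) * \<eta> = of_int i * (slope * \<eta>) + offset * \<eta> - of_int b * \<eta>"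
    by (simp add: algebra_simps)
  then show ?thesis unfolding slope_eta offset_eta by (simp add: \<eta>_def \<eta>'_def algebra_simps)
qed

lemma mis_enum: "mis_enum i \<in> MisU"
proof -
  define z where "z = (real i * slope + offset - real (bexp i)) * \<eta>"
  have "0 < real i * slope + offset - real (bexp i)" "real i * slope + offset - real (bexp i) \<le> 1"
    using bexp_bounds[of i] by linarith+
  then have z: "0 < z" "z \<le> \<eta>" using eta by (auto simp: z_def mult_left_le_one_le)
  have v: "real (mis_enum i) * \<theta> + \<alpha> - of_int (s first_mis + int i * P + int (bexp i) * p) = 1 - z"
    using mis_value[of "int i" "int (bexp i)"] by (simp add: mis_enum_def z_def)
  have e: "s (mis_enum i) = s first_mis + int i * P + int (bexp i) * p"
    by (rule s_eqI) (use v z eta_bounds in linarith)+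
  show "mis_enum i \<in> MisU" using v z unfolding MisU_def mem_Collect_eq e by linarith
qed

lemma strict_mono_mis_enum: "strict_mono mis_enum"
proof (rule strict_monoI_Suc)
  fix i
  have "real i * slope + offset \<le> real (Suc i) * slope + offset" using slope_pos by simp
  then have "\<lceil>real i * slope + offset\<rceil> \<le> \<lceil>real (Suc i) * slope + offset\<rceil>" by (rule ceiling_mono)
  then have "bexp i \<le> bexp (Suc i)" by (simp add: bexp_def)
  then have "bexp i * q \<le> bexp (Suc i) * q" by (rule mult_le_mono1)
  moreover have "i * Q < Suc i * Q" using Q by simp
  ultimately show "mis_enum i < mis_enum (Suc i)" unfolding mis_enum_def by linarith
qed

text \<open>Every mismatch has integer coordinates (i, b) relative to the first one, and the
  interval (0, 1] determines b. A negative i would force b <= 0, hence a position before the first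
  mismatch.\<close>

lemma range_mis_enum: "range mis_enum = MisU"
proof
  show "range mis_enum \<subseteq> MisU" using mis_enum by auto
  show "MisU \<subseteq> range mis_enum"
  proof
    fix n assume n: "n \<in> MisU"
    define i where "i = crd1 (int n - int first_mis) (s n - s first_mis)"
    define b where "b = crd2 (int n - int first_mis) (s n - s first_mis)"
    have "int n - int first_mis = i * int Q + b * int q" unfolding i_def b_def by (rule crd(1))
    then have nn: "int n = int first_mis + i * int Q + b * int q" by linarith
    have "s n - s first_mis = i * P + b * p" unfolding i_def b_def by (rule crd(2))
    then have ss: "s n = s first_mis + i * P + b * p" by linarith
    define z where "z = of_int i * slope + offset - of_int b"
    have "real n * \<theta> + \<alpha> - of_int (s n) = 1 - z * \<eta>"
    proof -
      have "real n = real_of_int (int n)" by simp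
      then show ?thesis unfolding z_def using mis_value[of i b] by (simp only: nn ss)
    qed
    then have "z * \<eta> \<le> 1 * \<eta>" "0 * \<eta> < z * \<eta>" using n s_gt[of n] by (auto simp: MisU_def)
    then have z: "z \<le> 1" "0 < z" using eta by (simp_all only: mult_le_cancel_right_pos mult_less_cancel_right_pos)
    have "0 \<le> i"
    proof (rule ccontr)
      assume "\<not> 0 \<le> i"
      then have i: "i \<le> - 1" by simp
      then have "of_int i * slope < 0" using slope_pos by (simp add: mult_less_0_iff)
      then have "real_of_int b < 1" using z offset unfolding z_def by linarith
      then have "b \<le> 0" by linarith
      then have "b * int q \<le> 0" by (simp add: mult_le_0_iff)
      moreover have "i * int Q < 0" using i Q by (simp add: mult_less_0_iff)
      ultimately have "int n < int first_mis" using nn by linarith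
      then show False using first_mis_le[OF n] by simp
    qed
    then have ii: "int (nat i) = i" by simp
    have "\<lceil>real (nat i) * slope + offset\<rceil> = b + 1"
    proof -
      have ri: "real (nat i) = of_int i" using \<open>0 \<le> i\<close> by simp
      show ?thesis unfolding ri using z unfolding z_def by (intro ceiling_unique) auto
    qed
    then have "int (bexp (nat i)) = b" unfolding bexp_int by simp
    then have "int n = int (mis_enum (nat i))" using nn ii by (simp add: mis_enum_def)
    then show "n \<in> range mis_enum" by auto
  qed
qed

text \<open>Going one step back, to i = -1 with its b <= 0, would give an earlier mismatch if that
  position were still positive.\<close>

lemma first_mis_bound: "real first_mis \<le> real Q + (slope + 1) * real q"
proof (rule ccontr)
  assume a: "\<not> ?thesis"
  define b where "b = \<lceil>offset - slope\<rceil> - 1"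
  have b: "offset - slope - 1 \<le> of_int b" "of_int b < offset - slope" unfolding b_def by linarith+
  have b0: "b \<le> 0" using b offset slope_pos by linarith
  define n where "n = int first_mis + (- 1) * int Q + b * int q"
  have "(- slope - 1) * real q \<le> of_int b * real q"
    using b offset by (intro mult_right_mono) auto
  then have "real_of_int n > 0" using a unfolding n_def by (simp add: algebra_simps)
  then have n0: "n > 0" by simp
  define z where "z = (of_int (- 1) * slope + offset - of_int b) * \<eta>"
  have "0 < of_int (- 1) * slope + offset - of_int b" "of_int (- 1) * slope + offset - of_int b \<le> 1"
    using b by auto
  then have z: "0 < z" "z \<le> \<eta>" using eta by (auto simp: z_def mult_left_le_one_le)
  have v: "real (nat n) * \<theta> + \<alpha> - of_int (s first_mis + (- 1) * P + b * p) = 1 - z"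
  proof -
    have "real (nat n) = real_of_int n" using n0 by simp
    then show ?thesis unfolding z_def n_def using mis_value[of "- 1" b] by (simp only:)
  qed
  have e: "s (nat n) = s first_mis + (- 1) * P + b * p"
    by (rule s_eqI) (use v z eta_bounds in linarith)+
  have "nat n \<in> MisU" using v z unfolding MisU_def mem_Collect_eq e by linarith
  then have "first_mis \<le> nat n" by (rule first_mis_le)
  then have "int first_mis \<le> n" using n0 by linarith
  moreover have "b * int q \<le> 0" using b0 by (simp add: mult_le_0_iff)
  ultimately show False using Q unfolding n_def by linarith
qed

text \<open>Brings the mismatch series into the form x^first_mis * G(x^Q, x^q).\<close>

lemma suminf_MisU:
  fixes x :: complex and w :: "nat \<Rightarrow> complex"
  assumes sm: "summable (\<lambda>n. (if n \<in> MisU then w n else 0) * x ^ n)" and x0: "x \<noteq> 0"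
  shows "(\<Sum>n. (if n \<in> MisU then w n else 0) * x ^ n) = x ^ first_mis * (\<Sum>i. (x ^ q) ^ bexp i * w (mis_enum i) * (x ^ Q) ^ i)"
proof -
  define g where "g n = (if n \<in> MisU then w n else 0) * x ^ n" for n
  have zero: "g n = 0" if "n \<notin> range mis_enum" for n using that unfolding range_mis_enum g_def by simp
  have ge: "g (mis_enum i) = x ^ first_mis * ((x ^ q) ^ bexp i * w (mis_enum i) * (x ^ Q) ^ i)" for i
  proof -
    have "g (mis_enum i) = w (mis_enum i) * x ^ (first_mis + i * Q + bexp i * q)"
      unfolding g_def using mis_enum[of i] by (simp add: mis_enum_def)
    also have "x ^ (first_mis + i * Q + bexp i * q) = x ^ first_mis * (x ^ Q) ^ i * (x ^ q) ^ bexp i"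
      by (simp only: power_add power_mult[symmetric] mult.commute[of i] mult.commute[of "bexp i"])
    finally show ?thesis by (simp only: mult_ac)
  qed
  have "suminf g = (\<Sum>i. g (mis_enum i))" by (rule suminf_mono_reindex[OF strict_mono_mis_enum zero, symmetric])
  also have "\<dots> = x ^ first_mis * (\<Sum>i. (x ^ q) ^ bexp i * w (mis_enum i) * (x ^ Q) ^ i)"
  proof -
    have "summable g" using sm unfolding g_def[abs_def] .
    then have "summable (\<lambda>i. g (mis_enum i))"
      using summable_mono_reindex[OF strict_mono_mis_enum, of g] zero by blast
    then have "summable (\<lambda>i. (x ^ q) ^ bexp i * w (mis_enum i) * (x ^ Q) ^ i)"
      unfolding ge using x0 summable_cmult_iff[of "x ^ first_mis"] by simp
    then show ?thesis unfolding ge by (rule suminf_mult)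
  qed
  finally show ?thesis unfolding g_def .
qed

end

section \<open>Farey neighbours of a badly approximable number\<close>

locale bad_pair = unimodular_pair +
  fixes c :: real
  assumes bad: "badly_approximable c" and c_le: "c \<le> 1"
begin

lemma c_pos: "0 < c"
  using bad by (simp add: badly_approximable_def)

lemma bad_lower: "w \<noteq> 0 \<Longrightarrow> c / \<bar>of_int w\<bar> \<le> \<bar>of_int w * \<theta> - of_int t\<bar>"
proof -
  assume w: "w \<noteq> 0"
  have b: "0 < w \<Longrightarrow> c / of_int w \<le> \<bar>of_int w * \<theta> - of_int t\<bar>" for w t :: int
    using bad unfolding badly_approximable_def by blast
  have "c / of_int \<bar>w\<bar> \<le> \<bar>of_int \<bar>w\<bar> * \<theta> - of_int (sgn w * t)\<bar>"
    by (rule b) (use w in simp)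
  also have "of_int \<bar>w\<bar> * \<theta> - of_int (sgn w * t) = of_int (sgn w) * (of_int w * \<theta> - of_int t)"
    by (cases "w > 0") (use w in \<open>auto simp: algebra_simps\<close>)
  also have "\<bar>of_int (sgn w) * (of_int w * \<theta> - of_int t)\<bar> = \<bar>of_int w * \<theta> - of_int t\<bar>"
    using w by (auto simp: abs_mult sgn_if)
  finally show ?thesis by simp
qed

lemma eta_lower: "c / real q \<le> \<eta>" "c / real Q \<le> \<eta>'"
  using bad_lower[of "int q" p] bad_lower[of "int Q" P] q Q eta by (auto simp: \<eta>_def \<eta>'_def abs_if split: if_splits)

lemma eta_upper: "\<eta> < 1 / real Q" "\<eta>' < 1 / real q"
  using eta_bounds q Q by (auto simp: less_divide_eq)

lemma qQ: "c * real Q \<le> real q" "c * real q \<le> real Q"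
proof -
  have "c / real q < 1 / real Q" "c / real Q < 1 / real q" using eta_lower eta_upper by linarith+
  then show "c * real Q \<le> real q" "c * real q \<le> real Q" using q Q by (auto simp: field_simps)
qed

lemma slope_le: "slope \<le> 1 / c"
proof -
  have "\<eta>' \<le> 1 / c * (c / real q)" using eta_upper c_pos by simp
  also have "\<dots> \<le> 1 / c * \<eta>" using eta_lower c_pos by (intro mult_left_mono) auto
  finally show ?thesis using eta by (simp add: slope_def divide_le_eq)
qed

text \<open>The number (u * slope + v) * \<eta> equals w\<theta> - t with w = vq - uQ, so bad
  approximability bounds it below by c/|w|, where |w| <= (|u| + |v|) Q/c; then \<eta> < 1/Q is
  divided out. For w = 0 the integer t is nonzero by the determinant. This excludes rational limits
  of slopes.\<close>

lemma slope_indep: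
  assumes "u \<noteq> 0"
  shows "c ^ 2 / of_int (\<bar>u\<bar> + \<bar>v\<bar>) \<le> \<bar>of_int u * slope + of_int v\<bar>"
proof -
  define w where "w = v * int q - u * int Q"
  define t where "t = v * p - u * P"
  define m where "m = real_of_int (\<bar>u\<bar> + \<bar>v\<bar>)"
  have m: "1 \<le> m" using assms unfolding m_def by linarith
  have eq: "of_int w * \<theta> - of_int t = (of_int u * slope + of_int v) * \<eta>"
  proof -
    have "(of_int u * slope + of_int v) * \<eta> = of_int u * (slope * \<eta>) + of_int v * \<eta>" by (simp add: algebra_simps)
    then show ?thesis unfolding slope_eta by (simp add: w_def t_def \<eta>_def \<eta>'_def algebra_simps)
  qed
  have Q0: "real Q > 0" using Q by simp
  have w_le: "\<bar>of_int w\<bar> \<le> m * (real Q / c)"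
  proof -
    have "\<bar>real_of_int w\<bar> \<le> \<bar>of_int v\<bar> * real q + \<bar>of_int u\<bar> * real Q"
      unfolding w_def by (simp add: abs_mult order.trans[OF abs_triangle_ineq4])
    also have "\<dots> \<le> \<bar>of_int v\<bar> * (real Q / c) + \<bar>of_int u\<bar> * (real Q / c)"
    proof (intro add_mono mult_left_mono)
      show "real q \<le> real Q / c" using qQ(2) c_pos by (simp add: le_divide_eq mult.commute)
      show "real Q \<le> real Q / c" using c_pos c_le Q0 by (simp add: le_divide_eq mult_left_le)
    qed auto
    finally show ?thesis by (simp add: m_def algebra_simps)
  qed
  have "c ^ 2 / m / real Q \<le> \<bar>(of_int u * slope + of_int v) * \<eta>\<bar>"
  proof (cases "w = 0")
    case True
    have "t \<noteq> 0"
    proof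
      assume t0: "t = 0"
      have "w * p - t * int q = u * (P * int q - p * int Q)" by (simp add: w_def t_def algebra_simps)
      then have "u = w * p - t * int q" by (simp add: det)
      then show False using t0 True assms by simp
    qed
    then have "1 \<le> \<bar>real_of_int t\<bar>" by linarith
    moreover have "c ^ 2 / m / real Q \<le> 1"
    proof -
      have "c ^ 2 \<le> 1" using c_pos c_le by (intro power_le_one) auto
      moreover have "1 * 1 \<le> m * real Q" using m Q by (intro mult_mono) auto
      ultimately show ?thesis using m Q by (simp add: divide_le_eq)
    qed
    ultimately show ?thesis using True unfolding eq[symmetric] by simp
  next
    case False
    have "c ^ 2 / m / real Q = c / (m * (real Q / c))" by (simp add: power2_eq_square)
    also have "\<dots> \<le> c / \<bar>of_int w\<bar>" using w_le False c_pos m Q by (intro divide_left_mono mult_pos_pos) auto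
    also have "\<dots> \<le> \<bar>of_int w * \<theta> - of_int t\<bar>" by (rule bad_lower[OF False])
    finally show ?thesis unfolding eq .
  qed
  also have "\<dots> \<le> \<bar>of_int u * slope + of_int v\<bar> * (1 / real Q)"
    unfolding abs_mult using eta eta_upper by (intro mult_left_mono) auto
  finally have "c ^ 2 / m / real Q * real Q \<le> \<bar>of_int u * slope + of_int v\<bar> * (1 / real Q) * real Q"
    using Q0 by (intro mult_right_mono) auto
  then show ?thesis unfolding m_def[symmetric] using Q by simp
qed

text \<open>For w = uQ + vq and t = uP + vp the number w\<theta> - t = v\<eta> - u\<eta>' is of
  order 1/Q. Bad approximability then makes |w| at least of order Q, unless w = 0; but w = 0 gives
  |t| < 1, so t = 0, and the determinant forces u = v = 0.\<close>

lemma exponent_separation: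
  assumes ne: "u \<noteq> 0 \<or> v \<noteq> 0" and large: "of_int (\<bar>u\<bar> + \<bar>v\<bar>) < c * real Q"
  shows "c ^ 2 / of_int (\<bar>u\<bar> + \<bar>v\<bar>) * real Q \<le> \<bar>of_int (u * int Q + v * int q)\<bar>"
proof -
  define w where "w = u * int Q + v * int q"
  define t where "t = u * P + v * p"
  define m where "m = real_of_int (\<bar>u\<bar> + \<bar>v\<bar>)"
  have m: "1 \<le> m" using ne unfolding m_def by linarith
  have Q0: "real Q > 0" using Q by simp
  have "of_int w * \<theta> - of_int t = of_int v * \<eta> - of_int u * \<eta>'"
    by (simp add: w_def t_def \<eta>_def \<eta>'_def algebra_simps)
  then have "\<bar>of_int w * \<theta> - of_int t\<bar> \<le> \<bar>of_int v\<bar> * \<eta> + \<bar>of_int u\<bar> * \<eta>'"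
    using abs_triangle_ineq4[of "of_int v * \<eta>" "of_int u * \<eta>'"] eta by (simp add: abs_mult)
  also have "\<dots> \<le> \<bar>of_int v\<bar> * (1 / (c * real Q)) + \<bar>of_int u\<bar> * (1 / (c * real Q))"
  proof (intro add_mono mult_left_mono)
    have "1 / real Q \<le> 1 / (c * real Q)" using c_pos c_le Q0 by (intro divide_left_mono) (auto simp: mult_left_le_one_le)
    then show "\<eta> \<le> 1 / (c * real Q)" using eta_upper by linarith
    have "1 / real q \<le> 1 / (c * real Q)" using qQ(1) c_pos Q0 q by (intro divide_left_mono) auto
    then show "\<eta>' \<le> 1 / (c * real Q)" using eta_upper by linarith
  qed auto
  also have "\<dots> = m / (c * real Q)" by (simp add: m_def add_divide_distrib)
  finally have up: "\<bar>of_int w * \<theta> - of_int t\<bar> \<le> m / (c * real Q)" .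
  have lt1: "m / (c * real Q) < 1" using large c_pos Q0 by (simp add: m_def divide_less_eq)
  show ?thesis
  proof (cases "w = 0")
    case True
    then have "\<bar>real_of_int t\<bar> < 1" using up lt1 by simp
    then have t0: "t = 0" by linarith
    have uu: "u = t * int q - w * p" and "v = w * P - t * int Q"
    proof -
      have "t * int q - w * p = u * (P * int q - p * int Q)" by (simp add: w_def t_def algebra_simps)
      then show "u = t * int q - w * p" by (simp add: det)
      have "w * P - t * int Q = v * (P * int q - p * int Q)" by (simp add: w_def t_def algebra_simps)
      then show "v = w * P - t * int Q" by (simp add: det)
    qed
    then show ?thesis using ne True t0 by simp
  next
    case False
    have "c / \<bar>of_int w\<bar> \<le> m / (c * real Q)" using bad_lower[OF False, of t] up by linarith
    then have "c * (c * real Q) \<le> m * \<bar>of_int w\<bar>" using False c_pos Q0 by (simp add: divide_le_eq pos_le_divide_eq field_simps)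
    then show ?thesis unfolding m_def[symmetric] w_def[symmetric] using m
      by (simp add: divide_le_eq power2_eq_square mult_ac)
  qed
qed

end

section \<open>The dominant monomial\<close>

text \<open>The constant depends on the growth data of E only, and linearly on M, so it serves all
  neighbour pairs. With vanishing first N coefficients it bounds the whole value.\<close>

lemma eval_fps_tail:
  fixes r :: real
  assumes r: "0 \<le> r" "r < 1"
  obtains C where "0 \<le> C"
    "\<And>M E y X. bdf M e B m E \<Longrightarrow> norm y \<le> 1 \<Longrightarrow> norm X \<le> r \<Longrightarrow>
       norm (eval_fps (fev y E) X - (\<Sum>i<N. poly (fps_nth E i) y * X ^ i)) \<le> M * C * norm X ^ N"
proof -
  define h where "h i = (real i + 1) ^ (e + 1) * r ^ i" for i
  have h: "summable h" "\<And>i. 0 \<le> h i" unfolding h_def by (rule summable_poly_power[OF r]) (use r in simp)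
  define C where "C = real (B + m + 1) * (real N + 1) ^ (e + 1) * suminf h"
  have C: "0 \<le> C" unfolding C_def using suminf_nonneg[OF h] by (intro mult_nonneg_nonneg) auto
  show thesis
  proof (rule that[OF C])
    fix M :: real and E :: "complex poly fps" and y X :: complex
    assume E: "bdf M e B m E" and y: "norm y \<le> 1" and X: "norm X \<le> r"
    have M: "0 \<le> M" by (rule bdf_nonneg[OF E])
    define f where "f i = poly (fps_nth E i) y * X ^ i" for i
    define R where "R = M * real (B + m + 1) * (real N + 1) ^ (e + 1) * norm X ^ N"
    have R: "0 \<le> R" using M by (simp add: R_def)
    have fb: "norm (f (i + N)) \<le> R * h i" for i
    proof -
      have "real (i + N) + 1 \<le> (real N + 1) * (real i + 1)" by (simp add: algebra_simps)
      then have "(real (i + N) + 1) ^ (e + 1) \<le> ((real N + 1) * (real i + 1)) ^ (e + 1)" by (intro power_mono) auto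
      then have "M * real (B + m + 1) * (real (i + N) + 1) ^ (e + 1) \<le> M * real (B + m + 1) * ((real N + 1) * (real i + 1)) ^ (e + 1)"
        using M by (intro mult_left_mono) auto
      then have 1: "norm (poly (fps_nth E (i + N)) y) \<le> M * real (B + m + 1) * ((real N + 1) * (real i + 1)) ^ (e + 1)"
        using poly_bdf_bound[OF E y, of "i + N"] by linarith
      have 2: "norm X ^ (i + N) \<le> r ^ i * norm X ^ N"
        unfolding power_add using X by (intro mult_right_mono power_mono) auto
      have "norm (f (i + N)) = norm (poly (fps_nth E (i + N)) y) * norm X ^ (i + N)"
        by (simp add: f_def norm_mult norm_power)
      also have "\<dots> \<le> (M * real (B + m + 1) * ((real N + 1) * (real i + 1)) ^ (e + 1)) * (r ^ i * norm X ^ N)"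
        using 1 2 M r by (intro mult_mono) auto
      also have "\<dots> = R * h i" unfolding R_def h_def power_mult_distrib by (simp only: mult_ac)
      finally show ?thesis .
    qed
    have sn: "summable (\<lambda>i. norm (f (i + N)))"
      by (rule summable_comparison_test[OF _ summable_mult[OF h(1), of R]]) (use fb in auto)
    then have "summable (\<lambda>i. f (i + N))" by (rule summable_norm_cancel)
    then have "summable f" by (simp only: summable_iff_shift)
    then have "suminf f = (\<Sum>i. f (i + N)) + (\<Sum>i<N. f i)" by (rule suminf_split_initial_segment)
    moreover have "eval_fps (fev y E) X = suminf f" by (simp add: eval_fps_def f_def[abs_def])
    ultimately have "eval_fps (fev y E) X - (\<Sum>i<N. f i) = (\<Sum>i. f (i + N))" by simp
    also have "norm \<dots> \<le> (\<Sum>i. norm (f (i + N)))" by (rule summable_norm[OF sn])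
    also have "\<dots> \<le> (\<Sum>i. R * h i)" by (intro suminf_le fb sn summable_mult h)
    also have "\<dots> = R * suminf h" by (rule suminf_mult[OF h(1)])
    also have "\<dots> = M * C * norm X ^ N" unfolding R_def C_def by (simp only: mult_ac)
    finally show "norm (eval_fps (fev y E) X - (\<Sum>i<N. poly (fps_nth E i) y * X ^ i)) \<le> M * C * norm X ^ N"
      unfolding f_def .
  qed
qed

text \<open>
  As \<open>q \<le> B * Q\<close>, monomials with \<open>i > A\<close> are smaller than the one at \<open>(i0, j0)\<close>. Among the remaining
  finitely many, the exponents \<open>i * Q + j * q\<close> differ by at least \<open>\<delta> * Q\<close>, so the least one dominates.
\<close>
lemma leading_monomial_nonzero:
  fixes x :: complex and i0 j0 B m :: nat
  defines "A \<equiv> i0 + B * j0"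
  defines "J \<equiv> B * A + m"
  assumes x: "0 < norm x" "norm x < 1" and delta: "0 < \<delta>" "\<delta> \<le> 1"
  obtains C where "0 \<le> C"
    "\<And>M E Q q. bdf M e B m E \<Longrightarrow> (\<And>i j. coeff (fps_nth E i) j \<in> \<int>) \<Longrightarrow> coeff (fps_nth E i0) j0 \<noteq> 0 \<Longrightarrow>
       1 \<le> Q \<Longrightarrow> q \<le> B * Q \<Longrightarrow>
       (\<And>u v :: int. u \<noteq> 0 \<or> v \<noteq> 0 \<Longrightarrow> \<bar>u\<bar> \<le> int A \<Longrightarrow> \<bar>v\<bar> \<le> int J \<Longrightarrow> \<delta> * real Q \<le> \<bar>of_int (u * int Q + v * int q)\<bar>) \<Longrightarrow>
       M * C * (norm x powr \<delta>) ^ Q < 1 \<Longrightarrow> eval_fps (fev (x ^ q) E) (x ^ Q) \<noteq> 0"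
proof -
  define r where "r = norm x"
  have r: "0 < r" "r < 1" using x by (auto simp: r_def)
  obtain C8 where C8: "0 \<le> C8"
    "\<And>M E y X. bdf M e B m E \<Longrightarrow> norm y \<le> 1 \<Longrightarrow> norm X \<le> r \<Longrightarrow>
       norm (eval_fps (fev y E) X - (\<Sum>i<A + 1. poly (fps_nth E i) y * X ^ i)) \<le> M * C8 * norm X ^ (A + 1)"
  proof (rule eval_fps_tail[of r e B m "A + 1"])
    show "0 \<le> r" "r < 1" using r by auto
    show thesis if "0 \<le> C" "\<And>M E y X. bdf M e B m E \<Longrightarrow> norm y \<le> 1 \<Longrightarrow> norm X \<le> r \<Longrightarrow>
       norm (eval_fps (fev y E) X - (\<Sum>i<A + 1. poly (fps_nth E i) y * X ^ i)) \<le> M * C * norm X ^ (A + 1)"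
      "\<And>C8. 0 \<le> C8 \<Longrightarrow> (\<And>M E y X. bdf M e B m E \<Longrightarrow> norm y \<le> 1 \<Longrightarrow> norm X \<le> r \<Longrightarrow>
       norm (eval_fps (fev y E) X - (\<Sum>i<A + 1. poly (fps_nth E i) y * X ^ i)) \<le> M * C8 * norm X ^ (A + 1)) \<Longrightarrow> thesis" for C
      by (rule that(3)[OF that(1)]) (rule that(2))
  qed
  define I where "I = {..A} \<times> {..J}"
  have finI: "finite I" by (simp add: I_def)
  define C where "C = real (card I) * (real A + 1) ^ e + C8"
  have C: "0 \<le> C" using C8(1) by (simp add: C_def)
  show thesis
  proof (rule that[OF C])
    fix M E Q q
    assume E: "bdf M e B m E" and int: "\<And>i j. coeff (fps_nth E i) j \<in> \<int>" and nz: "coeff (fps_nth E i0) j0 \<noteq> 0"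
      and Q: "1 \<le> Q" and qB: "q \<le> B * Q"
      and sep: "\<And>u v :: int. u \<noteq> 0 \<or> v \<noteq> 0 \<Longrightarrow> \<bar>u\<bar> \<le> int A \<Longrightarrow> \<bar>v\<bar> \<le> int J \<Longrightarrow> \<delta> * real Q \<le> \<bar>of_int (u * int Q + v * int q)\<bar>"
      and small: "M * C * (norm x powr \<delta>) ^ Q < 1"
    have M: "0 \<le> M" by (rule bdf_nonneg[OF E])
    define g where "g z = coeff (fps_nth E (fst z)) (snd z)" for z
    define om where "om z = fst z * Q + snd z * q" for z
    define rd where "rd = r powr (\<delta> * real Q)"
    have rd: "0 \<le> rd" by (simp add: rd_def)
    have rdp: "(norm x powr \<delta>) ^ Q = rd" unfolding rd_def r_def using x by (simp add: powr_power mult.commute)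
    have gap: "r ^ n \<le> r ^ n' * rd" if "real n' + \<delta> * real Q \<le> real n" for n n'
    proof -
      have "r ^ n = r powr real n" using r by (simp add: powr_realpow)
      also have "\<dots> \<le> r powr (real n' + \<delta> * real Q)" using that r by (intro powr_mono') auto
      also have "\<dots> = r ^ n' * rd" using r by (simp add: powr_add powr_realpow rd_def)
      finally show ?thesis .
    qed
    define S where "S = {z \<in> I. g z \<noteq> 0}"
    have finS: "finite S" using finI by (simp add: S_def)
    have j0: "j0 \<le> B * i0 + m" using E nz unfolding bdf_def by (meson not_le)
    have "B * i0 \<le> B * A" unfolding A_def by simp
    then have "j0 \<le> J" unfolding J_def using j0 by linarith
    moreover have "i0 \<le> A" by (simp add: A_def)
    ultimately have z0: "(i0, j0) \<in> S" using nz by (simp add: S_def I_def g_def)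
    define w1 where "w1 = Min (om ` S)"
    have "w1 \<in> om ` S" unfolding w1_def using finS z0 by (intro Min_in) auto
    then obtain z1 where z1: "z1 \<in> S" "om z1 = w1" by auto
    have w1_le: "w1 \<le> om z" if "z \<in> S" for z unfolding w1_def using finS that by simp
    \<comment> \<open>The origin of A = i0 + B * j0: the exponent of the known nonzero coefficient,
      and hence the least exponent, is at most A * Q.\<close>
    have "j0 * q \<le> j0 * (B * Q)" using qB by (rule mult_le_mono2)
    then have "om (i0, j0) \<le> A * Q" unfolding om_def A_def by (simp add: algebra_simps)
    then have w1A: "w1 \<le> A * Q" using w1_le[OF z0] by linarith
    have sepS: "real w1 + \<delta> * real Q \<le> real (om z)" if z: "z \<in> S" "z \<noteq> z1" for z
    proof -
      define u where "u = int (fst z) - int (fst z1)"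
      define v where "v = int (snd z) - int (snd z1)"
      have "u \<noteq> 0 \<or> v \<noteq> 0" using z(2) unfolding u_def v_def by (auto simp: prod_eq_iff)
      moreover have "\<bar>u\<bar> \<le> int A" "\<bar>v\<bar> \<le> int J" using z(1) z1(1) unfolding u_def v_def S_def I_def by auto
      ultimately have "\<delta> * real Q \<le> \<bar>of_int (u * int Q + v * int q)\<bar>" by (rule sep)
      also have "u * int Q + v * int q = int (om z) - int (om z1)" by (simp add: u_def v_def om_def algebra_simps)
      finally show ?thesis using w1_le[OF z(1)] z1(2) by simp
    qed
    define T where "T z = g z * x ^ om z" for z
    have gb: "norm (g z) \<le> M * (real A + 1) ^ e" if "z \<in> I" for z
    proof -
      have "norm (g z) \<le> M * (real (fst z) + 1) ^ e" unfolding g_def using E by (simp add: bdf_def)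
      also have "\<dots> \<le> M * (real A + 1) ^ e" using that M by (intro mult_left_mono power_mono) (auto simp: I_def)
      finally show ?thesis .
    qed
    have poly_eq: "poly (fps_nth E i) (x ^ q) * (x ^ Q) ^ i = (\<Sum>j\<le>J. T (i, j))" if "i \<le> A" for i
    proof -
      have "degree (fps_nth E i) \<le> B * i + m" by (rule degree_le) (use E in \<open>auto simp: bdf_def\<close>)
      also have "B * i + m \<le> J" unfolding J_def using that by simp
      finally have "poly (fps_nth E i) (x ^ q) = (\<Sum>j\<le>J. coeff (fps_nth E i) j * (x ^ q) ^ j)"
        using poly_as_sum_of_monoms'[of "fps_nth E i" J] by (metis (no_types, lifting) poly_monom poly_sum sum.cong)
      then show ?thesis
        by (simp add: T_def g_def om_def sum_distrib_right sum_distrib_left power_add power_mult[symmetric] mult_ac)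
    qed
    have "(\<Sum>i<A + 1. poly (fps_nth E i) (x ^ q) * (x ^ Q) ^ i) = (\<Sum>i\<le>A. \<Sum>j\<le>J. T (i, j))"
      by (rule sum.cong) (auto simp: poly_eq)
    also have "\<dots> = (\<Sum>z\<in>I. T z)" unfolding I_def by (simp add: sum.cartesian_product)
    also have "\<dots> = (\<Sum>z\<in>S. T z)" unfolding S_def using finI by (intro sum.mono_neutral_right) (auto simp: T_def)
    also have "\<dots> = T z1 + (\<Sum>z\<in>S - {z1}. T z)" using finS z1 by (simp add: sum.remove)
    finally have main: "(\<Sum>i<A + 1. poly (fps_nth E i) (x ^ q) * (x ^ Q) ^ i) = T z1 + (\<Sum>z\<in>S - {z1}. T z)" .
    have rest: "norm (\<Sum>z\<in>S - {z1}. T z) \<le> real (card I) * (M * (real A + 1) ^ e * (r ^ w1 * rd))"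
    proof -
      have "norm (\<Sum>z\<in>S - {z1}. T z) \<le> (\<Sum>z\<in>S - {z1}. M * (real A + 1) ^ e * (r ^ w1 * rd))"
      proof (rule sum_norm_le)
        fix z assume z: "z \<in> S - {z1}"
        have "norm (g z) * r ^ om z \<le> M * (real A + 1) ^ e * (r ^ w1 * rd)"
          using z gb[of z] gap[OF sepS[of z]] M r by (intro mult_mono) (auto simp: S_def)
        then show "norm (T z) \<le> M * (real A + 1) ^ e * (r ^ w1 * rd)" by (simp add: T_def norm_mult norm_power r_def)
      qed
      also have "\<dots> = real (card (S - {z1})) * (M * (real A + 1) ^ e * (r ^ w1 * rd))" by simp
      also have "\<dots> \<le> real (card I) * (M * (real A + 1) ^ e * (r ^ w1 * rd))"
      proof (rule mult_right_mono)
        have "card (S - {z1}) \<le> card I" using finI by (intro card_mono) (auto simp: S_def)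
        then show "real (card (S - {z1})) \<le> real (card I)" by simp
        show "0 \<le> M * (real A + 1) ^ e * (r ^ w1 * rd)" using M r rd by (intro mult_nonneg_nonneg) auto
      qed
      finally show ?thesis .
    qed
    have tail: "norm (eval_fps (fev (x ^ q) E) (x ^ Q) - (T z1 + (\<Sum>z\<in>S - {z1}. T z))) \<le> M * C8 * (r ^ w1 * rd)"
    proof -
      have "norm (x ^ q) \<le> 1" unfolding norm_power using x by (intro power_le_one) auto
      moreover have "norm (x ^ Q) \<le> r"
      proof -
        have "r ^ Q \<le> r ^ 1" using r Q by (intro power_decreasing) auto
        then show ?thesis by (simp add: norm_power r_def)
      qed
      ultimately have "norm (eval_fps (fev (x ^ q) E) (x ^ Q) - (T z1 + (\<Sum>z\<in>S - {z1}. T z))) \<le> M * C8 * norm (x ^ Q) ^ (A + 1)"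
        unfolding main[symmetric] by (rule C8(2)[OF E])
      also have "norm (x ^ Q) ^ (A + 1) = r ^ (Q * (A + 1))" by (simp only: norm_power r_def power_mult)
      also have "M * C8 * r ^ (Q * (A + 1)) \<le> M * C8 * (r ^ w1 * rd)"
      proof (intro mult_left_mono gap)
        have "\<delta> * real Q \<le> 1 * real Q" using delta by (intro mult_right_mono) auto
        moreover have "real w1 \<le> real A * real Q" using w1A by (simp flip: of_nat_mult)
        ultimately show "real w1 + \<delta> * real Q \<le> real (Q * (A + 1))" by (simp add: algebra_simps)
      qed (use M C8 in auto)
      finally show ?thesis .
    qed
    \<comment> \<open>Integrality keeps the leading coefficient away from 0, although the other
      coefficients may be as large as a multiple of M.\<close>
    have lead: "r ^ w1 \<le> norm (T z1)"
    proof -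
      have "g z1 \<in> \<int>" "g z1 \<noteq> 0" using int z1 by (auto simp: g_def S_def)
      then obtain n where n: "g z1 = of_int n" "n \<noteq> 0" by (auto elim: Ints_cases)
      then have "1 \<le> \<bar>n\<bar>" by linarith
      then have "(1 :: real) \<le> of_int \<bar>n\<bar>" by (simp only: of_int_1_le_iff)
      then have "1 \<le> norm (g z1)" using n(1) by simp
      then have "1 * r ^ w1 \<le> norm (g z1) * r ^ w1" using r by (intro mult_right_mono) auto
      then show ?thesis using z1(2) by (simp add: T_def norm_mult norm_power r_def)
    qed
    show "eval_fps (fev (x ^ q) E) (x ^ Q) \<noteq> 0"
    proof
      assume "eval_fps (fev (x ^ q) E) (x ^ Q) = 0"
      then have t0: "norm (T z1 + (\<Sum>z\<in>S - {z1}. T z)) \<le> M * C8 * (r ^ w1 * rd)"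
        using tail by (simp only: diff_0 norm_minus_cancel)
      have "norm (T z1) \<le> norm (T z1 + (\<Sum>z\<in>S - {z1}. T z)) + norm (\<Sum>z\<in>S - {z1}. T z)"
        using norm_triangle_ineq4[of "T z1 + (\<Sum>z\<in>S - {z1}. T z)" "\<Sum>z\<in>S - {z1}. T z"] by simp
      then have "r ^ w1 \<le> M * C8 * (r ^ w1 * rd) + real (card I) * (M * (real A + 1) ^ e * (r ^ w1 * rd))"
        using t0 rest lead by linarith
      also have "\<dots> = r ^ w1 * (M * C * rd)" by (simp add: C_def algebra_simps)
      also have "\<dots> < r ^ w1 * 1" using small r unfolding rdp by (intro mult_strict_left_mono) auto
      finally show False by simp
    qed
  qed
qed

section \<open>Integrality, scaling and uniform data of neighbour pairs\<close>

lemma bdf_sum: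
  assumes "finite A" "\<And>z. z \<in> A \<Longrightarrow> bdf K e B m (F z)" "0 \<le> K"
  shows "bdf (real (card A) * K) e B m (\<Sum>z\<in>A. F z)"
  unfolding bdf_def
proof (intro allI conjI impI)
  fix i j
  have "norm (coeff (fps_nth (\<Sum>z\<in>A. F z) i) j) \<le> (\<Sum>z\<in>A. K * (real i + 1) ^ e)"
    unfolding fps_sum_nth coeff_sum using assms(2) by (intro sum_norm_le) (auto simp: bdf_def)
  then show "norm (coeff (fps_nth (\<Sum>z\<in>A. F z) i) j) \<le> real (card A) * K * (real i + 1) ^ e" by simp
  assume "B * i + m < j"
  then show "coeff (fps_nth (\<Sum>z\<in>A. F z) i) j = 0"
    unfolding fps_sum_nth coeff_sum using assms(2) by (intro sum.neutral) (auto simp: bdf_def)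
qed

lemma bdf_const_mult:
  assumes "bdf K e B m F"
  shows "bdf (norm c * K) e B m (fps_const [:c:] * F)"
  using assms unfolding bdf_def by (auto simp: norm_mult mult.assoc mult_left_mono)

definition intf :: "complex poly fps \<Rightarrow> bool" where
  "intf F \<longleftrightarrow> (\<forall>i j. coeff (fps_nth F i) j \<in> \<int>)"

lemma intf_mult: "intf F \<Longrightarrow> intf G \<Longrightarrow> intf (F * G)"
  unfolding intf_def coeff_fps_mult by (intro allI Ints_sum Ints_mult) blast+

lemma intf_1: "intf 1"
  by (auto simp: intf_def coeff_1)

lemma intf_power: "intf F \<Longrightarrow> intf (F ^ t)"
proof (induction t)
  case 0
  show ?case unfolding power_0 by (rule intf_1)
next
  case (Suc t)
  show ?case unfolding power_Suc by (rule intf_mult[OF Suc.prems Suc.IH[OF Suc.prems]])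
qed

lemma intf_Phi:
  assumes "intf G"
  shows "intf (Phi G z)"
proof -
  have base: "intf (fps_X ^ a * fps_const (monom 1 b))" for a b
    by (auto simp: intf_def fps_X_power_mult_nth)
  show ?thesis unfolding Phi_def case_prod_unfold by (rule intf_mult[OF base intf_power[OF assms]])
qed

lemma intf_combo:
  assumes "intf G" "\<And>z. z \<in> A \<Longrightarrow> c z \<in> \<int>"
  shows "intf (combo G A c)"
proof -
  have "intf (fps_const [:c z:] * Phi G z)" if "z \<in> A" for z
  proof (rule intf_mult[OF _ intf_Phi[OF assms(1)]])
    have "coeff [:c z:] j \<in> \<int>" for j using assms(2)[OF that] by (cases j) auto
    then show "intf (fps_const [:c z:])" by (simp add: intf_def)
  qed
  then show ?thesis unfolding combo_def intf_def fps_sum_nth coeff_sum by (intro allI Ints_sum) blast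
qed

lemma const_mult_pCons: "fps_const [:a:] * fps_const [:b:] = fps_const [:a * b :: complex:]"
  by simp

lemma Phi_scale: "Phi (fps_const [:s:] * G) z = fps_const [:s ^ snd (snd z):] * Phi G z"
proof -
  have p: "[:s:] ^ t = [:s ^ t:]" for t by (induction t) (auto simp: mult.commute)
  show ?thesis unfolding Phi_def case_prod_unfold power_mult_distrib fps_const_power p by (simp only: mult_ac)
qed

text \<open>Passage between the integral series, needed for Siegel's lemma, and the normalised one,
  needed for compactness: scaling the series by s multiplies the coefficient of its t-th power by
  s^t.\<close>

lemma combo_scale:
  assumes "N \<noteq> 0"
  shows "combo (fps_const [:s:] * G) A c = fps_const [:N:] * combo G A (\<lambda>z. c z * s ^ snd (snd z) / N)"
  unfolding combo_def sum_distrib_left Phi_scale mult.assoc[symmetric] const_mult_pCons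
  using assms by simp

context hecke_mahler
begin

text \<open>
  \<open>th\<close> and \<open>kap\<close> are slope and intercept of the sequence of exponents \<open>b\<close>, \<open>m\<close> is the first
  mismatch, and \<open>l\<close> is the leading coefficient of the difference of \<open>f\<close>, which fixes the argument of the
  constant coefficients of the \<open>w i\<close>.
\<close>
definition pair_data ::
  "real \<Rightarrow> real \<Rightarrow> real \<Rightarrow> nat \<Rightarrow> complex \<Rightarrow> nat \<Rightarrow> real \<Rightarrow> nat \<times> nat \<times> nat \<times> real \<times> real \<times> (nat \<Rightarrow> nat) \<times> (nat \<Rightarrow> complex poly) \<Rightarrow> bool" where
  "pair_data c K cp e l L A = (\<lambda>(Q, q, m, th, kap, b, w).
     1 \<le> Q \<and> 1 \<le> q \<and> c * real q \<le> real Q \<and> real m \<le> A * real Q \<and>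
     0 \<le> th \<and> th \<le> 1 / c \<and> 0 \<le> kap \<and> kap \<le> 1 \<and>
     (\<forall>i. real i * th + kap - 1 \<le> real (b i)) \<and> (\<forall>i. real (b i) \<le> real i * th + kap) \<and>
     (\<forall>i. degree (w i) \<le> degree f) \<and> (\<forall>i j. coeff (w i) j \<in> \<int>) \<and>
     (\<forall>i j. norm (coeff (w i) j) \<le> K * real Q ^ e * (real i + 1) ^ e) \<and>
     (\<forall>i. cp * real Q ^ e \<le> Re (coeff (w i) 0 / l)) \<and>
     (\<forall>u v. u \<noteq> 0 \<longrightarrow> c ^ 2 / of_int (\<bar>u\<bar> + \<bar>v\<bar>) \<le> \<bar>of_int u * th + of_int v\<bar>) \<and>
     (\<forall>u v. (u \<noteq> 0 \<or> v \<noteq> 0) \<and> of_int (\<bar>u\<bar> + \<bar>v\<bar>) < c * real Q \<longrightarrow>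
        c ^ 2 / of_int (\<bar>u\<bar> + \<bar>v\<bar>) * real Q \<le> \<bar>of_int (u * int Q + v * int q)\<bar>) \<and>
     \<beta> ^ (q * degree f) * (x ^ m * eval_fps (fev (x ^ q) (Abs_fps (\<lambda>i. monom 1 (b i) * w i))) (x ^ Q)) \<in> Z (L * q))"

text \<open>All constants are fixed before the pair is chosen, so the estimates are uniform while Q
  becomes arbitrarily large.\<close>

lemma pair_data_exists:
  assumes c: "badly_approximable c" "c \<le> 1"
  obtains K cp e l L A where "0 < K" "0 < cp" "1 \<le> norm l" "0 \<le> A" "l \<in> \<int>"
    "\<And>k. \<exists>d. pair_data c K cp e l L A d \<and> k \<le> fst d"
proof -
  define D where "D = degree f"
  have c0: "0 < c" using c by (simp add: badly_approximable_def)
  obtain G where G: "G \<noteq> 0" "nab 1 (poly f) = poly G" using nab_poly_nonzero[OF deg_f, of 1] by auto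
  define e where "e = degree G"
  define l where "l = complex_of_int (lead_coeff G)"
  have l: "1 \<le> norm l"
  proof -
    have "1 \<le> \<bar>lead_coeff G\<bar>" using G(1) leading_coeff_0_iff[of G] by linarith
    then have "(1 :: real) \<le> of_int \<bar>lead_coeff G\<bar>" by (simp only: of_int_1_le_iff)
    then show ?thesis by (simp add: l_def)
  qed
  obtain y0 C where yC: "y0 \<ge> 1" "C > 0"
    "\<And>p y j. y0 \<le> y \<Longrightarrow> 0 \<le> p \<Longrightarrow> p \<le> y \<Longrightarrow> norm (coeff (wpoly D p (poly G) y) j) \<le> C * real_of_int y ^ e"
    "\<And>p y. y0 \<le> y \<Longrightarrow> Re (coeff (wpoly D p (poly G) y) 0 / l) \<ge> real_of_int y ^ e / 2"
    unfolding e_def l_def by (fact wpoly_bounds[OF G(1), of D])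
  obtain L where L: "\<And>q p \<sigma> Mis. word_shift s x q p \<sigma> Mis \<Longrightarrow> 0 \<le> p \<Longrightarrow> p \<le> int q \<Longrightarrow> 1 \<le> q \<Longrightarrow>
    \<beta> ^ (q * degree f) * (\<Sum>n. (if n \<in> Mis then poly (wpoly (degree f) p (nab \<sigma> (poly f)) (s n + p)) (x ^ q) else 0) * x ^ n)
      \<in> Z (L * q)" by (fact Z_mismatch_sum)
  \<comment> \<open>\<open>C4\<close> and \<open>A\<close> come from q <= Q/c, slope + 1 <= 2/c and
    \<open>first_mis_bound\<close>: the first mismatch is at most A * Q, and the i-th argument y is
    at most C4 * (i + 1) * Q.\<close>
  define C4 where "C4 = 4 / c ^ 2 + 1"
  have C4: "C4 > 0" using c0 by (simp add: C4_def add_pos_pos)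
  define A where "A = 1 + 2 / c ^ 2"
  define K where "K = C * C4 ^ e"
  define cp where "cp = (c * \<theta> / 2) ^ e / 2"
  have cle: "1 / c \<le> 1 / c ^ 2" "1 \<le> 1 / c"
    using c0 c(2) by (auto simp: power2_eq_square field_simps mult_left_le_one_le)
  show thesis
  proof (rule that[of K cp l A e L])
    show "0 < K" "0 < cp" "1 \<le> norm l" "0 \<le> A" "l \<in> \<int>"
      using yC C4 c0 theta l by (auto simp: K_def cp_def A_def l_def)
    fix k :: nat
    \<comment> \<open>Q >= Q0 gives both Q >= k and p >= y0, so that the bounds for
      \<open>wpoly\<close> apply to all mismatches. It follows from q + Q >= N because q + Q <= Q (1
      + 1/c).\<close>
    define Q0 where "Q0 = real k + (real_of_int y0 + 2) / (c * \<theta>)"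
    obtain N :: nat where N: "Q0 * (1 + 1 / c) \<le> real N" using real_arch_simple by blast
    obtain q Q p P where pr: "unimodular_pair \<theta> \<alpha> q Q p P" and qN: "N \<le> q + Q" using farey_pairs[of N] by blast
    interpret unimodular_pair \<theta> \<alpha> q Q p P by (rule pr)
    interpret bad_pair \<theta> \<alpha> q Q p P c by unfold_locales (use c in auto)
    have Q1: "1 \<le> real Q" using Q by simp
    have q_le: "real q \<le> real Q / c" using qQ(2) c0 by (simp add: le_divide_eq mult.commute)
    have "real N \<le> real q + real Q" using qN by (simp flip: of_nat_add)
    also have "\<dots> \<le> real Q * (1 + 1 / c)" using q_le by (simp add: algebra_simps)
    finally have "Q0 * (1 + 1 / c) \<le> real Q * (1 + 1 / c)" using N by linarith
    then have QQ0: "Q0 \<le> real Q" using c0 by (simp add: mult_le_cancel_right add_pos_pos)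
    have yy: "0 \<le> (real_of_int y0 + 2) / (c * \<theta>)" using yC(1) c0 theta by simp
    have kQ: "k \<le> Q" using QQ0 yy unfolding Q0_def by linarith
    have "(real_of_int y0 + 2) / (c * \<theta>) \<le> real Q" using QQ0 unfolding Q0_def by linarith
    then have "real_of_int y0 + 2 \<le> real Q * (c * \<theta>)" using c0 theta by (simp add: divide_le_eq)
    moreover have "(c * real Q) * \<theta> \<le> real q * \<theta>" using qQ(1) theta by (intro mult_right_mono) auto
    moreover have "real q * \<theta> - 1 < of_int p" using eta_bounds by (simp add: \<eta>_def)
    ultimately have p_low: "real_of_int y0 + 1 < of_int p" "c * \<theta> / 2 * real Q \<le> of_int p"
      using yC(1) by (auto simp: algebra_simps)
    define y where "y i = s (mis_enum i) + p" for i
    have y: "y0 \<le> y i" "p \<le> y i" "c * \<theta> / 2 * real Q \<le> real_of_int (y i)" for i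
    proof -
      show py: "p \<le> y i" using s_range(1)[of "mis_enum i"] by (simp add: y_def)
      then have "real_of_int p \<le> real_of_int (y i)" by simp
      then show "c * \<theta> / 2 * real Q \<le> real_of_int (y i)" using p_low by linarith
      show "y0 \<le> y i" using py p_low by linarith
    qed
    have m_le: "real first_mis \<le> A * real Q"
    proof -
      have "(slope + 1) * real q \<le> (1 / c + 1 / c) * (real Q / c)"
        using slope_le cle q_le c0 slope_pos by (intro mult_mono add_mono) auto
      also have "\<dots> = 2 / c ^ 2 * real Q" by (simp add: power2_eq_square)
      finally show ?thesis using first_mis_bound by (simp add: A_def algebra_simps)
    qed
    have y_up: "real_of_int (y i) \<le> C4 * (real i + 1) * real Q" for i
    proof -
      have "real_of_int (s (mis_enum i)) \<le> real_of_int (int (mis_enum i))" using s_range(2)[of "mis_enum i"] by (simp only: of_int_le_iff)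
      moreover have "real_of_int p \<le> real_of_int (int q)" using p_range(2) by (simp only: of_int_le_iff)
      ultimately have "real_of_int (y i) \<le> real first_mis + real i * real Q + real (bexp i) * real q + real q"
        by (simp add: y_def mis_enum_def)
      also have "\<dots> \<le> A * real Q + real i * real Q + (real i * (1 / c) + 1) * (real Q / c) + real Q / c"
      proof (intro add_mono mult_mono m_le q_le order_refl)
        have "real i * slope \<le> real i * (1 / c)" using slope_le by (intro mult_left_mono) auto
        then show "real (bexp i) \<le> real i * (1 / c) + 1" using bexp_bounds(2)[of i] offset by linarith
      qed (use c0 in auto)
      also have "\<dots> = (A + real i + real i / c ^ 2 + 2 * (1 / c)) * real Q"
        by (simp add: algebra_simps power2_eq_square)
      also have "\<dots> \<le> (C4 * (real i + 1)) * real Q"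
      proof (rule mult_right_mono)
        define t where "t = 1 / c ^ 2"
        have t: "1 / c \<le> t" "A = 1 + 2 * t" "C4 = 4 * t + 1" "real i / c ^ 2 = real i * t"
          using cle(1) by (simp_all add: t_def A_def C4_def)
        have "0 \<le> real i * t" by (simp add: t_def)
        then show "A + real i + real i / c ^ 2 + 2 * (1 / c) \<le> C4 * (real i + 1)"
          unfolding t(2-4) using t(1) by argo
      qed auto
      finally show ?thesis .
    qed
    define w where "w i = wpoly D p (poly G) (y i)" for i
    have y0': "0 \<le> real_of_int (y i)" for i using y(1)[of i] yC(1) by simp
    have ws: "word_shift s x q p 1 MisU" using shift_up by unfold_locales auto
    have val: "\<beta> ^ (q * degree f) * (x ^ first_mis * eval_fps (fev (x ^ q) (Abs_fps (\<lambda>i. monom 1 (bexp i) * w i))) (x ^ Q)) \<in> Z (L * q)"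
    proof -
      define W where "W n = poly (wpoly (degree f) p (nab 1 (poly f)) (s n + p)) (x ^ q)" for n
      have "summable (\<lambda>n. (if n \<in> MisU then W n else 0) * x ^ n)"
        using word_shift.Ser_mismatch(1)[OF ws, of f] unfolding W_def .
      then have "(\<Sum>n. (if n \<in> MisU then W n else 0) * x ^ n) = x ^ first_mis * (\<Sum>i. (x ^ q) ^ bexp i * W (mis_enum i) * (x ^ Q) ^ i)"
        by (rule suminf_MisU) (rule x_nonzero)
      also have "(\<Sum>i. (x ^ q) ^ bexp i * W (mis_enum i) * (x ^ Q) ^ i) = eval_fps (fev (x ^ q) (Abs_fps (\<lambda>i. monom 1 (bexp i) * w i))) (x ^ Q)"
        unfolding eval_fps_def fev_nth fps_nth_Abs_fps poly_mult poly_monom W_def w_def y_def D_def G(2) mult_1_left ..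
      finally show ?thesis using L[OF ws p_range q] unfolding W_def by simp
    qed
    have "pair_data c K cp e l L A (Q, q, first_mis, slope, offset, bexp, w)"
      unfolding pair_data_def case_prod_conv
    proof (intro conjI allI impI)
      show "norm (coeff (w i) j) \<le> K * real Q ^ e * (real i + 1) ^ e" for i j
      proof -
        have "norm (coeff (w i) j) \<le> C * real_of_int (y i) ^ e" unfolding w_def using y p_range by (intro yC(3)) auto
        also have "\<dots> \<le> C * (C4 * (real i + 1) * real Q) ^ e" using y_up y0' yC by (intro mult_left_mono power_mono) auto
        finally show ?thesis unfolding K_def power_mult_distrib by (simp only: mult_ac)
      qed
      show "cp * real Q ^ e \<le> Re (coeff (w i) 0 / l)" for i
      proof -
        have "cp * real Q ^ e = (c * \<theta> / 2 * real Q) ^ e / 2" unfolding cp_def power_mult_distrib by simp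
        also have "\<dots> \<le> real_of_int (y i) ^ e / 2" using y(3) c0 theta by (intro divide_right_mono power_mono) auto
        also have "\<dots> \<le> Re (coeff (w i) 0 / l)" unfolding w_def using y(1) by (rule yC(4))
        finally show ?thesis .
      qed
      show "degree (w i) \<le> degree f" for i unfolding w_def D_def by (rule degree_wpoly)
      show "coeff (w i) j \<in> \<int>" for i j unfolding w_def by (rule coeff_wpoly_Ints)
      show "real i * slope + offset - 1 \<le> real (bexp i)" for i by (rule bexp_bounds)
      show "real (bexp i) \<le> real i * slope + offset" for i using bexp_bounds(2)[of i] by simp
      show "c ^ 2 / of_int (\<bar>u\<bar> + \<bar>v\<bar>) \<le> \<bar>of_int u * slope + of_int v\<bar>" if "u \<noteq> 0" for u v using that by (rule slope_indep)
      show "c ^ 2 / of_int (\<bar>u\<bar> + \<bar>v\<bar>) * real Q \<le> \<bar>of_int (u * int Q + v * int q)\<bar>"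
        if "(u \<noteq> 0 \<or> v \<noteq> 0) \<and> of_int (\<bar>u\<bar> + \<bar>v\<bar>) < c * real Q" for u v using that exponent_separation by blast
    qed (use Q q qQ(2) m_le slope_pos slope_le offset val in auto)
    then show "\<exists>d. pair_data c K cp e l L A d \<and> k \<le> fst d"
      using kQ by (intro exI[of _ "(Q, q, first_mis, slope, offset, bexp, w)"]) simp
  qed
qed

end

section \<open>The auxiliary function\<close>

text \<open>There are (d + 1)^3 unknowns against the coefficients of X^i Y^j with i < N and j <= B *
  N + d * (m + 1). Neither number depends on Q, so Siegel's lemma costs only a power of Q,
  negligible against exponentials in Q. F carries the uniform bounds, and its multiple by l * Q^e
  the integrality.\<close>

lemma auxiliary_combination:
  fixes l :: complex and K :: real and e B m d N :: nat
  defines "Box \<equiv> {..d} \<times> {..d} \<times> {..d}"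
  assumes l: "1 \<le> norm l" and count: "N * (B * N + d * (m + 1) + 1) < (d + 1) ^ 3"
  shows "\<exists>C E e1. 0 \<le> C \<and> (\<forall>Q F. 1 \<le> Q \<and> bdf K e B m F \<and> intf (fps_const [:l * of_nat Q ^ e:] * F) \<longrightarrow>
    (\<exists>c :: _ \<Rightarrow> int. (\<exists>z\<in>Box. c z \<noteq> 0) \<and> (\<forall>z\<in>Box. real_of_int \<bar>c z\<bar> \<le> C * (real Q + 1) ^ E) \<and>
       (\<forall>i<N. fps_nth (combo (fps_const [:l * of_nat Q ^ e:] * F) Box (\<lambda>z. of_int (c z))) i = 0) \<and>
       bdf (C * (real Q + 1) ^ E) e1 B (d * (m + 1)) (combo (fps_const [:l * of_nat Q ^ e:] * F) Box (\<lambda>z. of_int (c z)))))"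
proof -
  have finB: "finite Box" by (simp add: Box_def)
  have cardB: "card Box = (d + 1) ^ 3" by (simp add: Box_def power3_eq_cube)
  obtain K1 e1 where bd: "\<And>F z. bdf K e B m F \<Longrightarrow> z \<in> Box \<Longrightarrow> bdf K1 e1 B (fst (snd z) + snd (snd z) * m) (Phi F z)"
    using bdf_Phi_box[OF finB, of K e B m] by blast
  define K2 where "K2 = max K1 1"
  have K2: "1 \<le> K2" by (simp add: K2_def)
  define mm where "mm = d * (m + 1)"
  define nE where "nE = N * (B * N + mm + 1)"
  define n3 where "n3 = real ((d + 1) ^ 3)"
  have n3: "1 \<le> n3" unfolding n3_def by simp
  define C10 where "C10 = norm l ^ d * K2 * (real N + 1) ^ e1"
  define C11 where "C11 = 2 * n3 * (C10 + 2) + 1"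
  define C where "C = C11 ^ nE * n3 * norm l ^ d * K2"
  define E where "E = e * d * (nE + 1)"
  have ld: "1 \<le> norm l ^ d" using l by (rule one_le_power)
  have C10: "1 \<le> C10"
  proof -
    have "1 * 1 * 1 \<le> norm l ^ d * K2 * (real N + 1) ^ e1" using one_le_power[of "real N + 1" e1] K2
      by (intro mult_mono ld) auto
    then show ?thesis by (simp add: C10_def)
  qed
  have C11: "1 \<le> C11" using C10 n3 by (simp add: C11_def)
  have C11n: "1 \<le> C11 ^ nE" using C11 by (rule one_le_power)
  have C: "0 \<le> C" unfolding C_def using C11n n3 ld K2 by (intro mult_nonneg_nonneg) auto
  show ?thesis
  proof (rule exI[of _ C], rule exI[of _ E], rule exI[of _ e1], rule conjI[OF C], intro allI impI)
    fix Q :: nat and F :: "complex poly fps"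
    assume asm: "1 \<le> Q \<and> bdf K e B m F \<and> intf (fps_const [:l * of_nat Q ^ e:] * F)"
    define S where "S = l * of_nat Q ^ e"
    define G where "G = fps_const [:S:] * F"
    have Q: "1 \<le> real Q" and F: "bdf K e B m F" and iG: "intf G" using asm by (auto simp: G_def S_def)
    define h where "h = (real Q + 1) ^ (e * d)"
    have h: "1 \<le> h" unfolding h_def by (rule one_le_power) simp
    have normS: "norm S = norm l * real Q ^ e" by (simp add: S_def norm_mult norm_power)
    have S1: "1 \<le> norm S"
    proof -
      have "1 * 1 \<le> norm l * real Q ^ e" using l Q by (intro mult_mono one_le_power) auto
      then show ?thesis by (simp add: normS)
    qed
    have Sd: "norm S ^ d \<le> norm l ^ d * h"
    proof -
      have "norm S ^ d = norm l ^ d * real Q ^ (e * d)" by (simp add: normS power_mult_distrib power_mult)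
      also have "\<dots> \<le> norm l ^ d * (real Q + 1) ^ (e * d)" by (intro mult_left_mono power_mono) auto
      finally show ?thesis by (simp add: h_def)
    qed
    have bPhi: "bdf (norm S ^ d * K2) e1 B mm (Phi G z)" if z: "z \<in> Box" for z
    proof -
      have "bdf (norm (S ^ snd (snd z)) * K1) e1 B (fst (snd z) + snd (snd z) * m) (Phi G z)"
        unfolding G_def Phi_scale by (rule bdf_const_mult[OF bd[OF F z]])
      then show ?thesis
      proof (rule bdf_mono)
        have "norm S ^ snd (snd z) \<le> norm S ^ d" using z S1 by (intro power_increasing) (auto simp: Box_def)
        moreover have "0 \<le> K1" using bdf_nonneg[OF bd[OF F z]] .
        ultimately show "norm (S ^ snd (snd z)) * K1 \<le> norm S ^ d * K2"
          unfolding norm_power using S1 by (intro mult_mono) (auto simp: K2_def)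
        have b: "fst (snd z) \<le> d" "snd (snd z) \<le> d" using z by (auto simp: Box_def)
        have "snd (snd z) * m \<le> d * m" using b(2) by (rule mult_le_mono1)
        then show "fst (snd z) + snd (snd z) * m \<le> mm" using b(1) unfolding mm_def distrib_left by linarith
      qed simp
    qed
    define a where "a = (\<lambda>(i, j) z. \<lfloor>Re (coeff (fps_nth (Phi G z) i) j)\<rfloor>)"
    have a: "of_int (a (i, j) z) = coeff (fps_nth (Phi G z) i) j" for i j z
    proof -
      have "coeff (fps_nth (Phi G z) i) j \<in> \<int>" using intf_Phi[OF iG] by (simp add: intf_def)
      then obtain n where n: "coeff (fps_nth (Phi G z) i) j = of_int n" by (auto elim: Ints_cases)
      then show ?thesis by (simp add: a_def)
    qed
    \<comment> \<open>For i < N the Y-degree is at most B * i + mm, so these equations annihilate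
      the entire coefficient of X^i.\<close>
    define I where "I = {..<N} \<times> {..B * N + mm}"
    have finI: "finite I" and cardI: "card I = nE" by (auto simp: I_def nE_def)
    define X where "X = norm S ^ d * K2 * (real N + 1) ^ e1"
    have Xh: "X \<le> C10 * h"
    proof -
      have "X \<le> (norm l ^ d * h) * K2 * (real N + 1) ^ e1"
        unfolding X_def using Sd K2 by (intro mult_right_mono) auto
      then show ?thesis by (simp add: C10_def mult_ac)
    qed
    have X0: "0 \<le> X" unfolding X_def using K2 by (intro mult_nonneg_nonneg) auto
    define b where "b = \<lceil>X\<rceil> + 1"
    have b1: "1 \<le> b" using X0 by (simp add: b_def)
    have ab: "\<bar>a ij z\<bar> \<le> b" if ij: "ij \<in> I" and z: "z \<in> Box" for ij z
    proof -
      obtain i j where [simp]: "ij = (i, j)" by (cases ij)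
      have "norm (coeff (fps_nth (Phi G z) i) j) \<le> (norm S ^ d * K2) * (real i + 1) ^ e1"
        using bPhi[OF z] by (simp add: bdf_def)
      also have "\<dots> \<le> X" unfolding X_def using ij K2 by (intro mult_left_mono power_mono mult_nonneg_nonneg) (auto simp: I_def)
      finally have "norm (complex_of_int (a (i, j) z)) \<le> X" unfolding a .
      then have "\<bar>real_of_int (a (i, j) z)\<bar> \<le> X" by (simp only: norm_of_int of_int_abs)
      then show ?thesis unfolding b_def by simp linarith
    qed
    have card_lt: "card I < card Box" unfolding cardI cardB nE_def mm_def by (rule count)
    have "\<exists>c. (\<exists>z\<in>Box. c z \<noteq> 0) \<and> (\<forall>ij\<in>I. (\<Sum>z\<in>Box. a ij z * c z) = 0) \<and>
        (\<forall>z\<in>Box. \<bar>c z\<bar> \<le> (2 * int (card Box) * b + 1) ^ card I)"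
    proof (rule siegel_pigeonhole[of I Box b a])
      show "finite I" by (rule finI)
      show "finite Box" by (rule finB)
      show "card I < card Box" by (rule card_lt)
      show "1 \<le> b" by (rule b1)
    qed (use ab in blast)+
    then obtain c where c: "\<exists>z\<in>Box. c z \<noteq> 0" "\<And>ij. ij \<in> I \<Longrightarrow> (\<Sum>z\<in>Box. a ij z * c z) = 0"
        "\<And>z. z \<in> Box \<Longrightarrow> \<bar>c z\<bar> \<le> (2 * int (card Box) * b + 1) ^ card I"
      by blast
    have cb: "real_of_int \<bar>c z\<bar> \<le> C11 ^ nE * h ^ nE" if z: "z \<in> Box" for z
    proof -
      have "real_of_int \<bar>c z\<bar> \<le> real_of_int ((2 * int (card Box) * b + 1) ^ card I)" using c(3)[OF z] by (simp only: of_int_le_iff)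
      also have "\<dots> = (2 * n3 * real_of_int b + 1) ^ nE" by (simp add: cardI cardB n3_def)
      also have "\<dots> \<le> (C11 * h) ^ nE"
      proof (rule power_mono)
        have "real_of_int b \<le> X + 2" unfolding b_def by linarith
        also have "\<dots> \<le> (C10 + 2) * h" using Xh h by (simp add: distrib_right)
        finally have "2 * n3 * real_of_int b \<le> 2 * n3 * ((C10 + 2) * h)" using n3 by (intro mult_left_mono) auto
        then show "2 * n3 * real_of_int b + 1 \<le> C11 * h" using h by (simp add: C11_def algebra_simps)
        show "0 \<le> 2 * n3 * real_of_int b + 1" using n3 b1 by simp
      qed
      finally show ?thesis by (simp add: power_mult_distrib)
    qed
    have hE: "h ^ nE * h = (real Q + 1) ^ E" unfolding h_def E_def power_mult[symmetric] power_add[symmetric] by (simp add: algebra_simps)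
    have small: "C11 ^ nE * h ^ nE \<le> C * (real Q + 1) ^ E"
    proof -
      have "C11 ^ nE * 1 * 1 * 1 * (h ^ nE * 1) \<le> C11 ^ nE * n3 * norm l ^ d * K2 * (h ^ nE * h)"
        using C11n n3 ld K2 h by (intro mult_mono mult_nonneg_nonneg) auto
      then show ?thesis by (simp add: hE C_def)
    qed
    let ?E = "combo G Box (\<lambda>z. of_int (c z))"
    have vanish: "fps_nth ?E i = 0" if i: "i < N" for i
    proof (rule poly_eqI)
      fix j
      show "coeff (fps_nth ?E i) j = coeff 0 j"
      proof (cases "j \<le> B * N + mm")
        case True
        have "coeff (fps_nth ?E i) j = (\<Sum>z\<in>Box. of_int (c z) * coeff (fps_nth (Phi G z) i) j)"
          by (simp add: combo_def fps_sum_nth coeff_sum)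
        also have "\<dots> = of_int (\<Sum>z\<in>Box. a (i, j) z * c z)" by (simp add: a mult.commute)
        also have "\<dots> = 0" using c(2)[of "(i, j)"] i True by (simp add: I_def)
        finally show ?thesis by simp
      next
        case False
        have "B * i \<le> B * N" using i by simp
        then have j: "B * i + mm < j" using False by linarith
        have "coeff (fps_nth (Phi G z) i) j = 0" if "z \<in> Box" for z using bPhi[OF that] j by (simp add: bdf_def)
        then show ?thesis by (simp add: combo_def fps_sum_nth coeff_sum)
      qed
    qed
    have bE: "bdf (C * (real Q + 1) ^ E) e1 B mm ?E"
    proof -
      define M where "M = (C11 ^ nE * h ^ nE) * (norm S ^ d * K2)"
      have M0: "0 \<le> M" unfolding M_def using C11n h K2 by (intro mult_nonneg_nonneg) auto
      have "bdf M e1 B mm (fps_const [:of_int (c z):] * Phi G z)" if z: "z \<in> Box" for z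
      proof (rule bdf_mono[OF bdf_const_mult[OF bPhi[OF z], of "of_int (c z)"]])
        show "norm (complex_of_int (c z)) * (norm S ^ d * K2) \<le> M"
          unfolding M_def using cb[OF z] K2 by (intro mult_right_mono mult_nonneg_nonneg) auto
      qed auto
      then have "bdf (real (card Box) * M) e1 B mm ?E" unfolding combo_def using finB M0 by (intro bdf_sum) auto
      then show ?thesis
      proof (rule bdf_mono)
        have "real (card Box) * M = n3 * (C11 ^ nE * h ^ nE) * K2 * norm S ^ d" by (simp add: M_def n3_def cardB)
        also have "\<dots> \<le> n3 * (C11 ^ nE * h ^ nE) * K2 * (norm l ^ d * h)"
          using Sd n3 C11n h K2 by (intro mult_left_mono mult_nonneg_nonneg) auto
        also have "\<dots> = C * (h ^ nE * h)" by (simp add: C_def mult_ac)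
        finally show "real (card Box) * M \<le> C * (real Q + 1) ^ E" by (simp add: hE)
      qed auto
    qed
    show "\<exists>c :: _ \<Rightarrow> int. (\<exists>z\<in>Box. c z \<noteq> 0) \<and> (\<forall>z\<in>Box. real_of_int \<bar>c z\<bar> \<le> C * (real Q + 1) ^ E) \<and>
       (\<forall>i<N. fps_nth (combo (fps_const [:l * of_nat Q ^ e:] * F) Box (\<lambda>z. of_int (c z))) i = 0) \<and>
       bdf (C * (real Q + 1) ^ E) e1 B (d * (m + 1)) (combo (fps_const [:l * of_nat Q ^ e:] * F) Box (\<lambda>z. of_int (c z)))"
      unfolding S_def[symmetric] G_def[symmetric] mm_def[symmetric]
      using c(1) cb small vanish bE by (intro exI[of _ c] conjI ballI allI impI) (auto intro: order.trans)
  qed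
qed

context hecke_mahler
begin

text \<open>Each of X, Y and g occurs to a power at most d, so d copies of \<beta>^Q, \<beta>^q and
  \<beta>^(qD) clear the denominators. The hypothesis concerns x^m * g; multiplying by \<beta>^m
  removes x^m at the cost of m + 1 levels, which is O(Q).\<close>

lemma Z_combo_value:
  fixes g :: complex and c :: "nat \<times> nat \<times> nat \<Rightarrow> int"
  assumes u: "\<beta> ^ (q * degree f) * (x ^ m * g) \<in> Z (L * q)"
    and c: "\<And>z. z \<in> {..d} \<times> {..d} \<times> {..d} \<Longrightarrow> \<bar>c z\<bar> \<le> 2 ^ Q"
    and Q: "1 \<le> Q" "(d + 1) ^ 3 \<le> Q" and q: "q \<le> B * Q" and m: "m \<le> A * Q" and d: "1 \<le> d"
  shows "\<beta> ^ (d * (Q + q + q * degree f)) *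
      (\<Sum>z\<in>{..d} \<times> {..d} \<times> {..d}. of_int (c z) * ((x ^ Q) ^ fst z * (x ^ q) ^ fst (snd z) * g ^ snd (snd z)))
    \<in> Z (d * Q * (8 + B + B * degree f + L * B + A))"
proof -
  define D where "D = degree f"
  define Box where "Box = {..d} \<times> {..d} \<times> {..d}"
  define v where "v = \<beta> ^ m * (\<beta> ^ (q * D) * (x ^ m * g))"
  have v: "v = \<beta> ^ (q * D) * g"
  proof -
    have "v = (\<beta> ^ m * x ^ m) * (\<beta> ^ (q * D) * g)" by (simp add: v_def mult_ac)
    then show ?thesis using beta_power_x[of m m] by simp
  qed
  have vZ: "v \<in> Z (m + 1 + L * q)" unfolding v_def D_def by (rule Z_mult[OF Z_beta_power u])
  define T where "T = d * Q + d * q + d * (q * D) + d * (m + 1 + L * q) + 4 + Q"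
  have trm: "\<beta> ^ (d * (Q + q + q * D)) * (of_int (c z) * ((x ^ Q) ^ fst z * (x ^ q) ^ fst (snd z) * g ^ snd (snd z))) \<in> Z T"
    if z: "z \<in> Box" for z
  proof -
    obtain a b t where [simp]: "z = (a, b, t)" by (cases z) auto
    have abt: "a \<le> d" "b \<le> d" "t \<le> d" using z by (auto simp: Box_def)
    have pw: "\<beta> ^ (d * n) * (x ^ n) ^ k = \<beta> ^ (n * (d - k))" if "k \<le> d" for n k
    proof -
      have "n * k \<le> d * n" using that by (simp add: mult.commute)
      moreover have "d * n - n * k = n * (d - k)" by (simp add: diff_mult_distrib2 mult.commute)
      ultimately show ?thesis using beta_power_x[of "n * k" "d * n"] by (simp add: power_mult[symmetric])
    qed
    have gt: "\<beta> ^ (d * (q * D)) * g ^ t = \<beta> ^ (q * D * (d - t)) * v ^ t"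
    proof -
      have "d * (q * D) = q * D * (d - t) + q * D * t" using abt(3) by (simp flip: distrib_left)
      then show ?thesis unfolding v power_mult_distrib by (simp add: power_add power_mult[symmetric])
    qed
    have "\<beta> ^ (d * (Q + q + q * D)) * (of_int (c z) * ((x ^ Q) ^ a * (x ^ q) ^ b * g ^ t)) =
        of_int (c z) * ((\<beta> ^ (d * Q) * (x ^ Q) ^ a) * (\<beta> ^ (d * q) * (x ^ q) ^ b) * (\<beta> ^ (d * (q * D)) * g ^ t))"
      by (simp only: distrib_left power_add mult_ac)
    also have "\<dots> = of_int (c z) * (\<beta> ^ (Q * (d - a)) * \<beta> ^ (q * (d - b)) * (\<beta> ^ (q * D * (d - t)) * v ^ t))"
      by (simp only: pw abt gt)
    also have "\<dots> \<in> Z (Q + ((Q * (d - a) + 1) + (q * (d - b) + 1) + ((q * D * (d - t) + 1) + ((m + 1 + L * q) * t + 1))))"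
    proof (intro Z_mult Z_beta_power Z_power vZ)
      show "of_int (c z) \<in> Z Q" using c[of z] z Q(1) unfolding Box_def by (intro Z_int)
    qed
    also have "\<dots> \<subseteq> Z T"
    proof (rule Z_mono)
      have "n * k \<le> d * n" if "k \<le> d" for n k using mult_le_mono2[OF that, of n] by (simp only: mult.commute[of d n])
      from this[of "d - a" Q] this[of "d - b" q] this[of "d - t" "q * D"] this[OF abt(3), of "m + 1 + L * q"]
      show "Q + ((Q * (d - a) + 1) + (q * (d - b) + 1) + ((q * D * (d - t) + 1) + ((m + 1 + L * q) * t + 1))) \<le> T"
        unfolding T_def by linarith
    qed
    finally show ?thesis by simp
  qed
  have "\<beta> ^ (d * (Q + q + q * D)) * (\<Sum>z\<in>Box. of_int (c z) * ((x ^ Q) ^ fst z * (x ^ q) ^ fst (snd z) * g ^ snd (snd z))) \<in> Z (T + card Box)"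
    unfolding sum_distrib_left by (rule Z_sum) (use trm in \<open>auto simp: Box_def T_def\<close>)
  then show ?thesis unfolding D_def[symmetric] Box_def[symmetric]
  proof (rule Z_le)
    have "card Box = (d + 1) ^ 3" by (simp add: Box_def power3_eq_cube)
    then have cB: "card Box \<le> Q" using Q(2) by (simp only:)
    have dQ: "Q \<le> d * Q" "4 \<le> 4 * (d * Q)" "d \<le> d * Q" using d Q(1) by auto
    have 1: "d * q \<le> d * (B * Q)" using q by (rule mult_le_mono2)
    have 2: "d * (q * D) \<le> d * ((B * Q) * D)" using q by (intro mult_le_mono2 mult_le_mono1)
    have 3: "d * m \<le> d * (A * Q)" using m by (rule mult_le_mono2)
    have 4: "d * (L * q) \<le> d * (L * (B * Q))" using q by (intro mult_le_mono2)
    have "T + card Box \<le> d * Q + d * (B * Q) + d * ((B * Q) * D) + (d * (A * Q) + d * Q + d * (L * (B * Q))) + 4 * (d * Q) + d * Q + d * Q"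
      using cB dQ 1 2 3 4 unfolding T_def distrib_left mult_1_right by linarith
    also have "\<dots> = d * Q * (8 + B + B * D + L * B + A)" by (simp add: distrib_left mult_ac)
    finally show "T + card Box \<le> d * Q * (8 + B + B * D + L * B + A)" .
  qed
qed

end

lemma eventually_poly_power_less:
  fixes C \<rho> \<epsilon> :: real
  assumes "0 \<le> \<rho>" "\<rho> < 1" "0 < \<epsilon>"
  shows "\<forall>\<^sub>F Q in sequentially. C * (real Q + 1) ^ E * \<rho> ^ Q < \<epsilon>"
proof -
  have "(\<lambda>Q. C * ((real Q + 1) ^ E * \<rho> ^ Q)) \<longlonglongrightarrow> 0"
    by (intro tendsto_mult_right_zero poly_power_tendsto_0 assms)
  then have "\<forall>\<^sub>F Q in sequentially. C * ((real Q + 1) ^ E * \<rho> ^ Q) < \<epsilon>" using assms(3) by (rule order_tendstoD)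
  then show ?thesis by (simp only: mult.assoc)
qed

context hecke_mahler
begin

text \<open>The value V of the auxiliary function is nonzero by its dominant monomial, hence at
  least \<delta>^(dQ) by Liouville's bound, but smaller by its order of vanishing.\<close>

theorem contradiction: False
proof -
  obtain c1 where c1: "badly_approximable c1" using badly_approximable_theta by blast
  define c where "c = min c1 1"
  have c: "badly_approximable c" "c \<le> 1"
  proof -
    have "c / of_int w \<le> c1 / of_int w" if "0 < w" for w :: int
      using that by (intro divide_right_mono) (auto simp: c_def)
    then show "badly_approximable c" "c \<le> 1"
      using c1 unfolding badly_approximable_def by (auto simp: c_def intro: order.trans)
  qed
  have c0: "0 < c" using c by (simp add: badly_approximable_def)
  show False
  proof (rule pair_data_exists[OF c])
    fix K cp e l L A
    assume K: "0 < K" and cp: "0 < cp" and l: "1 \<le> norm l" and A: "0 \<le> A" and "l \<in> \<int>"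
      and data: "\<And>k. \<exists>d. pair_data c K cp e l L A d \<and> k \<le> fst d"
    define D where "D = degree f"
    define r where "r = norm x"
    have r: "0 < r" "r < 1" using norm_x by (auto simp: r_def)
    define B where "B = nat \<lceil>1 / c\<rceil>"
    have B: "1 / c \<le> real B" unfolding B_def by (rule real_nat_ceiling_ge)
    define An where "An = nat \<lceil>A\<rceil>"
    have An: "A \<le> real An" unfolding An_def by (rule real_nat_ceiling_ge)
    define A7 where "A7 = 8 + B + B * D + L * B + An"
    define A8 where "A8 = 1 + B + B * D"
    \<comment> \<open>Per unit of d * Q, \<open>A7\<close> is the level of the cleared value and
      \<open>A8\<close> the exponent of the power of \<beta> that clears it.\<close>
    define \<delta> where "\<delta> = \<kappa> ^ A7 * r ^ A8"
    have delta: "0 < \<delta>" using kappa r by (simp add: \<delta>_def)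
    \<comment> \<open>Vanishing to order n * d gives the factor (r^n)^(dQ). The margin 4 leaves
      4^(-dQ), which absorbs the power of Q in the coefficients.\<close>
    obtain n0 where n0: "r ^ n0 < \<delta> / 4" using real_arch_pow_inv[of "\<delta> / 4" r] delta r by auto
    define n where "n = n0 + 1"
    have n: "r ^ n \<le> \<delta> / 4"
    proof -
      have "r ^ n \<le> r ^ n0" unfolding n_def using r by (intro power_decreasing) auto
      then show ?thesis using n0 by simp
    qed
    \<comment> \<open>With N = n * d this makes the number of equations at most d^3.\<close>
    define d where "d = n * (B * n + D + 3)"
    have d1: "1 \<le> d" by (simp add: d_def n_def)
    define N where "N = n * d"
    have count: "N * (B * N + d * ((D + 1) + 1) + 1) < (d + 1) ^ 3"
    proof -
      have "B * N + d * ((D + 1) + 1) + 1 \<le> B * N + d * ((D + 1) + 1) + d" using d1 by simp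
      also have "\<dots> = d * (B * n + D + 3)" by (simp add: N_def distrib_left mult_ac)
      finally have "N * (B * N + d * ((D + 1) + 1) + 1) \<le> N * (d * (B * n + D + 3))" by (rule mult_le_mono2)
      also have "\<dots> = d ^ 3" by (simp add: N_def d_def power3_eq_cube mult_ac)
      also have "\<dots> < (d + 1) ^ 3" by (intro power_strict_mono) auto
      finally show ?thesis .
    qed
    define Box where "Box = {..d} \<times> {..d} \<times> {..d}"
    have finB: "finite Box" by (simp add: Box_def)
    obtain C E e1 where "0 \<le> C \<and> (\<forall>Q F. 1 \<le> Q \<and> bdf K e B (D + 1) F \<and> intf (fps_const [:l * of_nat Q ^ e:] * F) \<longrightarrow>
      (\<exists>c :: _ \<Rightarrow> int. (\<exists>z\<in>Box. c z \<noteq> 0) \<and> (\<forall>z\<in>Box. real_of_int \<bar>c z\<bar> \<le> C * (real Q + 1) ^ E) \<and>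
         (\<forall>i<N. fps_nth (combo (fps_const [:l * of_nat Q ^ e:] * F) Box (\<lambda>z. of_int (c z))) i = 0) \<and>
         bdf (C * (real Q + 1) ^ E) e1 B (d * ((D + 1) + 1)) (combo (fps_const [:l * of_nat Q ^ e:] * F) Box (\<lambda>z. of_int (c z)))))"
      using auxiliary_combination[OF l count, of K e, folded Box_def] by (elim exE) (rule that)
    note C = this[THEN conjunct1] and aux = this[THEN conjunct2, rule_format, OF conjI[OF _ conjI]]
    define mm where "mm = d * ((D + 1) + 1)"
    from data have "\<forall>k. \<exists>dt. pair_data c K cp e l L A dt \<and> k \<le> fst dt" by blast
    then obtain dt where dt: "\<And>k. pair_data c K cp e l L A (dt k)" "\<And>k. k \<le> fst (dt k)" by metis
    define Q where "Q k = fst (dt k)" for k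
    define q where "q k = fst (snd (dt k))" for k
    define m where "m k = fst (snd (snd (dt k)))" for k
    define th where "th k = fst (snd (snd (snd (dt k))))" for k
    define kap where "kap k = fst (snd (snd (snd (snd (dt k)))))" for k
    define b where "b k = fst (snd (snd (snd (snd (snd (dt k))))))" for k
    define w where "w k = snd (snd (snd (snd (snd (snd (dt k))))))" for k
    have pd: "pair_data c K cp e l L A (Q k, q k, m k, th k, kap k, b k, w k)" for k
      using dt(1)[of k] by (simp add: Q_def q_def m_def th_def kap_def b_def w_def)
    note pd' = pd[unfolded pair_data_def case_prod_conv]
    have Qk: "k \<le> Q k" for k unfolding Q_def by (rule dt(2))
    note r1 = pd'[THEN conjunct2]
    note r2 = r1[THEN conjunct2]
    note r3 = r2[THEN conjunct2]
    note r4 = r3[THEN conjunct2]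
    note r5 = r4[THEN conjunct2]
    note r6 = r5[THEN conjunct2]
    note r7 = r6[THEN conjunct2]
    note r8 = r7[THEN conjunct2]
    note r9 = r8[THEN conjunct2]
    note r10 = r9[THEN conjunct2]
    note r11 = r10[THEN conjunct2]
    note r12 = r11[THEN conjunct2]
    note r13 = r12[THEN conjunct2]
    note r14 = r13[THEN conjunct2]
    note r15 = r14[THEN conjunct2]
    note r16 = r15[THEN conjunct2]
    note Q1 = pd'[THEN conjunct1] and cq = r2[THEN conjunct1] and mA = r3[THEN conjunct1]
      and th = r4[THEN conjunct1] r5[THEN conjunct1] and kap = r6[THEN conjunct1] r7[THEN conjunct1]
      and b1 = r8[THEN conjunct1, rule_format] and b2 = r9[THEN conjunct1, rule_format] and degw = r10[THEN conjunct1, rule_format]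
      and intw = r11[THEN conjunct1, rule_format] and boundw = r12[THEN conjunct1, rule_format] and posw = r13[THEN conjunct1, rule_format]
      and indep = r14[THEN conjunct1, rule_format] and sep = r15[THEN conjunct1, rule_format, OF conjI] and val = r16
    have qB: "q k \<le> B * Q k" for k
    proof -
      have "real (q k) \<le> 1 / c * real (Q k)" using cq[of k] c0 by (simp add: le_divide_eq mult.commute)
      also have "\<dots> \<le> real B * real (Q k)" using B by (intro mult_right_mono) auto
      finally show ?thesis by (simp flip: of_nat_mult)
    qed
    have mAn: "m k \<le> An * Q k" for k
    proof -
      have "real (m k) \<le> real An * real (Q k)" using mA[of k] mult_right_mono[OF An, of "real (Q k)"] by simp
      then show ?thesis by (simp flip: of_nat_mult)
    qed
    \<comment> \<open>Dividing by this gives weights whose size, and whose lower bound on the real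
      part of the constant coefficient, do not depend on Q.\<close>
    define S where "S k = l * of_nat (Q k) ^ e" for k
    have normS: "norm (S k) = norm l * real (Q k) ^ e" for k by (simp add: S_def norm_mult norm_power)
    have Qe: "0 < real (Q k) ^ e" for k using Q1[of k] by simp
    have S0: "S k \<noteq> 0" for k
    proof -
      have "0 < norm (S k)" unfolding normS using l Qe[of k] by (intro mult_pos_pos) auto
      then show ?thesis by auto
    qed
    define wh where "wh k i = smult (1 / S k) (w k i)" for k i
    define Gh where "Gh k = Abs_fps (\<lambda>i. monom 1 (b k i) * wh k i)" for k
    define G where "G k = fps_const [:S k:] * Gh k" for k
    have G_eq: "G k = Abs_fps (\<lambda>i. monom 1 (b k i) * w k i)" for k
      unfolding G_def Gh_def wh_def using S0[of k] by (intro fps_ext) (simp add: smult_monom mult_smult_right)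
    have whb: "norm (coeff (wh k i) j) \<le> K * (real i + 1) ^ e" for k i j
    proof -
      have "norm (coeff (w k i) j) \<le> K * (real i + 1) ^ e * real (Q k) ^ e" using boundw[of k i j] by (simp add: mult_ac)
      also have "\<dots> \<le> K * (real i + 1) ^ e * norm (S k)"
      proof (rule mult_left_mono)
        have "1 * real (Q k) ^ e \<le> norm l * real (Q k) ^ e" using l by (intro mult_right_mono) auto
        then show "real (Q k) ^ e \<le> norm (S k)" by (simp add: normS)
      qed (use K in auto)
      finally show ?thesis using S0[of k] by (simp add: wh_def norm_mult norm_divide divide_le_eq mult_ac)
    qed
    have whpos: "cp \<le> Re (coeff (wh k i) 0)" for k i
    proof -
      have "coeff (wh k i) 0 = (coeff (w k i) 0 / l) / complex_of_real (real (Q k) ^ e)" by (simp add: wh_def S_def)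
      then have "Re (coeff (wh k i) 0) = Re (coeff (w k i) 0 / l) / (real (Q k) ^ e)" by (simp only: Re_divide_of_real)
      then show ?thesis using posw[of k i] Qe[of k] by (simp add: le_divide_eq)
    qed
    have degwh: "degree (wh k i) \<le> D" for k i unfolding wh_def D_def by (rule order.trans[OF degree_smult_le degw])
    have bB: "b k i \<le> B * i + 1" for k i
    proof -
      have "real (b k i) \<le> real i * real B + 1"
        using b2[of k i] kap[of k] th(2)[of k] B mult_left_mono[of "th k" "real B" "real i"] by linarith
      then have "real (b k i) \<le> real (B * i + 1)" by (simp add: mult.commute)
      then show ?thesis by (simp only: of_nat_le_iff)
    qed
    have bGh: "bdf K e B (D + 1) (Gh k)" for k
      unfolding bdf_def
    proof (intro allI conjI impI)
      fix i j
      show "norm (coeff (fps_nth (Gh k) i) j) \<le> K * (real i + 1) ^ e"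
        using whb[of k i] K by (simp add: Gh_def coeff_monom_mult)
      assume "B * i + (D + 1) < j"
      then have "j - b k i > D" using bB[of k i] by linarith
      then have "coeff (wh k i) (j - b k i) = 0" using degwh[of k i] by (intro coeff_eq_0) linarith
      then show "coeff (fps_nth (Gh k) i) j = 0" by (simp add: Gh_def coeff_monom_mult)
    qed
    have iG: "intf (G k)" for k
      unfolding G_eq intf_def using intw by (auto simp: coeff_monom_mult)
    have "\<forall>k. \<exists>cc :: _ \<Rightarrow> int. (\<exists>z\<in>Box. cc z \<noteq> 0) \<and> (\<forall>z\<in>Box. real_of_int \<bar>cc z\<bar> \<le> C * (real (Q k) + 1) ^ E) \<and>
         (\<forall>i<N. fps_nth (combo (G k) Box (\<lambda>z. of_int (cc z))) i = 0) \<and>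
         bdf (C * (real (Q k) + 1) ^ E) e1 B mm (combo (G k) Box (\<lambda>z. of_int (cc z)))"
    proof
      fix k
      show "\<exists>cc :: _ \<Rightarrow> int. (\<exists>z\<in>Box. cc z \<noteq> 0) \<and> (\<forall>z\<in>Box. real_of_int \<bar>cc z\<bar> \<le> C * (real (Q k) + 1) ^ E) \<and>
         (\<forall>i<N. fps_nth (combo (G k) Box (\<lambda>z. of_int (cc z))) i = 0) \<and>
         bdf (C * (real (Q k) + 1) ^ E) e1 B mm (combo (G k) Box (\<lambda>z. of_int (cc z)))"
        unfolding G_def S_def mm_def by (rule aux[OF Q1 bGh iG[unfolded G_def S_def]])
    qed
    from choice[OF this] obtain cc :: "nat \<Rightarrow> nat \<times> nat \<times> nat \<Rightarrow> int" where cc: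
      "\<forall>k. (\<exists>z\<in>Box. cc k z \<noteq> 0) \<and> (\<forall>z\<in>Box. real_of_int \<bar>cc k z\<bar> \<le> C * (real (Q k) + 1) ^ E) \<and>
         (\<forall>i<N. fps_nth (combo (G k) Box (\<lambda>z. of_int (cc k z))) i = 0) \<and>
         bdf (C * (real (Q k) + 1) ^ E) e1 B mm (combo (G k) Box (\<lambda>z. of_int (cc k z)))" by blast
    define F where "F k = combo (G k) Box (\<lambda>z. of_int (cc k z))" for k
    have cc_nz: "\<exists>z\<in>Box. cc k z \<noteq> 0" and cc_b: "z \<in> Box \<Longrightarrow> real_of_int \<bar>cc k z\<bar> \<le> C * (real (Q k) + 1) ^ E"
      and F_zero: "i < N \<Longrightarrow> fps_nth (F k) i = 0" and F_bdf: "bdf (C * (real (Q k) + 1) ^ E) e1 B mm (F k)" for k z i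
      using cc unfolding F_def by blast+
    \<comment> \<open>In terms of the normalised series the coefficients are cc * S^t and may grow
      with k. Division by their total keeps them in a compact set and away from 0.\<close>
    define N1 where "N1 k = (\<Sum>z\<in>Box. norm (of_int (cc k z) * S k ^ snd (snd z)))" for k
    have N1: "0 < N1 k" for k
    proof -
      obtain z where z: "z \<in> Box" "cc k z \<noteq> 0" using cc_nz by blast
      have "0 < norm (of_int (cc k z) * S k ^ snd (snd z))" using z(2) S0[of k] by simp
      also have "\<dots> \<le> N1 k" unfolding N1_def using z(1) finB by (intro member_le_sum) auto
      finally show ?thesis .
    qed
    define cn where "cn k z = of_int (cc k z) * S k ^ snd (snd z) / of_real (N1 k)" for k z
    have cn1: "(\<Sum>z\<in>Box. norm (cn k z)) = 1" for k
    proof -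
      have "(\<Sum>z\<in>Box. norm (cn k z)) = (\<Sum>z\<in>Box. norm (of_int (cc k z) * S k ^ snd (snd z)) / N1 k)"
        unfolding cn_def norm_divide norm_of_real using N1[of k] by simp
      also have "\<dots> = N1 k / N1 k" by (simp only: N1_def sum_divide_distrib)
      finally show ?thesis using N1[of k] by simp
    qed
    have F_scale: "F k = fps_const [:of_real (N1 k):] * combo (Gh k) Box (cn k)" for k
      unfolding F_def G_def cn_def using N1[of k] by (intro combo_scale) simp
    have thB: "th k \<le> real B" for k using th(2)[of k] B by linarith
    have "\<exists>i j. \<exists>\<^sub>F k in sequentially. coeff (fps_nth (combo (Abs_fps (\<lambda>i. monom 1 (b k i) * wh k i)) Box (cn k)) i) j \<noteq> 0"
    proof (rule uniform_nonvanishing[OF th(1) thB kap _ b1 b2 degwh whb cp whpos finB cn1])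
      fix u v :: int assume u: "u \<noteq> 0"
      have "0 < c ^ 2 / real_of_int (\<bar>u\<bar> + \<bar>v\<bar>)" using u c0 by (intro divide_pos_pos) auto
      then show "\<exists>\<epsilon>>0. \<forall>\<^sub>F k in sequentially. \<epsilon> \<le> \<bar>of_int u * th k + of_int v\<bar>"
        using indep[OF u] by (intro exI[of _ "c ^ 2 / real_of_int (\<bar>u\<bar> + \<bar>v\<bar>)"]) auto
    qed
    \<comment> \<open>The position (i0, j0) is independent of k, so the constants below that depend
      on it are uniform in Q.\<close>
    then obtain i0 j0 where freq: "\<exists>\<^sub>F k in sequentially. coeff (fps_nth (combo (Gh k) Box (cn k)) i0) j0 \<noteq> 0"
      unfolding Gh_def by blast
    define Ai where "Ai = i0 + B * j0"
    define J where "J = B * Ai + mm"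
    define \<delta>' where "\<delta>' = c ^ 2 / (real Ai + real J + 1)"
    have delta': "0 < \<delta>'" "\<delta>' \<le> 1"
    proof -
      show "0 < \<delta>'" unfolding \<delta>'_def using c0 by (intro divide_pos_pos) auto
      have "c ^ 2 \<le> 1" using c0 c(2) by (intro power_le_one) auto
      then show "\<delta>' \<le> 1" unfolding \<delta>'_def by (simp add: divide_le_eq)
    qed
    have "\<exists>C'\<ge>0. \<forall>M E Q q. bdf M e1 B mm E \<longrightarrow> intf E \<longrightarrow> coeff (fps_nth E i0) j0 \<noteq> 0 \<longrightarrow>
         1 \<le> Q \<longrightarrow> q \<le> B * Q \<longrightarrow>
         (\<forall>u v :: int. u \<noteq> 0 \<or> v \<noteq> 0 \<longrightarrow> \<bar>u\<bar> \<le> int Ai \<longrightarrow> \<bar>v\<bar> \<le> int J \<longrightarrow> \<delta>' * real Q \<le> \<bar>of_int (u * int Q + v * int q)\<bar>) \<longrightarrow>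
         M * C' * (norm x powr \<delta>') ^ Q < 1 \<longrightarrow> eval_fps (fev (x ^ q) E) (x ^ Q) \<noteq> 0"
      unfolding Ai_def J_def intf_def
    proof (rule leading_monomial_nonzero[OF norm_x delta', of e1 B mm i0 j0], goal_cases)
      case (1 C)
      show ?case by (intro exI[of _ C] conjI 1(1) allI impI, erule 1(2)) (assumption | blast)+
    qed
    then obtain C14 where C14: "0 \<le> C14" "\<forall>M E Q q. bdf M e1 B mm E \<longrightarrow> intf E \<longrightarrow> coeff (fps_nth E i0) j0 \<noteq> 0 \<longrightarrow>
         1 \<le> Q \<longrightarrow> q \<le> B * Q \<longrightarrow>
         (\<forall>u v :: int. u \<noteq> 0 \<or> v \<noteq> 0 \<longrightarrow> \<bar>u\<bar> \<le> int Ai \<longrightarrow> \<bar>v\<bar> \<le> int J \<longrightarrow> \<delta>' * real Q \<le> \<bar>of_int (u * int Q + v * int q)\<bar>) \<longrightarrow>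
         M * C14 * (norm x powr \<delta>') ^ Q < 1 \<longrightarrow> eval_fps (fev (x ^ q) E) (x ^ Q) \<noteq> 0" by (elim exE conjE) (rule that)
    have "\<exists>C8\<ge>0. \<forall>M E y X. bdf M e1 B mm E \<longrightarrow> norm y \<le> 1 \<longrightarrow> norm X \<le> r \<longrightarrow>
         norm (eval_fps (fev y E) X - (\<Sum>i<N. poly (fps_nth E i) y * X ^ i)) \<le> M * C8 * norm X ^ N"
    proof (rule eval_fps_tail[of r e1 B mm N], goal_cases)
      case (3 C)
      show ?case by (intro exI[of _ C] conjI 3(1) allI impI, erule 3(2)) assumption+
    qed (use r in auto)
    then obtain C8 where C8: "0 \<le> C8" "\<And>M E y X. bdf M e1 B mm E \<Longrightarrow> norm y \<le> 1 \<Longrightarrow> norm X \<le> r \<Longrightarrow>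
         norm (eval_fps (fev y E) X - (\<Sum>i<N. poly (fps_nth E i) y * X ^ i)) \<le> M * C8 * norm X ^ N" by blast
    define \<rho> where "\<rho> = norm x powr \<delta>'"
    have rho: "0 \<le> \<rho>" "\<rho> < 1" unfolding \<rho>_def using powr_less_mono2[OF delta'(1) norm_ge_zero norm_x(2)] by auto
    \<comment> \<open>In order: the coefficients are at most 2^Q, the upper bound for V beats
      Liouville's, the lowest monomial dominates, the box has at most Q elements, and
      \<open>exponent_separation\<close> applies.\<close>
    have "\<forall>\<^sub>F n in sequentially. C * (real n + 1) ^ E * (1 / 2) ^ n < 1 \<and> (C * C8) * (real n + 1) ^ E * (1 / 4) ^ n < 1 \<and>
        (C * C14) * (real n + 1) ^ E * \<rho> ^ n < 1 \<and> (d + 1) ^ 3 \<le> n \<and> nat \<lceil>(real Ai + real J + 1) / c\<rceil> + 1 \<le> n"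
      by (intro eventually_conj eventually_poly_power_less eventually_ge_at_top rho) auto
    then obtain k0 where k0: "\<And>n. k0 \<le> n \<Longrightarrow> C * (real n + 1) ^ E * (1 / 2) ^ n < 1 \<and> (C * C8) * (real n + 1) ^ E * (1 / 4) ^ n < 1 \<and>
        (C * C14) * (real n + 1) ^ E * \<rho> ^ n < 1 \<and> (d + 1) ^ 3 \<le> n \<and> nat \<lceil>(real Ai + real J + 1) / c\<rceil> + 1 \<le> n"
      unfolding eventually_sequentially by (elim exE) (rule that, drule spec, erule mp)
    have "\<exists>k\<ge>k0. coeff (fps_nth (combo (Gh k) Box (cn k)) i0) j0 \<noteq> 0"
      using freq unfolding frequently_sequentially by blast
    then obtain k where k: "k0 \<le> k" "coeff (fps_nth (combo (Gh k) Box (cn k)) i0) j0 \<noteq> 0" by blast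
    have kQ: "k0 \<le> Q k" using k(1) Qk[of k] by simp
    define M where "M = C * (real (Q k) + 1) ^ E"
    from k0[OF kQ] have big: "M * (1 / 2) ^ Q k < 1" "M * C8 * (1 / 4) ^ Q k < 1" "M * C14 * \<rho> ^ Q k < 1"
        "(d + 1) ^ 3 \<le> Q k" "nat \<lceil>(real Ai + real J + 1) / c\<rceil> + 1 \<le> Q k"
      unfolding M_def by (auto simp: mult_ac)
    define V where "V = eval_fps (fev (x ^ q k) (F k)) (x ^ Q k)"
    have Vnz: "V \<noteq> 0"
    proof -
      have "coeff (fps_nth (F k) i0) j0 \<noteq> 0" unfolding F_scale using k(2) N1[of k] by simp
      moreover have "intf (F k)" unfolding F_def by (rule intf_combo[OF iG]) auto
      moreover have "\<forall>u v :: int. u \<noteq> 0 \<or> v \<noteq> 0 \<longrightarrow> \<bar>u\<bar> \<le> int Ai \<longrightarrow> \<bar>v\<bar> \<le> int J \<longrightarrow> \<delta>' * real (Q k) \<le> \<bar>of_int (u * int (Q k) + v * int (q k))\<bar>"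
      proof (intro allI impI)
        fix u v :: int assume uv: "u \<noteq> 0 \<or> v \<noteq> 0" "\<bar>u\<bar> \<le> int Ai" "\<bar>v\<bar> \<le> int J"
        define t where "t = real_of_int (\<bar>u\<bar> + \<bar>v\<bar>)"
        have t: "1 \<le> t" "t \<le> real Ai + real J + 1" using uv unfolding t_def by linarith+
        have "(real Ai + real J + 1) / c \<le> real (nat \<lceil>(real Ai + real J + 1) / c\<rceil>)" by (rule real_nat_ceiling_ge)
        also have "\<dots> < real (Q k)" using big(5) by linarith
        finally have "real Ai + real J + 1 < c * real (Q k)" using c0 by (simp add: divide_less_eq mult.commute)
        then have "c ^ 2 / t * real (Q k) \<le> \<bar>of_int (u * int (Q k) + v * int (q k))\<bar>"
          unfolding t_def using t by (intro sep uv(1)) (simp add: t_def)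
        moreover have "\<delta>' * real (Q k) \<le> c ^ 2 / t * real (Q k)"
          unfolding \<delta>'_def using t c0 by (intro mult_right_mono divide_left_mono mult_pos_pos) auto
        ultimately show "\<delta>' * real (Q k) \<le> \<bar>of_int (u * int (Q k) + v * int (q k))\<bar>" by linarith
      qed
      moreover have "M * C14 * (norm x powr \<delta>') ^ Q k < 1" using big(3) unfolding \<rho>_def .
      ultimately show ?thesis unfolding V_def
        using C14(2)[rule_format, OF F_bdf _ _ Q1 qB] unfolding M_def by simp
    qed
    define g where "g = eval_fps (fev (x ^ q k) (G k)) (x ^ Q k)"
    have nx: "norm (x ^ q k) \<le> 1" unfolding norm_power using norm_x by (intro power_le_one) auto
    have nX: "norm (x ^ Q k) \<le> r"
    proof -
      have "r ^ Q k \<le> r ^ 1" using r Q1[of k] by (intro power_decreasing) auto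
      then show ?thesis by (simp add: norm_power r_def)
    qed
    have bG: "bdf (norm (S k) * K) e B (D + 1) (G k)" unfolding G_def by (rule bdf_const_mult[OF bGh])
    have "norm (x ^ Q k) < 1" using nX r by linarith
    then have "norm (x ^ Q k) < fps_conv_radius (fev (x ^ q k) (G k))" by (rule bdf_conv_radius[OF bG nx])
    then have V_sum: "V = (\<Sum>z\<in>Box. of_int (cc k z) * ((x ^ Q k) ^ fst z * (x ^ q k) ^ fst (snd z) * g ^ snd (snd z)))"
      unfolding V_def F_def g_def using eval_combo[OF finB] by blast
    define Wt where "Wt = d * (Q k + q k + q k * D)"
    have VZ: "\<beta> ^ Wt * V \<in> Z (d * Q k * A7)"
      unfolding V_sum Box_def Wt_def A7_def D_def
    proof (rule Z_combo_value[OF _ _ Q1 big(4) qB mAn d1])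
      show "\<beta> ^ (q k * degree f) * (x ^ m k * g) \<in> Z (L * q k)" using val[of k] unfolding g_def G_eq .
      fix z assume "z \<in> {..d} \<times> {..d} \<times> {..d}"
      then have "real_of_int \<bar>cc k z\<bar> \<le> M" unfolding M_def using cc_b[of z k] by (simp add: Box_def)
      also have "M \<le> 2 ^ Q k" using big(1) by (simp add: power_one_over divide_less_eq)
      finally show "\<bar>cc k z\<bar> \<le> 2 ^ Q k" by (intro abs_le_power2_of_real) simp
    qed
    have "\<kappa> ^ (d * Q k * A7) \<le> norm (\<beta> ^ Wt * V)"
      using VZ Vnz beta0 d1 Q1[of k] by (intro Z_lower) (auto simp: A7_def)
    also have "\<dots> = norm \<beta> ^ Wt * norm V" by (simp add: norm_mult norm_power)
    also have "\<dots> \<le> norm \<beta> ^ (d * Q k * A8) * norm V"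
    proof (intro mult_right_mono power_increasing)
      have "d * (Q k + q k + q k * D) \<le> d * (Q k + B * Q k + (B * Q k) * D)"
        using qB[of k] by (intro mult_le_mono2 add_mono mult_le_mono1 order_refl)
      also have "\<dots> = d * Q k * A8" by (simp add: A8_def distrib_left mult_ac)
      finally show "Wt \<le> d * Q k * A8" unfolding Wt_def .
    qed (use beta in auto)
    finally have low: "\<kappa> ^ (d * Q k * A7) \<le> norm \<beta> ^ (d * Q k * A8) * norm V" .
    have rb: "r * norm \<beta> = 1" using beta0 by (simp add: r_def norm_inverse)
    have "\<delta> ^ (d * Q k) = \<kappa> ^ (d * Q k * A7) * r ^ (d * Q k * A8)"
      unfolding \<delta>_def power_mult_distrib by (simp only: power_mult[symmetric] mult.commute)
    also have "\<dots> \<le> (norm \<beta> ^ (d * Q k * A8) * norm V) * r ^ (d * Q k * A8)"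
      using low r by (intro mult_right_mono) auto
    also have "\<dots> = (r * norm \<beta>) ^ (d * Q k * A8) * norm V" by (simp only: power_mult_distrib mult_ac)
    also have "\<dots> = norm V" by (simp add: rb)
    finally have V_low: "\<delta> ^ (d * Q k) \<le> norm V" .
    have M0: "0 \<le> M" unfolding M_def using C by simp
    have "norm (V - (\<Sum>i<N. poly (fps_nth (F k) i) (x ^ q k) * (x ^ Q k) ^ i)) \<le> M * C8 * norm (x ^ Q k) ^ N"
      unfolding V_def M_def by (rule C8(2)[OF F_bdf nx nX])
    then have "norm V \<le> M * C8 * norm (x ^ Q k) ^ N" by (simp add: F_zero)
    also have "norm (x ^ Q k) ^ N = (r ^ n) ^ (d * Q k)"
      unfolding norm_power r_def N_def by (simp only: power_mult[symmetric] mult_ac)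
    also have "M * C8 * (r ^ n) ^ (d * Q k) \<le> M * C8 * (\<delta> / 4) ^ (d * Q k)"
      using n r M0 C8(1) by (intro mult_left_mono power_mono) auto
    also have "\<dots> = (M * C8 * (1 / 4) ^ (d * Q k)) * \<delta> ^ (d * Q k)" by (simp add: power_divide)
    finally have "1 * \<delta> ^ (d * Q k) \<le> (M * C8 * (1 / 4) ^ (d * Q k)) * \<delta> ^ (d * Q k)" using V_low by linarith
    then have "1 \<le> M * C8 * (1 / 4) ^ (d * Q k)" using delta by (subst (asm) mult_le_cancel_right_pos) auto
    also have "\<dots> \<le> M * C8 * (1 / 4) ^ Q k"
      using M0 C8(1) d1 by (intro mult_left_mono power_decreasing) auto
    also have "\<dots> < 1" by (rule big(2))
    finally show False by simp
  qed
qed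

end

theorem mainTheorem3:
  fixes \<theta> \<alpha> :: real and \<beta> :: complex and f :: "int poly"
  assumes "0 < \<theta>" "\<theta> < 1" "\<theta> \<notin> \<rat>"
    and "0 < \<alpha>" "\<alpha> < 1"
    and "algebraic \<beta>" "norm \<beta> > 1"
    and "degree f > 0"
  shows "summable (\<lambda>n::nat. of_int (poly f \<lfloor>real n * \<theta> + \<alpha>\<rfloor>) / \<beta> ^ n)
    \<and> \<not> algebraic (\<Sum>n::nat. of_int (poly f \<lfloor>real n * \<theta> + \<alpha>\<rfloor>) / \<beta> ^ n)"
proof -
  interpret irrational_rotation \<theta> \<alpha> by unfold_locales (use assms in auto)
  define S where "S = (\<Sum>n. of_int (poly f (s n)) * inverse \<beta> ^ n)"
  have term_eq: "of_int (poly f \<lfloor>real n * \<theta> + \<alpha>\<rfloor>) / \<beta> ^ n = of_int (poly f (s n)) * inverse \<beta> ^ n" for n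
    by (simp add: s_def divide_inverse power_inverse)
  have "norm (inverse \<beta>) < 1" using assms(7) by (simp add: norm_inverse inverse_less_1_iff)
  then interpret rotation_word s "inverse \<beta>" using s_range by unfold_locales auto
  have "\<not> algebraic S"
  proof
    assume "algebraic S"
    show False
    proof (rule liouville_filtration[OF assms(6) \<open>algebraic S\<close>])
      fix Z \<kappa> assume Z: "0 < \<kappa>" "\<kappa> \<le> 1"
        "\<And>L M. L \<le> M \<Longrightarrow> Z L \<subseteq> Z M"
        "\<And>L M u v. u \<in> Z L \<Longrightarrow> v \<in> Z M \<Longrightarrow> u * v \<in> Z (L + M)"
        "\<And>L u v. u \<in> Z L \<Longrightarrow> v \<in> Z L \<Longrightarrow> u + v \<in> Z (L + 1)"
        "\<And>L n. 1 \<le> L \<Longrightarrow> \<bar>n\<bar> \<le> 2 ^ L \<Longrightarrow> of_int n \<in> Z L"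
        "\<beta> \<in> Z 1" "S \<in> Z 1"
        "\<And>L \<rho>. 1 \<le> L \<Longrightarrow> \<rho> \<in> Z L \<Longrightarrow> \<rho> \<noteq> 0 \<Longrightarrow> \<kappa> ^ L \<le> norm \<rho>"
      have "filtration Z \<kappa> \<beta> S" by unfold_locales (fact Z)+
      then interpret filtration Z \<kappa> \<beta> S .
      have "hecke_mahler \<theta> \<alpha> Z \<kappa> \<beta> S f" using assms(7,8) S_def by unfold_locales
      then show False by (rule hecke_mahler.contradiction)
    qed
  qed
  then show ?thesis using summable_Ser(2)[of f] unfolding term_eq S_def by blast
qed

end
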